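(* Let $1<p<\infty$ and $z\in B_{\ell_p}$. Then there are $2^{\mathfrak c}$ different Gleason parts of $\mathcal M(\mathcal A_u(B_{\ell_p}))$ completely contained in the fiber $\mathcal M_z$. More precisely, denoting $s=(1-\|z\|^p)^{1/p}$, the set $$w^*\text{-}ac\{\delta_{\pi_n(z)+s e_{n+1}} : n\in\mathbb N\}\subset \mathcal M_z$$ has cardinality $2^{\mathfrak c}$, and each $\varphi$ in this set belongs to a different Gleason part (i.e. distinct elements of this set lie in distinct Gleason parts). Moreover, $\mathcal{GP}(\varphi)\subset \mathcal M_z$ for every such $\varphi$.
   Context: $\ell_p$ is the complex sequence space with canonical vectors $(e_n)$; $B_{\ell_p}$ and $\overline B_{\ell_p}$ are its open and closed unit balls. $\mathcal A_u(B_{\ell_p})$ is the Banach algebra, with the supremum norm, of all uniformly continuous holomorphic functions $f:B_{\ell_p}\to\mathbb C$; each such $f$ extends continuously to $\overline B_{\ell_p}$. $\mathcal M(\mathcal A_u(B_{\ell_p}))$ is its spectrum: the set of all non-zero multiplicative linear functionals, with the $w^*$-topology inherited from $\mathcal A_u(B_{\ell_p})'$. For $x\in\overline B_{\ell_p}$, $\delta_x$ is the evaluation $\delta_x(f)=f(x)$. Since $1<p<\infty$, $\ell_p$ is reflexive, and the fiber over $z\in\overline B_{\ell_p}$ is $\mathcal M_z=\{\varphi\in\mathcal M(\mathcal A_u(B_{\ell_p})): \varphi(x')=x'(z)\text{ for all }x'\in \ell_p'\}$ (continuous linear functionals being regarded as elements of $\mathcal A_u(B_{\ell_p})$). The Gleason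 part of $\varphi$ is $\mathcal{GP}(\varphi)=\{\psi\in\mathcal M(\mathcal A_u(B_{\ell_p})): \|\varphi-\psi\|<2\}$, where $\|\varphi-\psi\|=\sup\{|\varphi(f)-\psi(f)|:\|f\|\le1\}$; Gleason parts are the classes of an equivalence relation. For a sequence $z=(z(i))_i$, $\pi_n(z)=(z(1),\dots,z(n),0,0,\dots)$. For a net (in particular a sequence) $(\varphi_\alpha)_{\alpha\in I}$ in the spectrum, $w^*\text{-}ac\{\varphi_\alpha:\alpha\in I\}$ is the set of all $w^*$-accumulation (cluster) points of the net. $\mathfrak c$ is the cardinality of the continuum. *)

theory Defs
  imports "HOL-Analysis.Analysis" "HOL-Library.Equipollence"
begin

text \<open>
  The exponent \<open>p\<close> is a real parameter, so \<open>\<ell>\<^sub>p\<close> is a carrier set of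
  sequences (with coordinates indexed from \<open>0\<close>) and not a type. Functions with a restricted domain
  are represented by extensional functions, so that equality and cardinality are those of functions
  on that domain.
\<close>

definition lp :: "real \<Rightarrow> (nat \<Rightarrow> complex) set" where
  "lp p = {x. summable (\<lambda>i. norm (x i) powr p)}"

definition lp_norm :: "real \<Rightarrow> (nat \<Rightarrow> complex) \<Rightarrow> real" where
  "lp_norm p x = (\<Sum>i. norm (x i) powr p) powr (1 / p)"

definition lp_ball :: "real \<Rightarrow> (nat \<Rightarrow> complex) set" where
  "lp_ball p = {x \<in> lp p. lp_norm p x < 1}"

definition lp_dist :: "real \<Rightarrow> (nat \<Rightarrow> complex) \<Rightarrow> (nat \<Rightarrow> complex) \<Rightarrow> real" where
  "lp_dist p x y = lp_norm p (\<lambda>i. x i - y i)"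

text \<open>The functionals are only constrained on \<open>lp p\<close>; they are used through their values there.\<close>

definition lp_dual :: "real \<Rightarrow> ((nat \<Rightarrow> complex) \<Rightarrow> complex) set" where
  "lp_dual p = {L.
     (\<forall>x\<in>lp p. \<forall>y\<in>lp p. L (\<lambda>i. x i + y i) = L x + L y) \<and>
     (\<forall>c. \<forall>x\<in>lp p. L (\<lambda>i. c * x i) = c * L x) \<and>
     (\<exists>K. \<forall>x\<in>lp p. norm (L x) \<le> K * lp_norm p x)}"

text \<open>The filter of \<open>y \<rightarrow> x\<close> with \<open>y\<close> in the open unit ball, for \<open>x\<close> in the closed ball;
  \<open>y = x\<close> is not excluded.\<close>

definition lp_ball_nhds :: "real \<Rightarrow> (nat \<Rightarrow> complex) \<Rightarrow> (nat \<Rightarrow> complex) filter" where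
  "lp_ball_nhds p x = (INF d\<in>{0<..}. principal {y \<in> lp_ball p. lp_dist p y x < d})"

text \<open>Complex Frechet differentiability at every point of the open ball. At \<open>y = x\<close> the
  quotient is \<open>0 / 0 = 0\<close>.\<close>

definition lp_holomorphic :: "real \<Rightarrow> ((nat \<Rightarrow> complex) \<Rightarrow> complex) \<Rightarrow> bool" where
  "lp_holomorphic p f \<longleftrightarrow>
     (\<forall>x\<in>lp_ball p. \<exists>L\<in>lp_dual p.
        ((\<lambda>y. norm (f y - f x - L (\<lambda>i. y i - x i)) / lp_dist p y x) \<longlongrightarrow> 0) (lp_ball_nhds p x))"

definition lp_uniformly_continuous :: "real \<Rightarrow> ((nat \<Rightarrow> complex) \<Rightarrow> complex) \<Rightarrow> bool" where
  "lp_uniformly_continuous p f \<longleftrightarrow>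
     (\<forall>e>0. \<exists>d>0. \<forall>x\<in>lp_ball p. \<forall>y\<in>lp_ball p. lp_dist p x y < d \<longrightarrow> dist (f x) (f y) < e)"

definition Au :: "real \<Rightarrow> ((nat \<Rightarrow> complex) \<Rightarrow> complex) set" where
  "Au p = {f \<in> extensional (lp_ball p). lp_uniformly_continuous p f \<and> lp_holomorphic p f}"

definition Au_norm :: "real \<Rightarrow> ((nat \<Rightarrow> complex) \<Rightarrow> complex) \<Rightarrow> real" where
  "Au_norm p f = (SUP x\<in>lp_ball p. norm (f x))"

definition Au_spectrum :: "real \<Rightarrow> (((nat \<Rightarrow> complex) \<Rightarrow> complex) \<Rightarrow> complex) set" where
  "Au_spectrum p = {\<phi> \<in> extensional (Au p).
     (\<forall>f\<in>Au p. \<forall>g\<in>Au p. \<phi> (\<lambda>x\<in>lp_ball p. f x + g x) = \<phi> f + \<phi> g) \<and>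
     (\<forall>c. \<forall>f\<in>Au p. \<phi> (\<lambda>x\<in>lp_ball p. c * f x) = c * \<phi> f) \<and>
     (\<forall>f\<in>Au p. \<forall>g\<in>Au p. \<phi> (\<lambda>x\<in>lp_ball p. f x * g x) = \<phi> f * \<phi> g) \<and>
     (\<exists>f\<in>Au p. \<phi> f \<noteq> 0)}"

text \<open>The \<open>w\<^sup>*\<close>-topology is pointwise convergence on \<open>Au p\<close>, i.e. it is induced by the
  product topology.\<close>

definition wstar :: "real \<Rightarrow> (((nat \<Rightarrow> complex) \<Rightarrow> complex) \<Rightarrow> complex) topology" where
  "wstar p = subtopology (product_topology (\<lambda>_. euclidean) (Au p)) (Au_spectrum p)"

text \<open>Evaluation at \<open>x\<close> in the closed ball, using the continuous extension of \<open>f\<close>.\<close>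

definition evaluation ::
    "real \<Rightarrow> (nat \<Rightarrow> complex) \<Rightarrow> ((nat \<Rightarrow> complex) \<Rightarrow> complex) \<Rightarrow> complex" where
  "evaluation p x = (\<lambda>f\<in>Au p. Lim (lp_ball_nhds p x) f)"

definition Au_fiber ::
    "real \<Rightarrow> (nat \<Rightarrow> complex) \<Rightarrow> (((nat \<Rightarrow> complex) \<Rightarrow> complex) \<Rightarrow> complex) set" where
  "Au_fiber p z = {\<phi> \<in> Au_spectrum p. \<forall>L\<in>lp_dual p. \<phi> (restrict L (lp_ball p)) = L z}"

definition functional_dist :: "real \<Rightarrow> (((nat \<Rightarrow> complex) \<Rightarrow> complex) \<Rightarrow> complex) \<Rightarrow>
    (((nat \<Rightarrow> complex) \<Rightarrow> complex) \<Rightarrow> complex) \<Rightarrow> real" where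
  "functional_dist p \<phi> \<psi> = (SUP f\<in>{f \<in> Au p. Au_norm p f \<le> 1}. norm (\<phi> f - \<psi> f))"

definition gleason_part :: "real \<Rightarrow> (((nat \<Rightarrow> complex) \<Rightarrow> complex) \<Rightarrow> complex) \<Rightarrow>
    (((nat \<Rightarrow> complex) \<Rightarrow> complex) \<Rightarrow> complex) set" where
  "gleason_part p \<phi> = {\<psi> \<in> Au_spectrum p. functional_dist p \<phi> \<psi> < 2}"

definition cluster_points :: "'a topology \<Rightarrow> ('i \<Rightarrow> 'a) \<Rightarrow> 'i filter \<Rightarrow> 'a set" where
  "cluster_points T u F =
     {a \<in> topspace T. \<forall>U. openin T U \<and> a \<in> U \<longrightarrow> (\<exists>\<^sub>F i in F. u i \<in> U)}"

definition canonical_vec :: "nat \<Rightarrow> nat \<Rightarrow> complex" where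
  "canonical_vec k = (\<lambda>i. if i = k then 1 else 0)"

definition coord_proj :: "nat \<Rightarrow> (nat \<Rightarrow> complex) \<Rightarrow> nat \<Rightarrow> complex" where
  "coord_proj n x = (\<lambda>i. if i < n then x i else 0)"

text \<open>The cluster points of \<open>\<delta>\<close> at \<open>\<pi>\<^sub>n(z) + s e\<close>, where \<open>e\<close> is the canonical vector of the
  first coordinate that \<open>\<pi>\<^sub>n\<close> deletes; with coordinates counted from \<open>0\<close> it has index \<open>n\<close>.\<close>

definition wstar_ac :: "real \<Rightarrow> (nat \<Rightarrow> complex) \<Rightarrow> real \<Rightarrow>
    (((nat \<Rightarrow> complex) \<Rightarrow> complex) \<Rightarrow> complex) set" where
  "wstar_ac p z s = cluster_points (wstar p)
     (\<lambda>n. evaluation p (\<lambda>i. coord_proj n z i + complex_of_real s * canonical_vec n i)) sequentially"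

end

theory Submission
  imports Defs
begin

text \<open>
  Write \<open>x\<^sub>m = \<pi>\<^sub>m(z) + s e\<close>. The cluster points of \<open>\<delta>(x\<^sub>m)\<close> are peaked by the functions
  \<open>F\<^sub>k(x) = exp (c\<^sub>k h\<^sub>k(x - z)) (\<Sum>i\<ge>k. a\<^sub>i x\<^sub>i\<^sup>N) / C\<^sub>k\<close> with \<open>N > p\<close> and \<open>|a\<^sub>i| \<le> 1\<close>, where \<open>h\<^sub>k\<close> is the
  derivative of the \<open>p\<close>-th power of the norm at \<open>\<pi>\<^sub>k(z)\<close>. Convexity of \<open>t \<mapsto> t\<^sup>p\<close> and \<open>1 - u \<le> exp (- u)\<close> give
  \<open>|F\<^sub>k| \<le> 1\<close>, with an exponential gain where some head coordinate differs from that of \<open>z\<close>, whereas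
  \<open>F\<^sub>k\<close> tends to \<open>lim a\<close> at the cluster points as \<open>k \<rightarrow> \<infinity>\<close>.

  If \<open>a\<close> is the indicator of a set that separates two cluster points, then \<open>F\<^sub>k\<close> tends to \<open>1\<close> at one and to
  \<open>0\<close> at the other, and Moebius transformations turn this into distance \<open>2\<close>. If \<open>a = 1\<close> and \<open>\<psi>\<close> is in the Gleason
  part of a cluster point, then \<open>\<psi>(F\<^sub>k) \<longrightarrow> 1\<close>, while \<open>F\<^sub>k\<^sup>j (x\<^sub>i - z\<^sub>i)\<close> is uniformly small for large \<open>j\<close>; hence
  \<open>\<psi>(x\<^sub>i) = z\<^sub>i\<close>. Finally there are as many cluster points as sets of reals, because \<open>\<nat>\<close> has an independent
  family of subsets indexed by the reals.
\<close>

subsection \<open>Sequence spaces and their functionals\<close>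

text \<open>The mass \<open>norm (x i) powr p\<close> is not holomorphic in \<open>x i\<close>, so
  \<open>F\<^sub>k\<close> has to control it indirectly: the head \<open>i < k\<close> enters
  through a complex-linear tangent functional inside an exponential, the tail through a polynomial
  of degree \<open>N > p\<close>. In the unit ball, mass gained by the head is lost by the tail;
  this trade-off explains why the tangent at \<open>z\<close> is the exponent, and the convexity
  remainder is the gain. If \<open>\<sigma>\<close> is the mass that the first \<open>k\<close>
  coordinates of \<open>z\<close> leave, the constants are
  \<open>c\<^sub>k = N / (p * \<sigma>)\<close> and
  \<open>C\<^sub>k = \<sigma> powr (N / p)\<close>. The point \<open>x\<^sub>m\<close> still carries
  the coordinates of \<open>z\<close> between \<open>k\<close> and \<open>m\<close>, so one
  \<open>F\<^sub>k\<close> need not peak exactly and \<open>k\<close> must tend to infinity. Bounded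
  coefficients \<open>a\<close> read the position \<open>m\<close> of the bump, which continuous
  linear functionals lose in the limit. The upper bound on the cardinality is soft: the ball has a
  countable dense subset, so \<open>Au p\<close> has at most continuum many elements, and a complex
  function on such a set can be coded by a subset of it times a countable set.\<close>

definition lp_pow :: "real \<Rightarrow> (nat \<Rightarrow> complex) \<Rightarrow> real" where
  "lp_pow p x = (\<Sum>i. norm (x i) powr p)"

lemma lp_norm_nonneg [simp]: "0 \<le> lp_norm p x"
  by (simp add: lp_norm_def)

lemma lp_dist_nonneg [simp]: "0 \<le> lp_dist p x y"
  by (simp add: lp_dist_def)

context
  fixes p :: real
  assumes p: "1 < p"
begin

lemma lp_summable: "x \<in> lp p \<Longrightarrow> summable (\<lambda>i. norm (x i) powr p)"
  by (simp add: lp_def)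

lemma lp_pow_nonneg: "x \<in> lp p \<Longrightarrow> 0 \<le> lp_pow p x"
  unfolding lp_pow_def by (intro suminf_nonneg lp_summable) auto

lemma lp_norm_eq: "lp_norm p x = lp_pow p x powr (1 / p)"
  by (simp add: lp_norm_def lp_pow_def)

lemma lp_norm_powr: "x \<in> lp p \<Longrightarrow> lp_norm p x powr p = lp_pow p x"
  using p lp_pow_nonneg[of x] by (simp add: lp_norm_eq powr_powr)

lemma lp_norm_le_iff:
  assumes "x \<in> lp p" "0 \<le> r"
  shows "lp_norm p x \<le> r \<longleftrightarrow> lp_pow p x \<le> r powr p"
  using assms p by (metis lp_norm_nonneg lp_norm_powr not_le order.strict_trans powr_less_mono2 powr_mono2 zero_less_one less_imp_le)

lemma lp_norm_less_iff:
  assumes "x \<in> lp p" "0 \<le> r"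
  shows "lp_norm p x < r \<longleftrightarrow> lp_pow p x < r powr p"
  using assms p by (metis lp_norm_nonneg lp_norm_powr not_le order.strict_trans powr_less_mono2 powr_mono2 zero_less_one less_imp_le)

lemma mem_lp_ball: "x \<in> lp_ball p \<longleftrightarrow> x \<in> lp p \<and> lp_pow p x < 1"
  using lp_norm_less_iff[of x 1] by (auto simp: lp_ball_def)

lemma lp_ball_lp: "x \<in> lp_ball p \<Longrightarrow> x \<in> lp p"
  by (simp add: lp_ball_def)

lemma sum_le_lp_pow:
  assumes "x \<in> lp p" "finite I"
  shows "(\<Sum>i\<in>I. norm (x i) powr p) \<le> lp_pow p x"
  unfolding lp_pow_def using assms by (intro sum_le_suminf lp_summable) auto

lemma norm_le_lp_norm:
  assumes "x \<in> lp p" shows "norm (x i) \<le> lp_norm p x"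
proof -
  have "norm (x i) powr p \<le> lp_norm p x powr p"
    using sum_le_lp_pow[OF assms, of "{i}"] lp_norm_powr[OF assms] by simp
  then show ?thesis
    using p by (metis lp_norm_nonneg not_le order.strict_trans powr_less_mono2 zero_less_one)
qed

lemma lp_scale:
  assumes "x \<in> lp p"
  shows "(\<lambda>i. c * x i) \<in> lp p" and "lp_norm p (\<lambda>i. c * x i) = norm c * lp_norm p x"
    and "lp_pow p (\<lambda>i. c * x i) = norm c powr p * lp_pow p x"
proof -
  have e: "norm (c * x i) powr p = norm c powr p * norm (x i) powr p" for i
    by (simp add: norm_mult powr_mult)
  show "(\<lambda>i. c * x i) \<in> lp p"
    using assms by (simp add: lp_def e summable_mult)
  show 1: "lp_pow p (\<lambda>i. c * x i) = norm c powr p * lp_pow p x"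
    unfolding lp_pow_def e by (intro suminf_mult lp_summable assms)
  show "lp_norm p (\<lambda>i. c * x i) = norm c * lp_norm p x"
    unfolding lp_norm_eq 1 using p lp_pow_nonneg[OF assms] by (simp add: powr_mult powr_powr)
qed

lemma norm_add_powr_le:
  fixes a b :: complex
  shows "norm (a + b) powr p \<le> 2 powr p * (norm a powr p + norm b powr p)"
proof -
  have "norm (a + b) powr p \<le> (2 * max (norm a) (norm b)) powr p"
    using p by (intro powr_mono2) (auto intro: order_trans[OF norm_triangle_ineq])
  also have "\<dots> = 2 powr p * max (norm a) (norm b) powr p"
    by (simp add: powr_mult)
  also have "\<dots> \<le> 2 powr p * (norm a powr p + norm b powr p)"
    by (intro mult_left_mono) (auto simp: max_def)
  finally show ?thesis .
qed

text \<open>A quasi-triangle inequality with constant 4 serves as well as Minkowski's inequality,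
  since its uses concern only convergence and density.\<close>

lemma lp_add:
  assumes "x \<in> lp p" "y \<in> lp p"
  shows "(\<lambda>i. x i + y i) \<in> lp p"
    and "lp_norm p (\<lambda>i. x i + y i) \<le> 4 * max (lp_norm p x) (lp_norm p y)"
proof -
  have s: "summable (\<lambda>i. 2 powr p * (norm (x i) powr p + norm (y i) powr p))"
    by (intro summable_mult summable_add lp_summable assms)
  show m: "(\<lambda>i. x i + y i) \<in> lp p"
    unfolding lp_def mem_Collect_eq
    by (rule summable_comparison_test'[OF s, of 0]) (use norm_add_powr_le in auto)
  let ?m = "max (lp_norm p x) (lp_norm p y)"
  have "lp_pow p (\<lambda>i. x i + y i) \<le> (\<Sum>i. 2 powr p * (norm (x i) powr p + norm (y i) powr p))"
    unfolding lp_pow_def using m by (intro suminf_le s norm_add_powr_le) (simp add: lp_def)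
  also have "\<dots> = 2 powr p * (lp_pow p x + lp_pow p y)"
    unfolding lp_pow_def
    by (simp add: suminf_mult suminf_add lp_summable assms summable_add)
  also have "\<dots> \<le> 2 powr p * (?m powr p + ?m powr p)"
    using p by (intro mult_left_mono add_mono)
      (auto simp: lp_norm_powr[symmetric] assms intro!: powr_mono2)
  also have "\<dots> = 2 powr p * 2 powr 1 * ?m powr p"
    by simp
  \<comment> \<open>As \<open>p > 1\<close>, the factor 2 from two equal summands is absorbed into a
    second \<open>2 powr p\<close>; this produces the constant 4.\<close>
  also have "\<dots> \<le> 2 powr p * 2 powr p * ?m powr p"
    using p by (intro mult_right_mono mult_left_mono powr_mono) auto
  also have "\<dots> = (2 * 2 * ?m) powr p"
    by (simp only: powr_mult)
  finally show "lp_norm p (\<lambda>i. x i + y i) \<le> 4 * ?m"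
    using lp_norm_le_iff[OF m, of "4 * ?m"] by (simp add: le_max_iff_disj)
qed

lemma lp_diff:
  assumes "x \<in> lp p" "y \<in> lp p"
  shows "(\<lambda>i. x i - y i) \<in> lp p"
  using lp_add(1)[OF assms(1) lp_scale(1)[OF assms(2), of "-1"]] by simp

lemma lp_dist_commute: "lp_dist p x y = lp_dist p y x"
  by (simp add: lp_dist_def lp_norm_def norm_minus_commute)

lemma norm_diff_le_lp_dist:
  assumes "x \<in> lp p" "y \<in> lp p" shows "norm (x i - y i) \<le> lp_dist p x y"
  unfolding lp_dist_def using norm_le_lp_norm[OF lp_diff[OF assms]] by simp

lemma lp_dist_triangle:
  assumes "x \<in> lp p" "y \<in> lp p" "w \<in> lp p"
  shows "lp_dist p x y \<le> 4 * max (lp_dist p x w) (lp_dist p y w)"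
  using lp_add(2)[OF lp_diff[OF assms(1,3)] lp_diff[OF assms(3,2)]] lp_dist_commute[of y w]
  by (simp add: lp_dist_def)

lemma finite_support_lp:
  assumes "\<And>i. i \<notin> I \<Longrightarrow> x i = 0" "finite I"
  shows "x \<in> lp p" and "lp_pow p x = (\<Sum>i\<in>I. norm (x i) powr p)"
proof -
  show "x \<in> lp p"
    unfolding lp_def mem_Collect_eq using assms p by (intro summable_finite[of I]) auto
  show "lp_pow p x = (\<Sum>i\<in>I. norm (x i) powr p)"
    unfolding lp_pow_def using assms p by (intro suminf_finite) auto
qed

lemma lp_dual_add: "L \<in> lp_dual p \<Longrightarrow> x \<in> lp p \<Longrightarrow> y \<in> lp p \<Longrightarrow> L (\<lambda>i. x i + y i) = L x + L y"
  by (auto simp: lp_dual_def)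

lemma lp_dual_scale: "L \<in> lp_dual p \<Longrightarrow> x \<in> lp p \<Longrightarrow> L (\<lambda>i. c * x i) = c * L x"
  by (auto simp: lp_dual_def)

lemma lp_dual_diff:
  assumes "L \<in> lp_dual p" "x \<in> lp p" "y \<in> lp p"
  shows "L (\<lambda>i. x i - y i) = L x - L y"
  using lp_dual_add[OF assms(1,2) lp_scale(1)[OF assms(3), of "-1"]]
    lp_dual_scale[OF assms(1,3), of "-1"] by simp

lemma lp_dual_bound:
  assumes "L \<in> lp_dual p"
  obtains K where "K > 0" "\<And>x. x \<in> lp p \<Longrightarrow> norm (L x) \<le> K * lp_norm p x"
proof -
  from assms obtain K where K: "\<forall>x\<in>lp p. norm (L x) \<le> K * lp_norm p x"
    by (auto simp: lp_dual_def)
  show ?thesis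
  proof
    show "max K 1 > 0" by simp
    show "norm (L x) \<le> max K 1 * lp_norm p x" if "x \<in> lp p" for x
      using K that by (metis lp_norm_nonneg max.cobounded1 mult_right_mono order_trans)
  qed
qed

lemma lp_dual_lincomb:
  assumes "L1 \<in> lp_dual p" "L2 \<in> lp_dual p"
  shows "(\<lambda>x. a * L1 x + b * L2 x) \<in> lp_dual p"
proof -
  obtain K1 where K1: "K1 > 0" "\<And>x. x \<in> lp p \<Longrightarrow> norm (L1 x) \<le> K1 * lp_norm p x"
    using lp_dual_bound[OF assms(1)] by blast
  obtain K2 where K2: "K2 > 0" "\<And>x. x \<in> lp p \<Longrightarrow> norm (L2 x) \<le> K2 * lp_norm p x"
    using lp_dual_bound[OF assms(2)] by blast
  have "norm (a * L1 x + b * L2 x) \<le> (norm a * K1 + norm b * K2) * lp_norm p x" if "x \<in> lp p" for x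
  proof -
    have "norm (a * L1 x + b * L2 x) \<le> norm a * norm (L1 x) + norm b * norm (L2 x)"
      by (metis norm_mult norm_triangle_ineq)
    also have "\<dots> \<le> norm a * (K1 * lp_norm p x) + norm b * (K2 * lp_norm p x)"
      by (intro add_mono mult_left_mono K1(2)[OF that] K2(2)[OF that]) auto
    finally show ?thesis by (simp add: algebra_simps)
  qed
  then show ?thesis
    using assms unfolding lp_dual_def mem_Collect_eq
    by (intro conjI exI[of _ "norm a * K1 + norm b * K2"]) (auto simp: algebra_simps)
qed

lemma lp_dual_coord: "(\<lambda>x. x i) \<in> lp_dual p"
  unfolding lp_dual_def using norm_le_lp_norm by (auto intro!: exI[of _ 1])

lemma lp_dual_zero: "(\<lambda>x. 0) \<in> lp_dual p"
  using lp_dual_lincomb[OF lp_dual_coord lp_dual_coord, of 0 undefined 0 undefined] by simp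

lemma lp_dual_finite_sum: "(\<lambda>x. \<Sum>i<k. c i * x i) \<in> lp_dual p"
proof (induction k)
  case (Suc k)
  show ?case
    using lp_dual_lincomb[OF Suc lp_dual_coord, of 1 "c k" k] by simp
qed (simp add: lp_dual_zero)

subsection \<open>The algebra of uniformly continuous holomorphic functions\<close>

lemma eventually_lp_ball_nhds:
  "eventually P (lp_ball_nhds p x) \<longleftrightarrow>
    (\<exists>d>0. \<forall>y\<in>lp_ball p. lp_dist p y x < d \<longrightarrow> P y)"
  unfolding lp_ball_nhds_def
proof (subst eventually_INF_base, goal_cases)
  case (2 a b)
  then show ?case
    by (intro bexI[of _ "min a b"]) auto
qed (auto simp: eventually_principal)

lemma zero_in_lp_ball: "(\<lambda>i. 0) \<in> lp_ball p"
  using p by (simp add: mem_lp_ball lp_def lp_pow_def)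

lemma Au_ucont:
  assumes "f \<in> Au p" "0 < e"
  obtains d where "0 < d" "\<And>x y. x \<in> lp_ball p \<Longrightarrow> y \<in> lp_ball p \<Longrightarrow> lp_dist p x y < d \<Longrightarrow> norm (f x - f y) < e"
  using assms unfolding Au_def lp_uniformly_continuous_def by (auto simp: dist_norm)

lemma Au_extensional: "f \<in> Au p \<Longrightarrow> f \<in> extensional (lp_ball p)"
  by (simp add: Au_def)

lemma Au_restrict: "f \<in> Au p \<Longrightarrow> (\<lambda>x\<in>lp_ball p. f x) = f"
  by (simp add: Au_extensional extensional_restrict)

lemma Au_tendsto:
  assumes "f \<in> Au p" "x \<in> lp_ball p"
  shows "(f \<longlongrightarrow> f x) (lp_ball_nhds p x)"
proof (rule tendstoI)
  fix e :: real assume "e > 0"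
  then show "\<forall>\<^sub>F y in lp_ball_nhds p x. dist (f y) (f x) < e"
    using Au_ucont[OF assms(1), of e] assms(2) unfolding eventually_lp_ball_nhds dist_norm by metis
qed

lemma segment_in_lp_ball:
  assumes "x \<in> lp_ball p" "0 \<le> t" "t \<le> 1"
  shows "(\<lambda>i. complex_of_real t * x i) \<in> lp_ball p"
  using assms lp_scale[of x t] unfolding lp_ball_def
  by (auto intro: order.strict_trans1[OF mult_left_le_one_le])

lemma lp_dist_segment:
  assumes "x \<in> lp p"
  shows "lp_dist p (\<lambda>i. complex_of_real t * x i) (\<lambda>i. complex_of_real u * x i) = \<bar>t - u\<bar> * lp_norm p x"
proof -
  have "norm (complex_of_real t - complex_of_real u) = \<bar>t - u\<bar>"
    by (simp flip: of_real_diff)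
  then show ?thesis
    using lp_scale(2)[OF assms, of "complex_of_real t - complex_of_real u"]
    by (simp add: lp_dist_def left_diff_distrib)
qed

text \<open>Each point is joined to the origin by \<open>m\<close> radial steps of length below
  \<open>d\<close>, with \<open>m\<close> the same for all points, and each step changes
  \<open>f\<close> by less than 1.\<close>

lemma Au_bounded:
  assumes "f \<in> Au p"
  obtains B where "\<And>x. x \<in> lp_ball p \<Longrightarrow> norm (f x) \<le> B"
proof -
  obtain d where d: "0 < d" "\<And>x y. x \<in> lp_ball p \<Longrightarrow> y \<in> lp_ball p \<Longrightarrow> lp_dist p x y < d \<Longrightarrow> norm (f x - f y) < 1"
    using Au_ucont[OF assms, of 1] by auto
  obtain m :: nat where m: "1 / d < m" using reals_Archimedean2 by blast
  then have m0: "m > 0" using d(1) by (metis divide_pos_pos less_asym of_nat_0 gr0I zero_less_one)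
  have "norm (f x) \<le> norm (f (\<lambda>i. 0)) + m" if x: "x \<in> lp_ball p" for x
  proof -
    let ?y = "\<lambda>k::nat. \<lambda>i. complex_of_real (real k / m) * x i"
    have "norm (f (?y k)) \<le> norm (f (\<lambda>i. 0)) + k" if "k \<le> m" for k
      using that
    proof (induction k)
      case (Suc k)
      have "lp_dist p (?y (Suc k)) (?y k) = 1/m * lp_norm p x"
        unfolding lp_dist_segment[OF lp_ball_lp[OF x]] using m0 by (simp add: field_simps)
      also have "\<dots> \<le> 1/m * 1"
        using x by (intro mult_left_mono) (auto simp: lp_ball_def)
      also have "\<dots> < d" using m m0 d(1) by (simp add: field_simps)
      finally have "norm (f (?y (Suc k)) - f (?y k)) < 1"
        using Suc.prems m0 by (intro d(2) segment_in_lp_ball x) (auto simp: field_simps)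
      then show ?case
        using Suc norm_triangle_ineq2[of "f (?y (Suc k))" "f (?y k)"] by auto
    qed simp
    from this[of m] show ?thesis using m0 by simp
  qed
  then show ?thesis using that by blast
qed

lemma norm_le_Au_norm:
  assumes "f \<in> Au p" "x \<in> lp_ball p" shows "norm (f x) \<le> Au_norm p f"
  unfolding Au_norm_def using Au_bounded[OF assms(1)] assms(2)
  by (metis (no_types, lifting) bdd_aboveI2 cSUP_upper)

lemma Au_norm_le:
  assumes "\<And>x. x \<in> lp_ball p \<Longrightarrow> norm (f x) \<le> B" shows "Au_norm p f \<le> B"
  unfolding Au_norm_def using assms zero_in_lp_ball by (intro cSUP_least) auto

lemma Au_const: "(\<lambda>x\<in>lp_ball p. c) \<in> Au p"
  unfolding Au_def lp_uniformly_continuous_def lp_holomorphic_def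
  by (auto intro!: exI[of _ 1] bexI[OF _ lp_dual_zero] tendstoI simp: eventually_lp_ball_nhds)

lemma Au_linear:
  assumes L: "L \<in> lp_dual p" shows "restrict L (lp_ball p) \<in> Au p"
proof -
  obtain K where K: "K > 0" "\<And>x. x \<in> lp p \<Longrightarrow> norm (L x) \<le> K * lp_norm p x"
    using lp_dual_bound[OF L] by blast
  have "lp_uniformly_continuous p (restrict L (lp_ball p))"
    unfolding lp_uniformly_continuous_def
  proof (intro allI impI)
    fix e :: real assume "e > 0"
    show "\<exists>d>0. \<forall>x\<in>lp_ball p. \<forall>y\<in>lp_ball p. lp_dist p x y < d \<longrightarrow>
      dist (restrict L (lp_ball p) x) (restrict L (lp_ball p) y) < e"
    proof (intro exI conjI ballI impI)
      show "e / K > 0" using \<open>e > 0\<close> K by simp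
      fix x y assume *: "x \<in> lp_ball p" "y \<in> lp_ball p" "lp_dist p x y < e / K"
      then have "norm (L x - L y) \<le> K * lp_dist p x y"
        using K(2)[OF lp_diff[of x y]] lp_dual_diff[OF L, of x y]
        by (simp add: lp_ball_lp lp_dist_def)
      also have "\<dots> < e" using * K by (simp add: field_simps)
      finally show "dist (restrict L (lp_ball p) x) (restrict L (lp_ball p) y) < e"
        using * by (simp add: dist_norm)
    qed
  qed
  moreover have "lp_holomorphic p (restrict L (lp_ball p))"
    unfolding lp_holomorphic_def
    by (intro ballI bexI[OF _ L] tendsto_eventually)
       (auto simp: eventually_lp_ball_nhds lp_dual_diff[OF L] lp_ball_lp intro!: exI[of _ 1])
  ultimately show ?thesis by (simp add: Au_def)
qed

end

section \<open>Frechet derivatives and closure properties of the algebra\<close>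

context
  fixes p :: real
  assumes p: "1 < p"
begin

lemma lp_dist_eq_0:
  assumes "x \<in> lp p" "y \<in> lp p" "lp_dist p y x = 0" shows "y = x"
  using norm_diff_le_lp_dist[OF p assms(2,1)] assms(3) by fastforce

text \<open>Multiplying out the quotient is safe at \<open>y = x\<close>: there the quotient is 0 by
  convention, and the product form holds because \<open>L\<close> vanishes at 0. The differentiation
  rules work with the product form.\<close>

lemma lp_derivative_iff:
  assumes "x \<in> lp_ball p" "L \<in> lp_dual p"
  shows "((\<lambda>y. norm (f y - f x - L (\<lambda>i. y i - x i)) / lp_dist p y x) \<longlongrightarrow> 0) (lp_ball_nhds p x) \<longleftrightarrow>
    (\<forall>e>0. \<forall>\<^sub>F y in lp_ball_nhds p x. norm (f y - f x - L (\<lambda>i. y i - x i)) \<le> e * lp_dist p y x)"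
    (is "?l \<longleftrightarrow> ?r")
proof
  have L0: "L (\<lambda>i. x i - x i) = 0"
    using lp_dual_diff[OF p assms(2), of x x] assms(1) by (simp add: lp_ball_lp p)
  have xlp: "x \<in> lp p" using assms(1) by (rule lp_ball_lp[OF p])
  show ?r if ?l
  proof (intro allI impI)
    fix e :: real assume "e > 0"
    from tendstoD[OF that this]
    obtain d where d: "d > 0" "\<And>y. y \<in> lp_ball p \<Longrightarrow> lp_dist p y x < d \<Longrightarrow>
        norm (f y - f x - L (\<lambda>i. y i - x i)) / lp_dist p y x < e"
      unfolding eventually_lp_ball_nhds[OF p] by (auto simp: dist_norm)
    have "norm (f y - f x - L (\<lambda>i. y i - x i)) \<le> e * lp_dist p y x"
      if y: "y \<in> lp_ball p" "lp_dist p y x < d" for y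
    proof (cases "lp_dist p y x = 0")
      case True
      then have "y = x" using lp_dist_eq_0[of x y] xlp lp_ball_lp[OF p y(1)] by simp
      then show ?thesis using L0 True by simp
    next
      case False
      then have "lp_dist p y x > 0" using lp_dist_nonneg[of p y x] by linarith
      then show ?thesis using d(2)[OF y] by (simp add: field_simps)
    qed
    then show "\<forall>\<^sub>F y in lp_ball_nhds p x. norm (f y - f x - L (\<lambda>i. y i - x i)) \<le> e * lp_dist p y x"
      using d(1) unfolding eventually_lp_ball_nhds[OF p] by blast
  qed
  show ?l if r: ?r
  proof (rule tendstoI)
    fix e :: real assume "e > 0"
    then have "\<forall>\<^sub>F y in lp_ball_nhds p x. norm (f y - f x - L (\<lambda>i. y i - x i)) \<le> e/2 * lp_dist p y x"
      using r half_gt_zero by blast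
    then show "\<forall>\<^sub>F y in lp_ball_nhds p x. dist (norm (f y - f x - L (\<lambda>i. y i - x i)) / lp_dist p y x) 0 < e"
    proof eventually_elim
      case (elim y)
      then have "norm (f y - f x - L (\<lambda>i. y i - x i)) / lp_dist p y x \<le> e / 2"
        using lp_dist_nonneg[of p y x] \<open>e > 0\<close>
        by (cases "lp_dist p y x = 0") (auto simp: divide_le_eq less_le)
      moreover have "e / 2 < e" using \<open>e > 0\<close> by simp
      ultimately have "norm (f y - f x - L (\<lambda>i. y i - x i)) / lp_dist p y x < e"
        by (rule order.strict_trans1)
      then show ?case using lp_dist_nonneg[of p y x] by (simp add: dist_norm)
    qed
  qed
qed

lemma AuI:
  assumes "f \<in> extensional (lp_ball p)" "lp_uniformly_continuous p f"
    and "\<And>x. x \<in> lp_ball p \<Longrightarrow> \<exists>L\<in>lp_dual p. \<forall>e>0. \<forall>\<^sub>F y in lp_ball_nhds p x.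
            norm (f y - f x - L (\<lambda>i. y i - x i)) \<le> e * lp_dist p y x"
  shows "f \<in> Au p"
proof -
  have "lp_holomorphic p f"
    unfolding lp_holomorphic_def
  proof
    fix x assume x: "x \<in> lp_ball p"
    from assms(3)[OF x] obtain L where L: "L \<in> lp_dual p" and d: "\<forall>e>0. \<forall>\<^sub>F y in lp_ball_nhds p x.
      norm (f y - f x - L (\<lambda>i. y i - x i)) \<le> e * lp_dist p y x" ..
    show "\<exists>L\<in>lp_dual p. ((\<lambda>y. norm (f y - f x - L (\<lambda>i. y i - x i)) / lp_dist p y x) \<longlongrightarrow> 0) (lp_ball_nhds p x)"
      by (rule bexI[of _ L], rule lp_derivative_iff[THEN iffD2, OF x L d]) (rule L)
  qed
  with assms(1,2) show ?thesis by (simp add: Au_def)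
qed

lemma eventually_mem_lp_ball_nhds: "\<forall>\<^sub>F y in lp_ball_nhds p x. y \<in> lp_ball p"
  unfolding eventually_lp_ball_nhds[OF p] by (auto intro: exI[of _ 1])

text \<open>Besides the first-order expansion this gives a local Lipschitz bound, by which the
  product and chain rules control their error terms.\<close>

lemma Au_derivative:
  assumes f: "f \<in> Au p" and x: "x \<in> lp_ball p"
  obtains L C where "L \<in> lp_dual p" "C > 0"
    "\<And>e. e > 0 \<Longrightarrow> \<forall>\<^sub>F y in lp_ball_nhds p x. norm (f y - f x - L (\<lambda>i. y i - x i)) \<le> e * lp_dist p y x"
    "\<forall>\<^sub>F y in lp_ball_nhds p x. norm (f y - f x) \<le> C * lp_dist p y x"
proof -
  obtain L where L: "L \<in> lp_dual p" "\<And>e. e > 0 \<Longrightarrow> \<forall>\<^sub>F y in lp_ball_nhds p x.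
      norm (f y - f x - L (\<lambda>i. y i - x i)) \<le> e * lp_dist p y x"
  proof -
    from f x obtain L where L: "L \<in> lp_dual p"
      "((\<lambda>y. norm (f y - f x - L (\<lambda>i. y i - x i)) / lp_dist p y x) \<longlongrightarrow> 0) (lp_ball_nhds p x)"
      unfolding Au_def lp_holomorphic_def by auto
    have "\<forall>e>0. \<forall>\<^sub>F y in lp_ball_nhds p x. norm (f y - f x - L (\<lambda>i. y i - x i)) \<le> e * lp_dist p y x"
      by (rule lp_derivative_iff[THEN iffD1, OF x L(1) L(2)])
    then show ?thesis
      by (intro that[OF L(1)]) (erule allE, erule (1) impE)
  qed
  obtain K where K: "K > 0" "\<And>x. x \<in> lp p \<Longrightarrow> norm (L x) \<le> K * lp_norm p x"
    using lp_dual_bound[OF p L(1)] by blast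
  from eventually_mem_lp_ball_nhds[of x] have "\<forall>\<^sub>F y in lp_ball_nhds p x. norm (f y - f x) \<le> (1 + K) * lp_dist p y x"
    using L(2)[OF zero_less_one]
  proof eventually_elim
    case (elim y)
    have "norm (L (\<lambda>i. y i - x i)) \<le> K * lp_dist p y x"
      unfolding lp_dist_def using elim x by (intro K(2) lp_diff[OF p] lp_ball_lp[OF p])
    with elim(2) show ?case
      using norm_triangle_sub[of "f y - f x" "L (\<lambda>i. y i - x i)"] by (simp add: algebra_simps)
  qed
  then show ?thesis
    using that[OF L(1) _ L(2), of "1 + K"] K(1) by simp
qed

lemma Au_add:
  assumes f: "f \<in> Au p" and g: "g \<in> Au p"
  shows "(\<lambda>x\<in>lp_ball p. f x + g x) \<in> Au p" (is "?h \<in> _")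
proof (rule AuI)
  show "lp_uniformly_continuous p ?h"
    unfolding lp_uniformly_continuous_def
  proof (intro allI impI)
    fix e :: real assume "e > 0"
    then have e: "e / 2 > 0" by simp
    obtain d1 where d1: "0 < d1" "\<And>x y. x \<in> lp_ball p \<Longrightarrow> y \<in> lp_ball p \<Longrightarrow> lp_dist p x y < d1 \<Longrightarrow> norm (f x - f y) < e/2"
      using Au_ucont[OF p f e] by blast
    obtain d2 where d2: "0 < d2" "\<And>x y. x \<in> lp_ball p \<Longrightarrow> y \<in> lp_ball p \<Longrightarrow> lp_dist p x y < d2 \<Longrightarrow> norm (g x - g y) < e/2"
      using Au_ucont[OF p g e] by blast
    show "\<exists>d>0. \<forall>x\<in>lp_ball p. \<forall>y\<in>lp_ball p. lp_dist p x y < d \<longrightarrow> dist (?h x) (?h y) < e"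
    proof (intro exI[of _ "min d1 d2"] conjI ballI impI)
      fix x y assume *: "x \<in> lp_ball p" "y \<in> lp_ball p" "lp_dist p x y < min d1 d2"
      then have "norm (f x - f y) < e/2" "norm (g x - g y) < e/2"
        using d1(2) d2(2) by auto
      then show "dist (?h x) (?h y) < e"
        using * norm_triangle_ineq[of "f x - f y" "g x - g y"] by (simp add: dist_norm algebra_simps)
    qed (use d1 d2 in auto)
  qed
next
  fix x assume x: "x \<in> lp_ball p"
  obtain L1 C1 where L1: "L1 \<in> lp_dual p" "C1 > 0" "\<And>e. e > 0 \<Longrightarrow> \<forall>\<^sub>F y in lp_ball_nhds p x.
      norm (f y - f x - L1 (\<lambda>i. y i - x i)) \<le> e * lp_dist p y x"
      "\<forall>\<^sub>F y in lp_ball_nhds p x. norm (f y - f x) \<le> C1 * lp_dist p y x"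
    using that by (rule Au_derivative[OF f x])
  obtain L2 C2 where L2: "L2 \<in> lp_dual p" "C2 > 0" "\<And>e. e > 0 \<Longrightarrow> \<forall>\<^sub>F y in lp_ball_nhds p x.
      norm (g y - g x - L2 (\<lambda>i. y i - x i)) \<le> e * lp_dist p y x"
      "\<forall>\<^sub>F y in lp_ball_nhds p x. norm (g y - g x) \<le> C2 * lp_dist p y x"
    using that by (rule Au_derivative[OF g x])
  show "\<exists>L\<in>lp_dual p. \<forall>e>0. \<forall>\<^sub>F y in lp_ball_nhds p x. norm (?h y - ?h x - L (\<lambda>i. y i - x i)) \<le> e * lp_dist p y x"
  proof (intro bexI[OF _ lp_dual_lincomb[OF p L1(1) L2(1), of 1 1]] allI impI)
    fix e :: real assume "e > 0"
    then have "e / 2 > 0" by simp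
    from L1(3)[OF this] L2(3)[OF this] eventually_mem_lp_ball_nhds[of x]
    show "\<forall>\<^sub>F y in lp_ball_nhds p x. norm (?h y - ?h x - (1 * L1 (\<lambda>i. y i - x i) + 1 * L2 (\<lambda>i. y i - x i))) \<le> e * lp_dist p y x"
    proof eventually_elim
      case (elim y)
      have "norm (?h y - ?h x - (1 * L1 (\<lambda>i. y i - x i) + 1 * L2 (\<lambda>i. y i - x i))) =
        norm ((f y - f x - L1 (\<lambda>i. y i - x i)) + (g y - g x - L2 (\<lambda>i. y i - x i)))"
        using elim x by (simp add: algebra_simps)
      also have "\<dots> \<le> e / 2 * lp_dist p y x + e / 2 * lp_dist p y x"
        using elim by (intro norm_triangle_mono)
      finally show ?case by simp
    qed
  qed
qed simp

lemma Au_mult: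
  assumes f: "f \<in> Au p" and g: "g \<in> Au p"
  shows "(\<lambda>x\<in>lp_ball p. f x * g x) \<in> Au p" (is "?h \<in> _")
proof (rule AuI)
  show "lp_uniformly_continuous p ?h"
    unfolding lp_uniformly_continuous_def
  proof (intro allI impI)
    fix e :: real assume "e > 0"
    obtain B1 where B1: "\<And>x. x \<in> lp_ball p \<Longrightarrow> norm (f x) \<le> B1" using Au_bounded[OF p f] by blast
    obtain B2 where B2: "\<And>x. x \<in> lp_ball p \<Longrightarrow> norm (g x) \<le> B2" using Au_bounded[OF p g] by blast
    define B where "B = max 1 (max B1 B2)"
    have B: "B > 0" "\<And>x. x \<in> lp_ball p \<Longrightarrow> norm (f x) \<le> B" "\<And>x. x \<in> lp_ball p \<Longrightarrow> norm (g x) \<le> B"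
      using B1 B2 unfolding B_def by (force simp: le_max_iff_disj)+
    have e: "e / (2 * B) > 0" using \<open>e > 0\<close> B by simp
    obtain d1 where d1: "0 < d1" "\<And>x y. x \<in> lp_ball p \<Longrightarrow> y \<in> lp_ball p \<Longrightarrow> lp_dist p x y < d1 \<Longrightarrow> norm (f x - f y) < e / (2*B)"
      using Au_ucont[OF p f e] by blast
    obtain d2 where d2: "0 < d2" "\<And>x y. x \<in> lp_ball p \<Longrightarrow> y \<in> lp_ball p \<Longrightarrow> lp_dist p x y < d2 \<Longrightarrow> norm (g x - g y) < e / (2*B)"
      using Au_ucont[OF p g e] by blast
    show "\<exists>d>0. \<forall>x\<in>lp_ball p. \<forall>y\<in>lp_ball p. lp_dist p x y < d \<longrightarrow> dist (?h x) (?h y) < e"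
    proof (intro exI[of _ "min d1 d2"] conjI ballI impI)
      fix x y assume *: "x \<in> lp_ball p" "y \<in> lp_ball p" "lp_dist p x y < min d1 d2"
      have "norm (f x * g x - f y * g y) = norm (f x * (g x - g y) + g y * (f x - f y))"
        by (simp add: algebra_simps)
      also have "\<dots> \<le> norm (f x) * norm (g x - g y) + norm (g y) * norm (f x - f y)"
        by (metis norm_mult norm_triangle_ineq)
      also have "\<dots> \<le> B * norm (g x - g y) + B * norm (f x - f y)"
        using * B by (intro add_mono mult_right_mono) auto
      also have "\<dots> < B * (e / (2*B)) + B * (e / (2*B))"
        using * B(1) by (intro add_strict_mono mult_strict_left_mono d1(2) d2(2)) auto
      also have "\<dots> = e" using B(1) by simp
      finally show "dist (?h x) (?h y) < e"
        using * by (simp add: dist_norm)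
    qed (use d1 d2 in auto)
  qed
next
  fix x assume x: "x \<in> lp_ball p"
  obtain L1 C1 where L1: "L1 \<in> lp_dual p" "C1 > 0" "\<And>e. e > 0 \<Longrightarrow> \<forall>\<^sub>F y in lp_ball_nhds p x.
      norm (f y - f x - L1 (\<lambda>i. y i - x i)) \<le> e * lp_dist p y x"
      "\<forall>\<^sub>F y in lp_ball_nhds p x. norm (f y - f x) \<le> C1 * lp_dist p y x"
    using that by (rule Au_derivative[OF f x])
  obtain L2 C2 where L2: "L2 \<in> lp_dual p" "C2 > 0" "\<And>e. e > 0 \<Longrightarrow> \<forall>\<^sub>F y in lp_ball_nhds p x.
      norm (g y - g x - L2 (\<lambda>i. y i - x i)) \<le> e * lp_dist p y x"
      "\<forall>\<^sub>F y in lp_ball_nhds p x. norm (g y - g x) \<le> C2 * lp_dist p y x"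
    using that by (rule Au_derivative[OF g x])
  show "\<exists>L\<in>lp_dual p. \<forall>e>0. \<forall>\<^sub>F y in lp_ball_nhds p x. norm (?h y - ?h x - L (\<lambda>i. y i - x i)) \<le> e * lp_dist p y x"
  proof (intro bexI[OF _ lp_dual_lincomb[OF p L1(1) L2(1), of "g x" "f x"]] allI impI)
    fix e :: real assume e: "e > 0"
    define B where "B = 1 + norm (f x) + norm (g x)"
    have B: "B > 0" "norm (f x) \<le> B" "norm (g x) \<le> B" unfolding B_def
      using norm_ge_zero[of "f x"] norm_ge_zero[of "g x"] by linarith+
    have e1: "e / (3 * B) > 0" "e / (3 * C2) > 0" using e B L2(2) by auto
    have "\<forall>\<^sub>F y in lp_ball_nhds p x. norm (f y - f x) < e / (3 * C2)"
      using tendstoD[OF Au_tendsto[OF p f x] e1(2)] by (simp add: dist_norm)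
    then show "\<forall>\<^sub>F y in lp_ball_nhds p x.
        norm (?h y - ?h x - (g x * L1 (\<lambda>i. y i - x i) + f x * L2 (\<lambda>i. y i - x i))) \<le> e * lp_dist p y x"
      using L1(3)[OF e1(1)] L2(3)[OF e1(1)] L2(4) eventually_mem_lp_ball_nhds[of x]
    proof eventually_elim
      case (elim y)
      \<comment> \<open>Three errors share \<open>e\<close>: the product of the two increments,
        where \<open>f\<close> is small by continuity and \<open>g\<close> is Lipschitz with
        constant \<open>C2\<close>, and the two first-order remainders weighted by the values at
        \<open>x\<close>.\<close>
      let ?D = "lp_dist p y x" and ?A1 = "f y - f x - L1 (\<lambda>i. y i - x i)" and ?A2 = "g y - g x - L2 (\<lambda>i. y i - x i)"
      have "norm (?h y - ?h x - (g x * L1 (\<lambda>i. y i - x i) + f x * L2 (\<lambda>i. y i - x i))) =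
        norm ((f y - f x) * (g y - g x) + f x * ?A2 + g x * ?A1)"
        using elim x by (simp add: algebra_simps)
      also have "\<dots> \<le> norm (f y - f x) * norm (g y - g x) + norm (f x) * norm ?A2 + norm (g x) * norm ?A1"
        unfolding norm_mult[symmetric] by (intro norm_triangle_mono order_refl)
      also have "\<dots> \<le> e / (3*C2) * (C2 * ?D) + B * (e / (3*B) * ?D) + B * (e / (3*B) * ?D)"
        using elim B e1 by (intro add_mono mult_mono) (auto simp: less_imp_le)
      also have "\<dots> = e * ?D" using B(1) L2(2) by (simp add: field_simps)
      finally show ?case .
    qed
  qed
qed simp

lemma Au_compose:
  assumes f: "f \<in> Au p" and S: "open S" "\<And>x. x \<in> lp_ball p \<Longrightarrow> f x \<in> S"
    and h: "h holomorphic_on S" "uniformly_continuous_on (f ` lp_ball p) h"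
  shows "(\<lambda>x\<in>lp_ball p. h (f x)) \<in> Au p" (is "?h \<in> _")
proof (rule AuI)
  show "lp_uniformly_continuous p ?h"
    unfolding lp_uniformly_continuous_def
  proof (intro allI impI)
    fix e :: real assume "e > 0"
    then have "\<exists>r>0. \<forall>u\<in>f ` lp_ball p. \<forall>v\<in>f ` lp_ball p. dist v u < r \<longrightarrow> dist (h v) (h u) < e"
      using h(2) unfolding uniformly_continuous_on_def by simp
    then obtain r where r: "r > 0" "\<forall>u\<in>f ` lp_ball p. \<forall>v\<in>f ` lp_ball p. dist v u < r \<longrightarrow> dist (h v) (h u) < e"
      by metis
    obtain d where d: "0 < d" "\<And>x y. x \<in> lp_ball p \<Longrightarrow> y \<in> lp_ball p \<Longrightarrow> lp_dist p x y < d \<Longrightarrow> norm (f x - f y) < r"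
      using Au_ucont[OF p f r(1)] by blast
    show "\<exists>d>0. \<forall>x\<in>lp_ball p. \<forall>y\<in>lp_ball p. lp_dist p x y < d \<longrightarrow> dist (?h x) (?h y) < e"
    proof (intro exI[of _ d] conjI ballI impI d(1))
      fix x y assume *: "x \<in> lp_ball p" "y \<in> lp_ball p" "lp_dist p x y < d"
      then have "dist (f x) (f y) < r" using d(2) by (simp add: dist_norm)
      then have "dist (h (f x)) (h (f y)) < e"
        using r(2)[THEN bspec, OF imageI[OF *(2)], THEN bspec, OF imageI[OF *(1)]] by simp
      then show "dist (?h x) (?h y) < e" using * by simp
    qed
  qed
next
  fix x assume x: "x \<in> lp_ball p"
  obtain L C where L: "L \<in> lp_dual p" "C > 0" "\<And>e. e > 0 \<Longrightarrow> \<forall>\<^sub>F y in lp_ball_nhds p x.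
      norm (f y - f x - L (\<lambda>i. y i - x i)) \<le> e * lp_dist p y x"
      "\<forall>\<^sub>F y in lp_ball_nhds p x. norm (f y - f x) \<le> C * lp_dist p y x"
    using that by (rule Au_derivative[OF f x])
  obtain h' where h': "(h has_field_derivative h') (at (f x))"
    using holomorphic_on_imp_differentiable_at[OF h(1) S(1) S(2)[OF x]]
    unfolding field_differentiable_def by blast
  show "\<exists>L\<in>lp_dual p. \<forall>e>0. \<forall>\<^sub>F y in lp_ball_nhds p x. norm (?h y - ?h x - L (\<lambda>i. y i - x i)) \<le> e * lp_dist p y x"
  proof (intro bexI[OF _ lp_dual_lincomb[OF p L(1) L(1), of h' 0]] allI impI)
    fix e :: real assume e: "e > 0"
    define B where "B = 1 + norm h'"
    have B: "B > 0" "norm h' \<le> B" unfolding B_def using norm_ge_zero[of h'] by linarith+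
    have e1: "e / (2 * B) > 0" "e / (2 * C) > 0" using e B L(2) by auto
    obtain r where r: "r > 0" "\<And>w. norm (w - f x) < r \<Longrightarrow> norm (h w - h (f x) - h' * (w - f x)) \<le> e / (2*C) * norm (w - f x)"
      using h' e1(2) unfolding has_field_derivative_def has_derivative_at_alt by blast
    have "\<forall>\<^sub>F y in lp_ball_nhds p x. norm (f y - f x) < r"
      using tendstoD[OF Au_tendsto[OF p f x] r(1)] by (simp add: dist_norm)
    then show "\<forall>\<^sub>F y in lp_ball_nhds p x.
        norm (?h y - ?h x - (h' * L (\<lambda>i. y i - x i) + 0 * L (\<lambda>i. y i - x i))) \<le> e * lp_dist p y x"
      using L(3)[OF e1(1)] L(4) eventually_mem_lp_ball_nhds[of x]
    proof eventually_elim
      case (elim y)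
      let ?D = "lp_dist p y x" and ?A = "f y - f x - L (\<lambda>i. y i - x i)"
      have "norm (?h y - ?h x - (h' * L (\<lambda>i. y i - x i) + 0 * L (\<lambda>i. y i - x i))) =
        norm ((h (f y) - h (f x) - h' * (f y - f x)) + h' * ?A)"
        using elim(4) x by (simp add: algebra_simps)
      also have "\<dots> \<le> norm (h (f y) - h (f x) - h' * (f y - f x)) + norm h' * norm ?A"
        unfolding norm_mult[symmetric] by (rule norm_triangle_ineq)
      also have "\<dots> \<le> e / (2*C) * norm (f y - f x) + B * (e / (2*B) * ?D)"
        using B(1) by (intro add_mono[OF r(2)[OF elim(1)] mult_mono[OF B(2) elim(2)]]) auto
      also have "\<dots> \<le> e / (2*C) * (C * ?D) + B * (e / (2*B) * ?D)"
        by (intro add_right_mono mult_left_mono elim(3) less_imp_le[OF e1(2)])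
      also have "\<dots> = e * ?D" using B(1) L(2) by (simp add: field_simps)
      finally show ?case .
    qed
  qed
qed simp

text \<open>The compact set \<open>T\<close> supplies the uniform continuity: \<open>h\<close> may
  behave badly near the boundary of \<open>S\<close>, but the values of \<open>f\<close> stay away
  from it.\<close>

lemma Au_compose_bounded:
  assumes f: "f \<in> Au p" and S: "open S" "compact T" "T \<subseteq> S" "\<And>x. x \<in> lp_ball p \<Longrightarrow> f x \<in> T"
    and h: "h holomorphic_on S"
  shows "(\<lambda>x\<in>lp_ball p. h (f x)) \<in> Au p"
proof (rule Au_compose[OF f S(1) _ h])
  show "uniformly_continuous_on (f ` lp_ball p) h"
    unfolding uniformly_continuous_on_def
  proof (intro allI impI)
    fix e :: real assume e: "e > 0"
    have "uniformly_continuous_on T h"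
      by (intro compact_uniformly_continuous S(2) holomorphic_on_imp_continuous_on holomorphic_on_subset[OF h S(3)])
    then have "\<exists>d>0. \<forall>u\<in>T. \<forall>v\<in>T. dist v u < d \<longrightarrow> dist (h v) (h u) < e"
      using e unfolding uniformly_continuous_on_def by simp
    then obtain d where d: "d > 0" "\<forall>u\<in>T. \<forall>v\<in>T. dist v u < d \<longrightarrow> dist (h v) (h u) < e"
      by metis
    show "\<exists>d>0. \<forall>u\<in>f ` lp_ball p. \<forall>v\<in>f ` lp_ball p. dist v u < d \<longrightarrow> dist (h v) (h u) < e"
    proof (intro exI[of _ d] conjI ballI impI d(1))
      fix u v assume "u \<in> f ` lp_ball p" "v \<in> f ` lp_ball p" "dist v u < d"
      moreover have "f ` lp_ball p \<subseteq> T" using S(4) by (rule image_subsetI)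
      ultimately show "dist (h v) (h u) < e"
        using d(2)[THEN bspec, of u, THEN bspec, of v] by (simp add: subsetD)
    qed
  qed
qed (use S in auto)

lemma Au_cmult:
  assumes f: "f \<in> Au p" shows "(\<lambda>x\<in>lp_ball p. c * f x) \<in> Au p"
proof -
  have "(\<lambda>x\<in>lp_ball p. (\<lambda>x\<in>lp_ball p. c) x * f x) = (\<lambda>x\<in>lp_ball p. c * f x)"
    by (rule restrict_ext) simp
  then show ?thesis using Au_mult[OF Au_const[OF p] f, of c] by (simp only:)
qed

lemma Au_power:
  assumes f: "f \<in> Au p" shows "(\<lambda>x\<in>lp_ball p. f x ^ n) \<in> Au p"
proof (induction n)
  case (Suc n)
  have "(\<lambda>x\<in>lp_ball p. f x * (\<lambda>x\<in>lp_ball p. f x ^ n) x) = (\<lambda>x\<in>lp_ball p. f x ^ Suc n)"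
    by (rule restrict_ext) simp
  then show ?case using Au_mult[OF f Suc] by (simp only:)
qed (use Au_const[OF p, of 1] in \<open>simp only: power_0\<close>)

end

section \<open>Evaluations at points of the closed ball\<close>

context
  fixes p :: real
  assumes p: "1 < p"
begin

text \<open>Scaling by \<open>t < 1\<close> leads from the closed ball into the open one. Hence the
  neighbourhood filter is proper, and evaluations can be computed as radial limits.\<close>

lemma radial_filterlim:
  assumes "x \<in> lp p" "lp_norm p x \<le> 1"
  shows "filterlim (\<lambda>t i. complex_of_real t * x i) (lp_ball_nhds p x) (at_left 1)"
  unfolding filterlim_iff
proof (intro allI impI)
  fix P assume "eventually P (lp_ball_nhds p x)"
  then obtain d where d: "d > 0" "\<And>y. y \<in> lp_ball p \<Longrightarrow> lp_dist p y x < d \<Longrightarrow> P y"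
    unfolding eventually_lp_ball_nhds[OF p] by blast
  have "P (\<lambda>i. complex_of_real t * x i)" if t: "max 0 (1 - d) < t" "t < 1" for t :: real
  proof (rule d(2))
    have "t * lp_norm p x < 1"
      using assms(2) t mult_left_le[of "lp_norm p x" t] by linarith
    then show "(\<lambda>i. complex_of_real t * x i) \<in> lp_ball p"
      using t lp_scale(1,2)[OF p assms(1), of t] by (simp add: lp_ball_def)
    have "lp_dist p (\<lambda>i. complex_of_real t * x i) x = (1 - t) * lp_norm p x"
      using lp_dist_segment[OF p assms(1), of t 1] t by simp
    also have "\<dots> \<le> 1 - t"
      using t assms(2) by (intro mult_left_le) auto
    finally show "lp_dist p (\<lambda>i. complex_of_real t * x i) x < d" using t by linarith
  qed
  then show "\<forall>\<^sub>F t in at_left 1. P (\<lambda>i. complex_of_real t * x i)"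
    using d(1) unfolding eventually_at_left_field by (intro exI[of _ "max 0 (1 - d)"]) auto
qed

lemma lp_ball_nhds_neq_bot:
  assumes "x \<in> lp p" "lp_norm p x \<le> 1"
  shows "lp_ball_nhds p x \<noteq> bot"
proof
  assume "lp_ball_nhds p x = bot"
  then have "\<forall>\<^sub>F y in lp_ball_nhds p x. False"
    by simp
  from eventually_compose_filterlim[OF this radial_filterlim[OF assms]]
  have "\<forall>\<^sub>F t::real in at_left 1. False" .
  then show False by simp
qed

text \<open>\<open>Lim\<close> is a choice operator, so existence comes first: uniform continuity
  makes the image filter Cauchy, and the complex plane is complete.\<close>

lemma evaluation_tendsto:
  assumes f: "f \<in> Au p" and x: "x \<in> lp p" "lp_norm p x \<le> 1"
  shows "(f \<longlongrightarrow> evaluation p x f) (lp_ball_nhds p x)"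
proof -
  have "cauchy_filter (filtermap f (lp_ball_nhds p x))"
    unfolding cauchy_filter_metric_filtermap
  proof (intro allI impI)
    fix e :: real assume "e > 0"
    then obtain d where d: "0 < d" "\<And>x y. x \<in> lp_ball p \<Longrightarrow> y \<in> lp_ball p \<Longrightarrow> lp_dist p x y < d \<Longrightarrow> norm (f x - f y) < e"
      using Au_ucont[OF p f] by blast
    \<comment> \<open>The radius \<open>d / 4\<close> compensates for the constant 4 in
      \<open>lp_dist_triangle\<close>.\<close>
    let ?P = "\<lambda>y. y \<in> lp_ball p \<and> lp_dist p y x < d / 4"
    have "dist (f y) (f w) < e" if "?P y" "?P w" for y w
    proof -
      have "lp_dist p y w \<le> 4 * max (lp_dist p y x) (lp_dist p w x)"
        using that by (intro lp_dist_triangle[OF p] x lp_ball_lp[OF p]) auto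
      also have "4 * max (lp_dist p y x) (lp_dist p w x) < d" using that by (auto simp: max_def)
      finally show ?thesis using d(2)[of y w] that by (simp add: dist_norm)
    qed
    moreover have "eventually ?P (lp_ball_nhds p x)"
      unfolding eventually_lp_ball_nhds[OF p] using d(1) by (intro exI[of _ "d / 4"]) auto
    ultimately show "\<exists>P. eventually P (lp_ball_nhds p x) \<and> (\<forall>x y. P x \<and> P y \<longrightarrow> dist (f x) (f y) < e)"
      by (intro exI[of _ ?P]) simp
  qed
  moreover have "filtermap f (lp_ball_nhds p x) \<noteq> bot"
    using lp_ball_nhds_neq_bot[OF x] by (simp add: filtermap_bot_iff)
  ultimately obtain l where "filtermap f (lp_ball_nhds p x) \<le> nhds l"
    using complete_UNIV[where 'a = complex, unfolded complete_uniform, THEN spec, of "filtermap f (lp_ball_nhds p x)"]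
    by (simp, blast)
  then have "(f \<longlongrightarrow> l) (lp_ball_nhds p x)"
    by (simp add: filterlim_def)
  then show ?thesis
    using tendsto_Lim[OF lp_ball_nhds_neq_bot[OF x], of f l] f by (simp add: evaluation_def)
qed

lemma evaluation_eqI:
  assumes f: "f \<in> Au p" and x: "x \<in> lp p" "lp_norm p x \<le> 1"
    and l: "((\<lambda>t. f (\<lambda>i. complex_of_real t * x i)) \<longlongrightarrow> l) (at_left 1)"
  shows "evaluation p x f = l"
  using tendsto_unique[OF _ filterlim_compose[OF evaluation_tendsto[OF f x] radial_filterlim[OF x]] l]
  by simp

lemma evaluation_restrict:
  assumes f: "restrict h (lp_ball p) \<in> Au p" and x: "x \<in> lp p" "lp_norm p x \<le> 1"
    and l: "((\<lambda>t. h (\<lambda>i. complex_of_real t * x i)) \<longlongrightarrow> l) (at_left 1)"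
  shows "evaluation p x (restrict h (lp_ball p)) = l"
proof (rule evaluation_eqI[OF f x], rule Lim_transform_eventually[OF l])
  have "\<forall>\<^sub>F t in at_left 1. (\<lambda>i. complex_of_real t * x i) \<in> lp_ball p"
    by (rule eventually_compose_filterlim[OF eventually_mem_lp_ball_nhds[OF p] radial_filterlim[OF x]])
  then show "\<forall>\<^sub>F t in at_left 1. h (\<lambda>i. complex_of_real t * x i) =
      restrict h (lp_ball p) (\<lambda>i. complex_of_real t * x i)"
    by eventually_elim simp
qed

lemma evaluation_in_spectrum:
  assumes x: "x \<in> lp p" "lp_norm p x \<le> 1"
  shows "evaluation p x \<in> Au_spectrum p"
proof -
  note T = evaluation_tendsto[OF _ x]
  note U = tendsto_unique[OF lp_ball_nhds_neq_bot[OF x]]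
  have E: "(restrict h (lp_ball p) \<longlongrightarrow> l) (lp_ball_nhds p x)" if "(h \<longlongrightarrow> l) (lp_ball_nhds p x)" for h and l :: complex
    using that by (rule Lim_transform_eventually) (rule eventually_mono[OF eventually_mem_lp_ball_nhds[OF p]], simp)
  have "evaluation p x (\<lambda>x\<in>lp_ball p. f x + g x) = evaluation p x f + evaluation p x g"
    if "f \<in> Au p" "g \<in> Au p" for f g
    by (rule U[OF T[OF Au_add[OF p that]] E[OF tendsto_add[OF T[OF that(1)] T[OF that(2)]]]])
  moreover have "evaluation p x (\<lambda>x\<in>lp_ball p. f x * g x) = evaluation p x f * evaluation p x g"
    if "f \<in> Au p" "g \<in> Au p" for f g
    by (rule U[OF T[OF Au_mult[OF p that]] E[OF tendsto_mult[OF T[OF that(1)] T[OF that(2)]]]])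
  moreover have "evaluation p x (\<lambda>x\<in>lp_ball p. c * f x) = c * evaluation p x f"
    if "f \<in> Au p" for f c
    by (rule U[OF T[OF Au_cmult[OF p that]] E[OF tendsto_mult_left[OF T[OF that(1)]]]])
  moreover have "evaluation p x (\<lambda>x\<in>lp_ball p. 1) = 1"
    by (rule U[OF T[OF Au_const[OF p]] E[OF tendsto_const]])
  moreover have "evaluation p x \<in> extensional (Au p)"
    by (simp add: evaluation_def)
  ultimately show ?thesis
    unfolding Au_spectrum_def mem_Collect_eq using Au_const[OF p, of 1]
    by (intro conjI ballI allI bexI[of _ "\<lambda>x\<in>lp_ball p. 1"]) simp_all
qed

subsection \<open>Characters and Gleason parts\<close>

lemma spectrum_extensional: "\<phi> \<in> Au_spectrum p \<Longrightarrow> \<phi> \<in> extensional (Au p)"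
  by (simp add: Au_spectrum_def)

lemma spectrum_add:
  "\<phi> \<in> Au_spectrum p \<Longrightarrow> f \<in> Au p \<Longrightarrow> g \<in> Au p \<Longrightarrow> \<phi> (\<lambda>x\<in>lp_ball p. f x + g x) = \<phi> f + \<phi> g"
  by (simp add: Au_spectrum_def)

lemma spectrum_mult:
  "\<phi> \<in> Au_spectrum p \<Longrightarrow> f \<in> Au p \<Longrightarrow> g \<in> Au p \<Longrightarrow> \<phi> (\<lambda>x\<in>lp_ball p. f x * g x) = \<phi> f * \<phi> g"
  by (simp add: Au_spectrum_def)

lemma spectrum_cmult:
  "\<phi> \<in> Au_spectrum p \<Longrightarrow> f \<in> Au p \<Longrightarrow> \<phi> (\<lambda>x\<in>lp_ball p. c * f x) = c * \<phi> f"
  by (simp add: Au_spectrum_def)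

lemma spectrum_one:
  assumes \<phi>: "\<phi> \<in> Au_spectrum p" shows "\<phi> (\<lambda>x\<in>lp_ball p. 1) = 1"
proof -
  from \<phi> obtain f where f: "f \<in> Au p" "\<phi> f \<noteq> 0"
    unfolding Au_spectrum_def by auto
  have "(\<lambda>x\<in>lp_ball p. f x * (\<lambda>x\<in>lp_ball p. 1) x) = (\<lambda>x\<in>lp_ball p. f x)"
    by (rule restrict_ext) simp
  then have "(\<lambda>x\<in>lp_ball p. f x * (\<lambda>x\<in>lp_ball p. 1) x) = f"
    using Au_restrict[OF p f(1)] by (rule trans)
  then have "\<phi> f * \<phi> (\<lambda>x\<in>lp_ball p. 1) = \<phi> f"
    using spectrum_mult[OF \<phi> f(1) Au_const[OF p, of 1]] by (simp only:)
  with f(2) show ?thesis by simp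
qed

lemma spectrum_const:
  assumes \<phi>: "\<phi> \<in> Au_spectrum p" shows "\<phi> (\<lambda>x\<in>lp_ball p. c) = c"
proof -
  have "(\<lambda>x\<in>lp_ball p. c * (\<lambda>x\<in>lp_ball p. 1) x) = (\<lambda>x\<in>lp_ball p. c)"
    by (rule restrict_ext) simp
  then show ?thesis
    using spectrum_cmult[OF \<phi> Au_const[OF p, of 1], of c] spectrum_one[OF \<phi>] by (simp only: mult_1_right)
qed

lemma Au_affine:
  assumes f: "f \<in> Au p" shows "(\<lambda>x\<in>lp_ball p. a + b * f x) \<in> Au p"
proof -
  have "(\<lambda>x\<in>lp_ball p. (\<lambda>x\<in>lp_ball p. a) x + (\<lambda>x\<in>lp_ball p. b * f x) x) = (\<lambda>x\<in>lp_ball p. a + b * f x)"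
    by (rule restrict_ext) simp
  then show ?thesis
    using Au_add[OF p Au_const[OF p, of a] Au_cmult[OF p f, of b]] by (simp only:)
qed

lemma spectrum_affine:
  assumes \<phi>: "\<phi> \<in> Au_spectrum p" and f: "f \<in> Au p"
  shows "\<phi> (\<lambda>x\<in>lp_ball p. a + b * f x) = a + b * \<phi> f"
proof -
  have "(\<lambda>x\<in>lp_ball p. (\<lambda>x\<in>lp_ball p. a) x + (\<lambda>x\<in>lp_ball p. b * f x) x) = (\<lambda>x\<in>lp_ball p. a + b * f x)"
    by (rule restrict_ext) simp
  then show ?thesis
    using spectrum_add[OF \<phi> Au_const[OF p, of a] Au_cmult[OF p f, of b]]
      spectrum_const[OF \<phi>, of a] spectrum_cmult[OF \<phi> f, of b] by (simp only:)
qed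

lemma spectrum_power:
  assumes \<phi>: "\<phi> \<in> Au_spectrum p" and f: "f \<in> Au p"
  shows "\<phi> (\<lambda>x\<in>lp_ball p. f x ^ n) = \<phi> f ^ n"
proof (induction n)
  case 0
  show ?case using spectrum_one[OF \<phi>] by (simp only: power_0)
next
  case (Suc n)
  have "(\<lambda>x\<in>lp_ball p. f x * (\<lambda>x\<in>lp_ball p. f x ^ n) x) = (\<lambda>x\<in>lp_ball p. f x ^ Suc n)"
    by (rule restrict_ext) simp
  then show ?case
    using spectrum_mult[OF \<phi> f Au_power[OF p f, of n]] Suc by (simp only: power_Suc)
qed

text \<open>Were the modulus of \<open>\<phi> f\<close> larger than the norm of \<open>f\<close>,
  the function \<open>\<phi> f - f\<close> would be invertible in \<open>Au p\<close>, and yet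
  \<open>\<phi>\<close> sends it to 0. So characters are automatically contractive.\<close>

lemma spectrum_bound:
  assumes \<phi>: "\<phi> \<in> Au_spectrum p" and f: "f \<in> Au p"
  shows "norm (\<phi> f) \<le> Au_norm p f"
proof (rule ccontr)
  assume *: "\<not> norm (\<phi> f) \<le> Au_norm p f"
  define c where "c = \<phi> f"
  define g where "g = (\<lambda>x\<in>lp_ball p. c + (-1) * f x)"
  define h where "h = (\<lambda>x\<in>lp_ball p. inverse (c - f x))"
  have cf: "c \<noteq> f x" if "x \<in> lp_ball p" for x
    using norm_le_Au_norm[OF p f that] * by (auto simp: c_def)
  have h: "h \<in> Au p"
    unfolding h_def
  proof (rule Au_compose_bounded[OF p f, where S = "- {c}" and T = "cball 0 (Au_norm p f)"])
    show "cball 0 (Au_norm p f) \<subseteq> - {c}" using * by (auto simp: c_def)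
    show "(\<lambda>w. inverse (c - w)) holomorphic_on - {c}" by (auto intro!: holomorphic_intros)
  qed (use norm_le_Au_norm[OF p f] in auto)
  have g: "g \<in> Au p" unfolding g_def by (rule Au_affine[OF f])
  have "(\<lambda>x\<in>lp_ball p. g x * h x) = (\<lambda>x\<in>lp_ball p. 1)"
    by (rule restrict_ext) (use cf in \<open>auto simp: g_def h_def\<close>)
  then have "\<phi> g * \<phi> h = 1"
    using spectrum_mult[OF \<phi> g h] spectrum_one[OF \<phi>] by (simp only:)
  moreover have "\<phi> g = 0"
    unfolding g_def spectrum_affine[OF \<phi> f] by (simp add: c_def)
  ultimately show False by simp
qed

text \<open>Contractivity bounds all differences by 2, so the real supremum in
  \<open>functional_dist\<close> is a genuine one.\<close>

lemma functional_dist_upper: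
  assumes "\<phi> \<in> Au_spectrum p" "\<psi> \<in> Au_spectrum p" "f \<in> Au p" "Au_norm p f \<le> 1"
  shows "norm (\<phi> f - \<psi> f) \<le> functional_dist p \<phi> \<psi>"
  unfolding functional_dist_def
proof (rule cSUP_upper)
  show "bdd_above ((\<lambda>f. norm (\<phi> f - \<psi> f)) ` {f \<in> Au p. Au_norm p f \<le> 1})"
  proof (rule bdd_aboveI2)
    fix f assume "f \<in> {f \<in> Au p. Au_norm p f \<le> 1}"
    then show "norm (\<phi> f - \<psi> f) \<le> 2"
      using spectrum_bound[OF assms(1), of f] spectrum_bound[OF assms(2), of f]
        norm_triangle_ineq4[of "\<phi> f" "\<psi> f"] by auto
  qed
qed (use assms in auto)

lemma functional_dist_self [simp]: "functional_dist p \<phi> \<phi> = 0"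
proof -
  have "{f \<in> Au p. Au_norm p f \<le> 1} \<noteq> {}"
    using Au_const[OF p, of 0] Au_norm_le[OF p, of "\<lambda>x\<in>lp_ball p. 0" 1] by auto
  then show ?thesis by (simp add: functional_dist_def)
qed

lemma norm_moebius_le:
  fixes w :: complex and t :: real
  assumes "norm w \<le> 1" "0 \<le> t" "t < 1"
  shows "norm (w - t) \<le> norm (1 - t * w)"
proof -
  have e: "Re (1 - t * w) = 1 - t * Re w" "Im (1 - t * w) = - (t * Im w)"
    "Re (w - t) = Re w - t" "Im (w - t) = Im w"
    by simp_all
  have "(norm (1 - t * w))\<^sup>2 - (norm (w - t))\<^sup>2 = (1 - t\<^sup>2) * (1 - (norm w)\<^sup>2)"
    unfolding cmod_power2 e by algebra
  also have "\<dots> \<ge> 0"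
    using power_le_one[OF assms(2) less_imp_le[OF assms(3)], of 2] power_le_one[OF norm_ge_zero assms(1), of 2]
    by (intro mult_nonneg_nonneg) linarith+
  finally have "(norm (w - t))\<^sup>2 \<le> (norm (1 - t * w))\<^sup>2" by linarith
  then show ?thesis by (rule power2_le_imp_le) (rule norm_ge_zero)
qed

lemma one_minus_neq_0:
  fixes w :: complex and t :: real
  assumes "norm w \<le> 1" "0 \<le> t" "t < 1"
  shows "1 - t * w \<noteq> 0" and "1 - t \<le> norm (1 - t * w)"
proof -
  have "norm (t * w) \<le> t" using assms by (simp add: norm_mult mult_left_le)
  then show "1 - t \<le> norm (1 - t * w)"
    using norm_triangle_ineq2[of 1 "t * w"] by simp
  then show "1 - t * w \<noteq> 0" using assms by auto
qed

text \<open>A character respects the algebra operations only; its value at the quotient is therefore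
  read off from the identity \<open>m * (1 - t * f) = f - t\<close>.\<close>

lemma Au_moebius:
  assumes f: "f \<in> Au p" "Au_norm p f \<le> 1" and t: "0 \<le> t" "t < (1::real)"
  defines "m \<equiv> \<lambda>x\<in>lp_ball p. (f x - t) / (1 - t * f x)"
  shows "m \<in> Au p" and "Au_norm p m \<le> 1"
    and "\<phi> \<in> Au_spectrum p \<Longrightarrow> \<phi> m = (\<phi> f - t) / (1 - t * \<phi> f)"
proof -
  have f1: "norm (f x) \<le> 1" if "x \<in> lp_ball p" for x
    using norm_le_Au_norm[OF p f(1) that] f(2) by simp
  show m: "m \<in> Au p"
    unfolding m_def
  proof (rule Au_compose_bounded[OF p f(1), where S = "{w. 1 - complex_of_real t * w \<noteq> 0}" and T = "cball 0 1"])
    show "open {w. 1 - complex_of_real t * w \<noteq> 0}"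
      by (intro open_Collect_neq continuous_intros)
    show "(\<lambda>w. (w - t) / (1 - t * w)) holomorphic_on {w. 1 - complex_of_real t * w \<noteq> 0}"
      by (intro holomorphic_intros) auto
    show "cball 0 1 \<subseteq> {w. 1 - complex_of_real t * w \<noteq> 0}"
      using one_minus_neq_0(1) t by auto
  qed (use f1 in auto)
  show "Au_norm p m \<le> 1"
  proof (rule Au_norm_le[OF p])
    fix x assume x: "x \<in> lp_ball p"
    show "norm (m x) \<le> 1"
      using norm_moebius_le[OF f1[OF x] t] one_minus_neq_0(1)[OF f1[OF x] t] x
      by (simp add: m_def norm_divide divide_le_eq)
  qed
  assume \<phi>: "\<phi> \<in> Au_spectrum p"
  have \<phi>1: "norm (\<phi> f) \<le> 1" using spectrum_bound[OF \<phi> f(1)] f(2) by simp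
  have "(\<lambda>x\<in>lp_ball p. m x * (\<lambda>x\<in>lp_ball p. 1 + (- complex_of_real t) * f x) x) = (\<lambda>x\<in>lp_ball p. (- complex_of_real t) + 1 * f x)"
    by (rule restrict_ext) (use one_minus_neq_0(1)[OF f1 t] in \<open>auto simp: m_def field_simps\<close>)
  then have "\<phi> m * (1 + (- complex_of_real t) * \<phi> f) = - complex_of_real t + 1 * \<phi> f"
    using spectrum_mult[OF \<phi> m Au_affine[OF f(1), of 1 "- complex_of_real t"]]
      spectrum_affine[OF \<phi> f(1), of 1 "- complex_of_real t"] spectrum_affine[OF \<phi> f(1), of "- complex_of_real t" 1]
    by (simp only:)
  then show "\<phi> m = (\<phi> f - t) / (1 - t * \<phi> f)"
    using one_minus_neq_0(1)[OF \<phi>1 t] by (simp add: eq_divide_eq)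
qed

text \<open>A Moebius transformation that fixes \<open>1\<close> pushes every other point of the disc to \<open>-1\<close>.\<close>

lemma functional_dist_ge_2:
  assumes \<phi>: "\<phi> \<in> Au_spectrum p" and \<psi>: "\<psi> \<in> Au_spectrum p" and "\<epsilon> > 0"
    and peak: "\<And>\<delta>. \<delta> > 0 \<Longrightarrow> \<exists>f\<in>Au p. Au_norm p f \<le> 1 \<and> norm (\<phi> f - 1) < \<delta> \<and> norm (\<psi> f - 1) \<ge> \<epsilon>"
  shows "2 \<le> functional_dist p \<phi> \<psi>"
proof (rule field_le_epsilon)
  fix \<eta> :: real assume \<eta>: "\<eta> > 0"
  \<comment> \<open>With \<open>1 - t = r\<close>, the transform of a value \<open>w\<close> differs
    from 1 by at most \<open>2 * norm (w - 1) / r\<close> and from -1 by at most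
    \<open>2 * r / norm (1 - t * w)\<close>. The bound \<open>r \<le> \<epsilon> / 2\<close> keeps
    the last denominator above \<open>\<epsilon> / 2\<close> at \<open>\<psi> f\<close>, and
    \<open>r \<le> \<epsilon> * \<eta> / 8\<close> then makes the quotient at most
    \<open>\<eta> / 2\<close>. The tolerance for \<open>\<phi> f\<close> is chosen after
    \<open>r\<close>.\<close>
  define r where "r = min (1/2) (min (\<epsilon> / 2) (\<epsilon> * \<eta> / 8))"
  have r: "r > 0" "r \<le> 1/2" "r \<le> \<epsilon> / 2" "r \<le> \<epsilon> * \<eta> / 8"
    using \<eta> \<open>\<epsilon> > 0\<close> by (auto simp: r_def)
  define t where "t = 1 - r"
  have t: "0 \<le> t" "t < 1" "1 - t = r" using r by (auto simp: t_def)
  obtain f where f: "f \<in> Au p" "Au_norm p f \<le> 1" "norm (\<phi> f - 1) < r * \<eta> / 4" "norm (\<psi> f - 1) \<ge> \<epsilon>"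
    using peak[of "r * \<eta> / 4"] r(1) \<eta> by auto
  have n: "norm (\<phi> f) \<le> 1" "norm (\<psi> f) \<le> 1"
    using spectrum_bound[OF \<phi> f(1)] spectrum_bound[OF \<psi> f(1)] f(2) by simp_all
  define m where "m = (\<lambda>x\<in>lp_ball p. (f x - t) / (1 - t * f x))"
  note m = Au_moebius[OF f(1,2) t(1,2), folded m_def]
  have 1: "norm (\<phi> m - 1) \<le> \<eta> / 2"
  proof -
    have "\<phi> m - 1 = of_real (1 + t) * (\<phi> f - 1) / (1 - t * \<phi> f)"
      unfolding m(3)[OF \<phi>] using one_minus_neq_0(1)[OF n(1) t(1,2)] by (simp add: field_simps)
    then have "norm (\<phi> m - 1) = (1 + t) * norm (\<phi> f - 1) / norm (1 - t * \<phi> f)"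
      using t by (simp only: norm_divide norm_mult norm_of_real)
    also have "\<dots> \<le> 2 * (r * \<eta> / 4) / r"
      using f(3) t one_minus_neq_0(2)[OF n(1) t(1,2)] r \<eta>
      by (intro frac_le mult_mono) auto
    also have "\<dots> = \<eta> / 2" using r by simp
    finally show ?thesis .
  qed
  have 2: "norm (\<psi> m + 1) \<le> \<eta> / 2"
  proof -
    have "\<psi> m + 1 = of_real (1 - t) * (1 + \<psi> f) / (1 - t * \<psi> f)"
      unfolding m(3)[OF \<psi>] using one_minus_neq_0(1)[OF n(2) t(1,2)] by (simp add: field_simps)
    then have "norm (\<psi> m + 1) = r * norm (1 + \<psi> f) / norm (1 - t * \<psi> f)"
      using r(1) by (simp add: norm_divide norm_mult del: of_real_diff add: t(3))
    also have "\<dots> \<le> (\<epsilon> * \<eta> / 8) * 2 / (\<epsilon> / 2)"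
    proof (intro frac_le mult_mono)
      show "norm (1 + \<psi> f) \<le> 2" using n(2) norm_triangle_ineq[of 1 "\<psi> f"] by simp
      have "norm (\<psi> f - 1) = norm (of_real (1 - t) * \<psi> f - (1 - t * \<psi> f))"
        by (simp add: algebra_simps)
      also have "\<dots> \<le> norm (of_real (1 - t) * \<psi> f) + norm (1 - t * \<psi> f)"
        by (rule norm_triangle_ineq4)
      also have "norm (of_real (1 - t) * \<psi> f) \<le> r"
        unfolding t(3) using r(1) n(2) by (simp add: norm_mult mult_left_le)
      finally show "\<epsilon> / 2 \<le> norm (1 - t * \<psi> f)" using f(4) r(3) by simp
    qed (use r \<open>\<epsilon> > 0\<close> \<eta> in auto)
    also have "\<dots> = \<eta> / 2" using \<open>\<epsilon> > 0\<close> by simp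
    finally show ?thesis .
  qed
  have "2 = norm ((\<phi> m - \<psi> m) + (1 - \<phi> m) + (\<psi> m + 1))" by simp
  also have "\<dots> \<le> norm (\<phi> m - \<psi> m) + norm (1 - \<phi> m) + norm (\<psi> m + 1)"
    by (intro norm_triangle_mono order_refl)
  also have "norm (1 - \<phi> m) = norm (\<phi> m - 1)" by (rule norm_minus_commute)
  finally show "2 \<le> functional_dist p \<phi> \<psi> + \<eta>"
    using functional_dist_upper[OF \<phi> \<psi> m(1,2)] 1 2 by linarith
qed

text \<open>Peaking spreads over a Gleason part: if \<open>\<psi> (f k)\<close> stayed away from 1
  for infinitely many \<open>k\<close>, those \<open>f k\<close> would eventually peak at
  \<open>\<phi>\<close> but not at \<open>\<psi>\<close>, and \<open>functional_dist_ge_2\<close>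
  would put the two at distance 2.\<close>

lemma gleason_part_tendsto_1:
  assumes \<phi>: "\<phi> \<in> Au_spectrum p" and \<psi>: "\<psi> \<in> gleason_part p \<phi>"
    and f: "\<And>k. f k \<in> Au p" "\<And>k. Au_norm p (f k) \<le> 1" and lim: "(\<lambda>k. \<phi> (f k)) \<longlonglongrightarrow> 1"
  shows "(\<lambda>k. \<psi> (f k)) \<longlonglongrightarrow> 1"
proof (rule ccontr)
  assume "\<not> ?thesis"
  then obtain e where e: "e > 0" "\<not> (\<forall>\<^sub>F k in sequentially. dist (\<psi> (f k)) 1 < e)"
    unfolding tendsto_iff by auto
  have \<psi>S: "\<psi> \<in> Au_spectrum p" using \<psi> by (simp add: gleason_part_def)
  have "2 \<le> functional_dist p \<phi> \<psi>"
  proof (rule functional_dist_ge_2[OF \<phi> \<psi>S e(1)])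
    fix \<delta> :: real assume "\<delta> > 0"
    with lim have "\<forall>\<^sub>F k in sequentially. dist (\<phi> (f k)) 1 < \<delta>" by (rule tendstoD)
    with e(2)[unfolded not_eventually] have "\<exists>\<^sub>F k in sequentially. \<not> dist (\<psi> (f k)) 1 < e \<and> dist (\<phi> (f k)) 1 < \<delta>"
      by (rule frequently_eventually_frequently)
    from frequently_ex[OF this] obtain k where k: "\<not> dist (\<psi> (f k)) 1 < e \<and> dist (\<phi> (f k)) 1 < \<delta>" ..
    show "\<exists>f\<in>Au p. Au_norm p f \<le> 1 \<and> norm (\<phi> f - 1) < \<delta> \<and> norm (\<psi> f - 1) \<ge> e"
      using k f(2)[of k] by (intro bexI[OF _ f(1)[of k]]) (simp add: dist_norm not_less)
  qed
  then show False using \<psi> by (simp add: gleason_part_def)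
qed

end

subsection \<open>Diagonal polynomials and tails of functionals\<close>

definition diag_poly :: "nat \<Rightarrow> (nat \<Rightarrow> complex) \<Rightarrow> (nat \<Rightarrow> complex) \<Rightarrow> complex" where
  "diag_poly N a x = (\<Sum>i. a i * x i ^ N)"

lemma norm_power_diff_le:
  fixes x y :: complex and M :: real
  assumes "norm x \<le> M" "norm y \<le> M"
  shows "norm (y ^ Suc n - x ^ Suc n) \<le> Suc n * M ^ n * norm (y - x)"
proof (induction n)
  case (Suc n)
  have M: "0 \<le> M" using assms(1) norm_ge_zero[of x] by linarith
  have "norm (y ^ Suc (Suc n) - x ^ Suc (Suc n)) = norm (y * (y ^ Suc n - x ^ Suc n) + x ^ Suc n * (y - x))"
    by (simp add: algebra_simps)
  also have "\<dots> \<le> norm y * norm (y ^ Suc n - x ^ Suc n) + norm x ^ Suc n * norm (y - x)"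
    unfolding norm_mult[symmetric] norm_power[symmetric] by (rule norm_triangle_ineq)
  also have "\<dots> \<le> M * (Suc n * M ^ n * norm (y - x)) + M ^ Suc n * norm (y - x)"
    by (intro add_mono mult_mono Suc power_mono assms) (use M in auto)
  also have "\<dots> = Suc (Suc n) * M ^ Suc n * norm (y - x)"
    by (simp add: algebra_simps)
  finally show ?case .
qed simp

text \<open>The remainder \<open>R\<close> of degree \<open>n + 2\<close> yields the next one as
  \<open>y * R\<close> plus a quadratic term. Two degrees go into the squared difference; the power
  \<open>M ^ n\<close> is kept because, for \<open>n \<ge> p\<close>, it becomes summable over the
  coordinates.\<close>

lemma norm_power_remainder_le:
  fixes x y :: complex and M :: real
  assumes "norm x \<le> M" "norm y \<le> M"
  shows "norm (y ^ (n+2) - x ^ (n+2) - of_nat (n+2) * x ^ (n+1) * (y - x)) \<le> (real (n+2))\<^sup>2 * M ^ n * (norm (y - x))\<^sup>2"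
proof (induction n)
  case 0
  have "y ^ (0+2) - x ^ (0+2) - of_nat (0+2) * x ^ (0+1) * (y - x) = (y - x)\<^sup>2"
    by (simp add: power2_eq_square algebra_simps)
  then show ?case by (simp add: norm_power)
next
  case (Suc n)
  let ?R = "y ^ (n+2) - x ^ (n+2) - of_nat (n+2) * x ^ (n+1) * (y - x)" and ?d = "(norm (y - x))\<^sup>2"
  have M: "0 \<le> M" using assms(1) norm_ge_zero[of x] by linarith
  have "y ^ (Suc n+2) - x ^ (Suc n+2) - of_nat (Suc n+2) * x ^ (Suc n+1) * (y - x)
      = y * ?R + of_nat (n+2) * x ^ (n+1) * (y - x)\<^sup>2"
    by (simp add: power2_eq_square algebra_simps)
  then have "norm (y ^ (Suc n+2) - x ^ (Suc n+2) - of_nat (Suc n+2) * x ^ (Suc n+1) * (y - x))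
      \<le> norm (y * ?R) + norm (of_nat (n+2) * x ^ (n+1) * (y - x)\<^sup>2)"
    by (simp only: norm_triangle_ineq)
  also have "\<dots> = norm y * norm ?R + real (n+2) * norm x ^ (n+1) * ?d"
    by (simp only: norm_mult norm_power norm_of_nat)
  also have "\<dots> \<le> M * ((real (n+2))\<^sup>2 * M ^ n * ?d) + real (n+2) * M ^ (n+1) * ?d"
    by (intro add_mono mult_mono Suc power_mono assms order_refl) (use M in auto)
  also have "\<dots> = ((real (n+2))\<^sup>2 + real (n+2)) * (M ^ Suc n * ?d)"
    by (simp add: algebra_simps)
  also have "\<dots> \<le> (real (Suc n+2))\<^sup>2 * (M ^ Suc n * ?d)"
    using M by (intro mult_right_mono) (auto simp: power2_eq_square algebra_simps)
  finally show ?case by (simp only: mult.assoc)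
qed

context
  fixes p :: real
  assumes p: "1 < p"
begin

lemma power_le_powr:
  fixes u :: real
  assumes "0 \<le> u" "u \<le> 1" "p \<le> real n"
  shows "u ^ n \<le> u powr p"
proof (cases "u = 0")
  case True
  moreover have "n > 0" using assms(3) p by (cases n) auto
  ultimately show ?thesis by (simp add: zero_power)
next
  case False
  then have "u ^ n = u powr real n" using assms by (simp add: powr_realpow)
  also have "\<dots> \<le> u powr p" using assms by (intro powr_mono') auto
  finally show ?thesis .
qed

lemma max_power_le:
  fixes u v :: real
  assumes "0 \<le> u" "u \<le> 1" "0 \<le> v" "v \<le> 1" "p \<le> real n"
  shows "max u v ^ n \<le> u powr p + v powr p"
  using power_le_powr[of u n] power_le_powr[of v n] assms by (auto simp: max_def add_increasing add_increasing2)

context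
  fixes n N :: nat and a :: "nat \<Rightarrow> complex"
  assumes n: "p \<le> real n" and N: "N = n + 2" and a: "\<And>i. norm (a i) \<le> 1"
begin

lemma diag_poly_term_le:
  assumes "norm (x i) \<le> 1" shows "norm (a i * x i ^ N) \<le> norm (x i) powr p"
proof -
  have "norm (a i * x i ^ N) \<le> 1 * norm (x i) ^ N"
    unfolding norm_mult norm_power by (intro mult_right_mono a) auto
  also have "\<dots> \<le> norm (x i) powr p"
    using power_le_powr[OF norm_ge_zero assms, of N] n by (simp add: N)
  finally show ?thesis .
qed

lemma diag_poly_summable:
  assumes "x \<in> lp p" "lp_norm p x \<le> 1"
  shows "summable (\<lambda>i. a i * x i ^ N)"
  by (rule summable_comparison_test'[OF lp_summable[OF p assms(1)], of 0])
    (use norm_le_lp_norm[OF p assms(1)] assms(2) diag_poly_term_le order_trans in blast)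

lemma diag_poly_scale:
  assumes "x \<in> lp p" "lp_norm p x \<le> 1"
  shows "diag_poly N a (\<lambda>i. c * x i) = c ^ N * diag_poly N a x"
  using suminf_mult[OF diag_poly_summable[OF assms], of "c ^ N"]
  by (simp add: diag_poly_def power_mult_distrib mult_ac)

text \<open>Bounded coefficients suffice because everything is estimated term by term: at most two
  of the \<open>n + 2\<close> degrees are spent on differences, and the remaining ones, at least
  \<open>n \<ge> p\<close>, are dominated by the masses of the two points, of total at most
  2.\<close>

lemma Au_diag_poly: "(\<lambda>x\<in>lp_ball p. diag_poly N a x) \<in> Au p" (is "?Q \<in> _")
proof (rule AuI[OF p])
  have x1: "norm (x i) \<le> 1" if "x \<in> lp_ball p" for x i
    using norm_le_lp_norm[OF p lp_ball_lp[OF p that], of i] that by (simp add: lp_ball_def)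
  have xs: "summable (\<lambda>i. a i * x i ^ N)" if "x \<in> lp_ball p" for x
    by (rule diag_poly_summable) (use that in \<open>simp_all add: lp_ball_def\<close>)
  have xp: "summable (\<lambda>i. norm (x i) powr p)" "(\<Sum>i. norm (x i) powr p) \<le> 1" if "x \<in> lp_ball p" for x
    using that mem_lp_ball[OF p, of x] lp_summable[OF p, of x] by (simp_all add: lp_pow_def)
  have mx: "max (norm (x i)) (norm (y i)) ^ m \<le> norm (x i) powr p + norm (y i) powr p"
    if "x \<in> lp_ball p" "y \<in> lp_ball p" "n \<le> m" for x y i m
    by (intro max_power_le norm_ge_zero x1 that) (use that(3) n in linarith)
  have s2: "summable (\<lambda>i. C * (norm (x i) powr p + norm (y i) powr p))"
      "(\<Sum>i. C * (norm (x i) powr p + norm (y i) powr p)) \<le> C * 2"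
    if "x \<in> lp_ball p" "y \<in> lp_ball p" "C \<ge> 0" for x y and C :: real
  proof -
    show "summable (\<lambda>i. C * (norm (x i) powr p + norm (y i) powr p))"
      by (intro summable_mult summable_add xp that)
    have "(\<Sum>i. C * (norm (x i) powr p + norm (y i) powr p)) = C * ((\<Sum>i. norm (x i) powr p) + (\<Sum>i. norm (y i) powr p))"
      by (simp add: suminf_mult suminf_add summable_add xp that)
    also have "\<dots> \<le> C * 2"
      using xp(2)[OF that(1)] xp(2)[OF that(2)] that(3) by (intro mult_left_mono) auto
    finally show "(\<Sum>i. C * (norm (x i) powr p + norm (y i) powr p)) \<le> C * 2" .
  qed
  have lip: "norm (diag_poly N a y - diag_poly N a x) \<le> real N * lp_dist p y x * 2"
    if xy: "x \<in> lp_ball p" "y \<in> lp_ball p" for x y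
  proof -
    let ?D = "lp_dist p y x"
    have b: "norm (a i * y i ^ N - a i * x i ^ N) \<le> real N * ?D * (norm (x i) powr p + norm (y i) powr p)" for i
    proof -
      have "norm (a i * y i ^ N - a i * x i ^ N) = norm (a i) * norm (y i ^ N - x i ^ N)"
        by (simp add: right_diff_distrib[symmetric] norm_mult)
      also have "\<dots> \<le> 1 * norm (y i ^ N - x i ^ N)"
        by (intro mult_right_mono a) auto
      also have "\<dots> \<le> real N * max (norm (x i)) (norm (y i)) ^ (n+1) * norm (y i - x i)"
        using norm_power_diff_le[of "x i" "max (norm (x i)) (norm (y i))" "y i" "n+1"] by (simp add: N)
      also have "\<dots> \<le> real N * (norm (x i) powr p + norm (y i) powr p) * ?D"
        by (intro mult_mono mx xy norm_diff_le_lp_dist[OF p] lp_ball_lp[OF p]) (auto simp: le_max_iff_disj)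
      finally show ?thesis by (simp only: mult_ac)
    qed
    have "norm (diag_poly N a y - diag_poly N a x) = norm (\<Sum>i. a i * y i ^ N - a i * x i ^ N)"
      unfolding diag_poly_def by (simp add: suminf_diff xs xy)
    also have "\<dots> \<le> (\<Sum>i. real N * ?D * (norm (x i) powr p + norm (y i) powr p))"
      by (intro norm_suminf_le b s2 xy) auto
    also have "\<dots> \<le> real N * ?D * 2"
      by (intro s2 xy) auto
    finally show ?thesis .
  qed
  show "lp_uniformly_continuous p ?Q"
    unfolding lp_uniformly_continuous_def
  proof (intro allI impI)
    fix e :: real assume e: "e > 0"
    have N0: "real N > 0" by (simp add: N)
    show "\<exists>d>0. \<forall>x\<in>lp_ball p. \<forall>y\<in>lp_ball p. lp_dist p x y < d \<longrightarrow> dist (?Q x) (?Q y) < e"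
    proof (intro exI[of _ "e / (real N * 2)"] conjI ballI impI)
      fix x y assume xy: "x \<in> lp_ball p" "y \<in> lp_ball p" "lp_dist p x y < e / (real N * 2)"
      then have "real N * lp_dist p x y * 2 < e" using N0 by (simp add: field_simps)
      then show "dist (?Q x) (?Q y) < e"
        using lip[OF xy(2,1)] xy by (simp add: dist_norm)
    qed (use e N0 in simp)
  qed
  fix x assume x: "x \<in> lp_ball p"
  \<comment> \<open>The termwise derivative at \<open>x\<close>; the exponent \<open>n + 1\<close>
    is \<open>N - 1\<close>.\<close>
  define L where "L = (\<lambda>h. \<Sum>i. a i * (of_nat N * x i ^ (n+1) * h i))"
  have Lb: "norm (a i * (of_nat N * x i ^ (n+1) * h i)) \<le> real N * lp_norm p h * norm (x i) powr p"
    if "h \<in> lp p" for h i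
  proof -
    have "norm (a i * (of_nat N * x i ^ (n+1) * h i)) = norm (a i) * (real N * norm (x i) ^ (n+1) * norm (h i))"
      by (simp only: norm_mult norm_power norm_of_nat)
    also have "\<dots> \<le> 1 * (real N * norm (x i) powr p * lp_norm p h)"
      using n by (intro mult_mono a norm_le_lp_norm[OF p that] power_le_powr x1 x) auto
    finally show ?thesis by (simp only: mult_ac mult_1)
  qed
  have Lp: "summable (\<lambda>i. C * norm (x i) powr p)" for C
    by (intro summable_mult xp x)
  have Ls: "summable (\<lambda>i. a i * (of_nat N * x i ^ (n+1) * h i))" if "h \<in> lp p" for h
    by (rule summable_comparison_test'[OF Lp, of 0]) (rule Lb[OF that])
  have L: "L \<in> lp_dual p"
    unfolding lp_dual_def mem_Collect_eq
  proof (intro conjI ballI allI exI)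
    fix g h assume gh: "g \<in> lp p" "h \<in> lp p"
    show "L (\<lambda>i. g i + h i) = L g + L h"
      unfolding L_def suminf_add[OF Ls[OF gh(1)] Ls[OF gh(2)]] by (simp only: distrib_left)
  next
    fix c h assume h: "h \<in> lp p"
    show "L (\<lambda>i. c * h i) = c * L h"
      unfolding L_def suminf_mult[OF Ls[OF h], symmetric] by (simp only: mult_ac)
  next
    fix h assume h: "h \<in> lp p"
    have "norm (L h) \<le> (\<Sum>i. real N * lp_norm p h * norm (x i) powr p)"
      unfolding L_def by (intro norm_suminf_le Lb h Lp)
    also have "\<dots> = real N * lp_norm p h * (\<Sum>i. norm (x i) powr p)"
      by (intro suminf_mult xp x)
    also have "\<dots> \<le> real N * lp_norm p h * 1"
      by (intro mult_left_mono xp x) auto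
    finally show "norm (L h) \<le> real N * lp_norm p h" by simp
  qed
  show "\<exists>L\<in>lp_dual p. \<forall>e>0. \<forall>\<^sub>F y in lp_ball_nhds p x. norm (?Q y - ?Q x - L (\<lambda>i. y i - x i)) \<le> e * lp_dist p y x"
  proof (intro bexI[OF _ L] allI impI)
    fix e :: real assume e: "e > 0"
    show "\<forall>\<^sub>F y in lp_ball_nhds p x. norm (?Q y - ?Q x - L (\<lambda>i. y i - x i)) \<le> e * lp_dist p y x"
      unfolding eventually_lp_ball_nhds[OF p]
    \<comment> \<open>The remainder is at most twice the square of \<open>N * lp_dist p y x\<close>,
      so this radius turns one of the two distance factors into \<open>e\<close>.\<close>
    proof (intro exI[of _ "e / ((real N)\<^sup>2 * 2)"] conjI ballI impI)
      fix y assume y: "y \<in> lp_ball p" and d: "lp_dist p y x < e / ((real N)\<^sup>2 * 2)"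
      let ?D = "lp_dist p y x"
      let ?R = "\<lambda>i. a i * y i ^ N - a i * x i ^ N - a i * (of_nat N * x i ^ (n+1) * (y i - x i))"
      have b: "norm (?R i) \<le> (real N)\<^sup>2 * ?D\<^sup>2 * (norm (x i) powr p + norm (y i) powr p)" for i
      proof -
        have "?R i = a i * (y i ^ N - x i ^ N - of_nat N * x i ^ (n+1) * (y i - x i))"
          by (simp only: right_diff_distrib)
        then have "norm (?R i) = norm (a i) * norm (y i ^ N - x i ^ N - of_nat N * x i ^ (n+1) * (y i - x i))"
          by (simp only: norm_mult)
        also have "\<dots> \<le> 1 * norm (y i ^ N - x i ^ N - of_nat N * x i ^ (n+1) * (y i - x i))"
          by (intro mult_right_mono a) auto
        also have "\<dots> \<le> (real N)\<^sup>2 * max (norm (x i)) (norm (y i)) ^ n * (norm (y i - x i))\<^sup>2"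
          unfolding N mult_1 by (rule norm_power_remainder_le) auto
        also have "\<dots> \<le> (real N)\<^sup>2 * (norm (x i) powr p + norm (y i) powr p) * ?D\<^sup>2"
          by (intro mult_mono mx x y norm_diff_le_lp_dist[OF p] power_mono lp_ball_lp[OF p])
            (auto simp: le_max_iff_disj)
        finally show ?thesis by (simp only: mult_ac)
      qed
      have h: "(\<lambda>i. y i - x i) \<in> lp p" by (intro lp_diff[OF p] lp_ball_lp[OF p] x y)
      have "diag_poly N a y - diag_poly N a x - L (\<lambda>i. y i - x i) = (\<Sum>i. ?R i)"
        unfolding diag_poly_def L_def suminf_diff[OF xs[OF y] xs[OF x]]
          suminf_diff[OF summable_diff[OF xs[OF y] xs[OF x]] Ls[OF h]] ..
      then have "norm (?Q y - ?Q x - L (\<lambda>i. y i - x i)) = norm (\<Sum>i. ?R i)"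
        using x y by simp
      also have "\<dots> \<le> (\<Sum>i. (real N)\<^sup>2 * ?D\<^sup>2 * (norm (x i) powr p + norm (y i) powr p))"
        by (intro norm_suminf_le b s2 x y) auto
      also have "\<dots> \<le> (real N)\<^sup>2 * ?D\<^sup>2 * 2"
        by (intro s2 x y) auto
      also have "\<dots> = (((real N)\<^sup>2 * 2) * ?D) * ?D"
        by (simp add: power2_eq_square)
      also have "\<dots> \<le> e * ?D"
        using d N by (intro mult_right_mono) (auto simp: field_simps)
      finally show "norm (?Q y - ?Q x - L (\<lambda>i. y i - x i)) \<le> e * ?D" .
    qed (use e N in simp)
  qed
qed simp

end

section \<open>Coordinates and uniform tails of continuous functionals\<close>

lemma lp_dual_coord_proj:
  assumes L: "L \<in> lp_dual p"
  shows "L (coord_proj n w) = (\<Sum>i<n. w i * L (canonical_vec i))"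
proof (induction n)
  case 0
  have "L (\<lambda>i. 0 * (0::complex)) = 0 * L (\<lambda>i. 0)"
    by (intro lp_dual_scale[OF p L] lp_ball_lp[OF p] zero_in_lp_ball[OF p])
  then show ?case by (simp add: coord_proj_def)
next
  case (Suc n)
  have v: "canonical_vec n \<in> lp p"
    by (rule finite_support_lp(1)[OF p, of "{n}"]) (auto simp: canonical_vec_def)
  have c: "coord_proj n w \<in> lp p"
    by (rule finite_support_lp(1)[OF p, of "{..<n}"]) (auto simp: coord_proj_def)
  have "coord_proj (Suc n) w = (\<lambda>i. coord_proj n w i + w n * canonical_vec n i)"
    by (auto simp: coord_proj_def canonical_vec_def fun_eq_iff less_Suc_eq)
  then have "L (coord_proj (Suc n) w) = L (coord_proj n w) + L (\<lambda>i. w n * canonical_vec n i)"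
    using lp_dual_add[OF p L c lp_scale(1)[OF p v, of "w n"]] by (simp only:)
  then show ?case
    using lp_dual_scale[OF p L v, of "w n"] Suc by (simp only: sum.lessThan_Suc)
qed

lemma coord_proj_tendsto:
  assumes x: "x \<in> lp p" shows "(\<lambda>n. lp_dist p x (coord_proj n x)) \<longlonglongrightarrow> 0"
proof -
  have c: "coord_proj n x \<in> lp p" for n
    by (rule finite_support_lp(1)[OF p, of "{..<n}"]) (auto simp: coord_proj_def)
  have "lp_pow p (\<lambda>i. x i - coord_proj n x i) = lp_pow p x - (\<Sum>i<n. norm (x i) powr p)" for n
  proof -
    have "lp_pow p (\<lambda>i. x i - coord_proj n x i)
      = (\<Sum>i. norm (x (i + n) - coord_proj n x (i + n)) powr p) + (\<Sum>i<n. norm (x i - coord_proj n x i) powr p)"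
      unfolding lp_pow_def by (rule suminf_split_initial_segment[OF lp_summable[OF p lp_diff[OF p x c]]])
    also have "\<dots> = (\<Sum>i. norm (x (i + n)) powr p)"
      using p by (simp add: coord_proj_def)
    also have "\<dots> = lp_pow p x - (\<Sum>i<n. norm (x i) powr p)"
      unfolding lp_pow_def by (rule suminf_minus_initial_segment[OF lp_summable[OF p x]])
    finally show ?thesis .
  qed
  moreover have "(\<lambda>n. lp_pow p x - (\<Sum>i<n. norm (x i) powr p)) \<longlonglongrightarrow> lp_pow p x - lp_pow p x"
    unfolding lp_pow_def by (intro tendsto_diff tendsto_const summable_LIMSEQ lp_summable[OF p x])
  ultimately have "(\<lambda>n. lp_pow p (\<lambda>i. x i - coord_proj n x i)) \<longlonglongrightarrow> 0"
    by simp
  then have "(\<lambda>n. lp_pow p (\<lambda>i. x i - coord_proj n x i) powr (1 / p)) \<longlonglongrightarrow> 0 powr (1 / p)"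
    by (rule tendsto_powr'[OF _ tendsto_const])
      (use p in \<open>auto intro!: always_eventually lp_pow_nonneg[OF p] lp_diff[OF p] x c\<close>)
  then show ?thesis
    using p by (simp add: lp_dist_def lp_norm_eq[OF p])
qed

lemma lp_dual_coord_proj_tendsto:
  assumes L: "L \<in> lp_dual p" and x: "x \<in> lp p"
  shows "(\<lambda>n. L (coord_proj n x)) \<longlonglongrightarrow> L x"
proof -
  obtain K where K: "K > 0" "\<And>x. x \<in> lp p \<Longrightarrow> norm (L x) \<le> K * lp_norm p x"
    using lp_dual_bound[OF p L] by blast
  have c: "coord_proj n x \<in> lp p" for n
    by (rule finite_support_lp(1)[OF p, of "{..<n}"]) (auto simp: coord_proj_def)
  have "(\<lambda>n. L x - L (coord_proj n x)) \<longlonglongrightarrow> 0"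
  proof (rule Lim_null_comparison)
    show "\<forall>\<^sub>F n in sequentially. norm (L x - L (coord_proj n x)) \<le> K * lp_dist p x (coord_proj n x)"
      using K(2)[OF lp_diff[OF p x c]] lp_dual_diff[OF p L x c] by (intro always_eventually) (simp add: lp_dist_def)
    show "(\<lambda>n. K * lp_dist p x (coord_proj n x)) \<longlonglongrightarrow> 0"
      by (rule tendsto_mult_right_zero[OF coord_proj_tendsto[OF x]])
  qed
  from tendsto_diff[OF tendsto_const[of "L x"] this] show ?thesis by simp
qed

text \<open>The converse of Hoelder's inequality: \<open>L\<close> is tested on truncations of
  \<open>w\<close>, whose entries have modulus \<open>norm (l i) powr (q - 1)\<close> and the phase
  that makes \<open>w i * l i\<close> nonnegative. A partial sum \<open>S\<close> then satisfies
  \<open>S \<le> K * S powr (1 / p)\<close>, hence \<open>S powr (1 / q) \<le> K\<close>.\<close>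

lemma lp_dual_coefficients_summable:
  assumes L: "L \<in> lp_dual p"
  shows "summable (\<lambda>i. norm (L (canonical_vec i)) powr (p / (p - 1)))"
proof -
  define q where "q = p / (p - 1)"
  have q: "q > 1" "(q - 1) * p = q" "1 - 1/p = 1/q" using p by (auto simp: q_def field_simps)
  define l where "l i = L (canonical_vec i)" for i
  obtain K where K: "K > 0" "\<And>x. x \<in> lp p \<Longrightarrow> norm (L x) \<le> K * lp_norm p x"
    using lp_dual_bound[OF p L] by blast
  \<comment> \<open>The exponent \<open>q - 2\<close> may be negative; vanishing coefficients do no
    harm because \<open>0 powr _ = 0\<close>.\<close>
  define w where "w i = complex_of_real (norm (l i) powr (q - 2)) * cnj (l i)" for i
  have wl: "w i * l i = of_real (norm (l i) powr q)" for i
  proof (cases "l i = 0")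
    case False
    have "w i * l i = of_real (norm (l i) powr (q - 2)) * of_real ((norm (l i))\<^sup>2)"
      unfolding w_def complex_norm_square by (simp only: mult_ac)
    also have "\<dots> = of_real (norm (l i) powr (q - 2) * norm (l i) powr 2)"
      using False by (simp add: powr_numeral)
    also have "norm (l i) powr (q - 2) * norm (l i) powr 2 = norm (l i) powr q"
      unfolding powr_add[symmetric] by simp
    finally show ?thesis .
  qed (use q in \<open>simp add: w_def\<close>)
  have wn: "norm (w i) powr p = norm (l i) powr q" for i
  proof (cases "l i = 0")
    case False
    have "norm (w i) = norm (l i) powr (q - 2) * norm (l i) powr 1"
      using False by (simp add: w_def norm_mult)
    also have "\<dots> = norm (l i) powr (q - 1)"
      unfolding powr_add[symmetric] by simp
    finally show ?thesis using q(2) by (simp add: powr_powr)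
  qed (use q p in \<open>simp add: w_def\<close>)
  have "(\<Sum>i<n. norm (l i) powr q) \<le> K powr q" for n
  proof (cases "(\<Sum>i<n. norm (l i) powr q) = 0")
    case False
    define S where "S = (\<Sum>i<n. norm (l i) powr q)"
    have S: "S > 0" using False sum_nonneg[of "{..<n}" "\<lambda>i. norm (l i) powr q"] by (simp add: S_def)
    have c: "coord_proj n w \<in> lp p" "lp_pow p (coord_proj n w) = S"
      using finite_support_lp[OF p, of "{..<n}" "coord_proj n w"] wn
      by (auto simp: coord_proj_def S_def)
    have "L (coord_proj n w) = (\<Sum>i<n. w i * l i)"
      unfolding l_def by (rule lp_dual_coord_proj[OF L])
    also have "\<dots> = of_real S" unfolding wl S_def by simp
    finally have "norm (L (coord_proj n w)) = S" using S by simp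
    then have "S \<le> K * S powr (1 / p)"
      using K(2)[OF c(1)] c(2) by (simp add: lp_norm_eq[OF p])
    moreover have "S = S powr (1/q) * S powr (1/p)"
      unfolding powr_add[symmetric] using q(3) S by (simp flip: q(3))
    ultimately have "S powr (1/q) * S powr (1/p) \<le> K * S powr (1/p)" by simp
    then have "S powr (1/q) \<le> K" using S by simp
    then have "(S powr (1/q)) powr q \<le> K powr q" using q by (intro powr_mono2) auto
    then show ?thesis using q S by (simp add: powr_powr S_def)
  qed simp
  then have "summable (\<lambda>i. norm (l i) powr q)"
    by (intro summableI_nonneg_bounded) auto
  then show ?thesis by (simp add: l_def q_def)
qed

text \<open>\<open>gleason_part_coordinate\<close> will give the values at coordinate functions
  only; uniform approximation by finite combinations carries them to every continuous functional. At
  \<open>p = 1\<close> the sum of all coordinates would be a counterexample.\<close>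

lemma lp_dual_uniform_tail:
  assumes L: "L \<in> lp_dual p" and "\<epsilon> > 0"
  shows "\<exists>n. \<forall>x\<in>lp_ball p. norm (L x - L (coord_proj n x)) \<le> \<epsilon>"
proof -
  define q where "q = p / (p - 1)"
  have q: "q > 1" "1 / p + 1 / q = 1" using p by (auto simp: q_def field_simps)
  define l where "l i = L (canonical_vec i)" for i
  \<comment> \<open>The weight for Young's inequality: \<open>\<eta> powr p\<close> spends half of
    \<open>\<epsilon>\<close> on the mass of \<open>x\<close>, which is below 1, and
    \<open>n\<close> is then taken so large that the tail of the coefficients, divided by
    \<open>\<eta> powr q\<close>, costs at most the other half.\<close>
  define \<eta> where "\<eta> = (\<epsilon> / 2) powr (1 / p)"
  have \<eta>: "\<eta> > 0" "\<eta> powr p = \<epsilon> / 2" using \<open>\<epsilon> > 0\<close> p by (simp_all add: \<eta>_def powr_powr)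
  have "summable (\<lambda>i. norm (l i) powr q)"
    unfolding l_def q_def by (rule lp_dual_coefficients_summable[OF L])
  moreover have "\<epsilon> / 2 * \<eta> powr q > 0" using \<open>\<epsilon> > 0\<close> \<eta> by simp
  ultimately obtain n where n: "\<And>m k. m \<ge> n \<Longrightarrow> norm (\<Sum>i=m..<k. norm (l i) powr q) < \<epsilon> / 2 * \<eta> powr q"
    unfolding summable_Cauchy by meson
  have "norm (L x - L (coord_proj n x)) \<le> \<epsilon>" if x: "x \<in> lp_ball p" for x
  proof (rule tendsto_upperbound)
    have xl: "x \<in> lp p" and x1: "lp_pow p x < 1" using x mem_lp_ball[OF p] by auto
    show "(\<lambda>m. norm (L (coord_proj m x) - L (coord_proj n x))) \<longlonglongrightarrow> norm (L x - L (coord_proj n x))"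
      by (intro tendsto_norm tendsto_diff tendsto_const lp_dual_coord_proj_tendsto[OF L xl])
    have "norm (L (coord_proj m x) - L (coord_proj n x)) \<le> \<epsilon>" if "m \<ge> n" for m
    proof -
      have y: "norm (x i * l i) \<le> \<epsilon> / 2 * norm (x i) powr p + norm (l i) powr q / \<eta> powr q" for i
      proof -
        have "norm (x i * l i) = (\<eta> * norm (x i)) * (norm (l i) / \<eta>)"
          using \<eta>(1) by (simp add: norm_mult)
        also have "\<dots> \<le> (\<eta> * norm (x i)) powr p / p + (norm (l i) / \<eta>) powr q / q"
          using \<eta>(1) by (intro Youngs_inequality p q) auto
        also have "\<dots> \<le> (\<eta> * norm (x i)) powr p / 1 + (norm (l i) / \<eta>) powr q / 1"
          using p q by (intro add_mono divide_left_mono) auto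
        also have "\<dots> = \<epsilon> / 2 * norm (x i) powr p + norm (l i) powr q / \<eta> powr q"
          using \<eta> by (simp add: powr_mult powr_divide)
        finally show ?thesis .
      qed
      have "L (coord_proj m x) - L (coord_proj n x) = (\<Sum>i<m. x i * l i) - (\<Sum>i<n. x i * l i)"
        unfolding l_def lp_dual_coord_proj[OF L] ..
      also have "\<dots> = (\<Sum>i=n..<m. x i * l i)"
        using sum_diff_nat_ivl[of 0 n m "\<lambda>i. x i * l i"] that by (simp add: atLeast0LessThan)
      finally have "norm (L (coord_proj m x) - L (coord_proj n x)) \<le> (\<Sum>i=n..<m. norm (x i * l i))"
        by (simp only: norm_sum)
      also have "\<dots> \<le> (\<Sum>i=n..<m. \<epsilon> / 2 * norm (x i) powr p + norm (l i) powr q / \<eta> powr q)"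
        by (intro sum_mono y)
      also have "\<dots> = \<epsilon> / 2 * (\<Sum>i=n..<m. norm (x i) powr p) + (\<Sum>i=n..<m. norm (l i) powr q) / \<eta> powr q"
        by (simp only: sum.distrib sum_distrib_left sum_divide_distrib)
      also have "\<dots> \<le> \<epsilon> / 2 * 1 + (\<epsilon> / 2 * \<eta> powr q) / \<eta> powr q"
      proof (intro add_mono mult_left_mono divide_right_mono)
        show "(\<Sum>i=n..<m. norm (x i) powr p) \<le> 1"
          using sum_le_lp_pow[OF p xl, of "{n..<m}"] x1 by simp
        show "(\<Sum>i=n..<m. norm (l i) powr q) \<le> \<epsilon> / 2 * \<eta> powr q"
          using n[of n m] by simp
      qed (use \<open>\<epsilon> > 0\<close> in auto)
      also have "\<dots> = \<epsilon>" using \<eta>(1) by simp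
      finally show ?thesis .
    qed
    then show "\<forall>\<^sub>F m in sequentially. norm (L (coord_proj m x) - L (coord_proj n x)) \<le> \<epsilon>"
      unfolding eventually_sequentially by blast
  qed simp
  then show ?thesis by blast
qed

end

subsection \<open>Peak functions\<close>

text \<open>The Bregman divergence of \<open>norm _ powr p\<close> on the plane, that is, its excess
  over the real tangent at \<open>c\<close>. At \<open>c = 0\<close> the convention
  \<open>0 powr _ = 0\<close> gives the correct zero derivative even for
  \<open>p < 2\<close>.\<close>

definition powr_gap :: "real \<Rightarrow> complex \<Rightarrow> complex \<Rightarrow> real" where
  "powr_gap p c x = norm x powr p - norm c powr p - p * norm c powr (p - 2) * Re (cnj c * (x - c))"

text \<open>The mass available beyond \<open>k\<close> to a sequence of the unit ball that begins
  like \<open>z\<close>; it decreases to \<open>s powr p\<close>.\<close>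

definition tail_mass :: "real \<Rightarrow> (nat \<Rightarrow> complex) \<Rightarrow> nat \<Rightarrow> real" where
  "tail_mass p z k = 1 - (\<Sum>i<k. norm (z i) powr p)"

text \<open>Its real part is the differential at \<open>z\<close> of the mass of the first
  \<open>k\<close> coordinates. The complex-linear form is what makes the exponential
  holomorphic.\<close>

definition tangent_functional :: "real \<Rightarrow> (nat \<Rightarrow> complex) \<Rightarrow> nat \<Rightarrow> (nat \<Rightarrow> complex) \<Rightarrow> complex" where
  "tangent_functional p z k x = (\<Sum>i<k. complex_of_real (p * norm (z i) powr (p - 2)) * cnj (z i) * x i)"

text \<open>With \<open>\<sigma> = tail_mass p z k\<close>, a point of the ball whose head has
  first-order change \<open>D\<close> and total gap \<open>G\<close> has tail mass at most
  \<open>\<sigma> - D - G \<le> \<sigma> * exp (- ((D + G) / \<sigma>))\<close>. Raising this to the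
  power \<open>N / p\<close> dictates both constants: the exponential cancels \<open>D\<close>, the
  last factor cancels \<open>\<sigma>\<close>.\<close>

definition peak_fun :: "real \<Rightarrow> nat \<Rightarrow> (nat \<Rightarrow> complex) \<Rightarrow> nat \<Rightarrow> (nat \<Rightarrow> complex) \<Rightarrow> (nat \<Rightarrow> complex) \<Rightarrow> complex" where
  "peak_fun p N z k a x =
     exp (complex_of_real (real N / (p * tail_mass p z k)) * (tangent_functional p z k x - tangent_functional p z k z))
     * diag_poly N (\<lambda>i. if k \<le> i then a i else 0) x
     * complex_of_real (tail_mass p z k powr - (real N / p))"

definition sphere_seq :: "(nat \<Rightarrow> complex) \<Rightarrow> real \<Rightarrow> nat \<Rightarrow> nat \<Rightarrow> complex" where
  "sphere_seq z s m = (\<lambda>i. coord_proj m z i + complex_of_real s * canonical_vec m i)"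

lemma powr_strict_tangent:
  fixes t r p :: real
  assumes p: "1 < p" and "0 \<le> t" "0 < r" "t \<noteq> r"
  shows "r powr p + p * r powr (p - 1) * (t - r) < t powr p"
proof -
  have cont: "continuous_on {u..v} (\<lambda>x. x powr p)" if "0 \<le> u" for u v :: real
    using that p by (intro continuous_on_powr' continuous_intros) auto
  have der: "((\<lambda>x. x powr p) has_real_derivative p * x powr (p - 1)) (at x)" if "0 < x" for x :: real
    using has_real_derivative_powr[OF that, of p] .
  have diff: "(\<lambda>x. x powr p) differentiable (at x)" if "0 < x" for x :: real
    unfolding real_differentiable_def using der[OF that] by blast
  show ?thesis
  proof (cases "t < r")
    case True
    obtain l c where c: "t < c" "c < r" "((\<lambda>x. x powr p) has_real_derivative l) (at c)" "r powr p - t powr p = (r - t) * l"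
    proof -
      have "\<exists>l c. t < c \<and> c < r \<and> ((\<lambda>x. x powr p) has_real_derivative l) (at c) \<and> r powr p - t powr p = (r - t) * l"
        by (rule MVT[OF True cont]) (use assms diff in auto)
      then show ?thesis using that by blast
    qed
    have "c > 0" using c assms by linarith
    have l: "l = p * c powr (p - 1)" by (rule DERIV_unique[OF c(3) der[OF \<open>c > 0\<close>]])
    have "c powr (p - 1) < r powr (p - 1)" using c \<open>c > 0\<close> p by (intro powr_less_mono2) auto
    then have "(r - t) * l < (r - t) * (p * r powr (p - 1))"
      unfolding l using True p by (intro mult_strict_left_mono) auto
    then show ?thesis using c(4) by (simp add: algebra_simps)
  next
    case False
    then have rt: "r < t" using assms by simp
    obtain l c where c: "r < c" "c < t" "((\<lambda>x. x powr p) has_real_derivative l) (at c)" "t powr p - r powr p = (t - r) * l"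
    proof -
      have "\<exists>l c. r < c \<and> c < t \<and> ((\<lambda>x. x powr p) has_real_derivative l) (at c) \<and> t powr p - r powr p = (t - r) * l"
        by (rule MVT[OF rt cont]) (use assms diff in auto)
      then show ?thesis using that by blast
    qed
    have "c > 0" using c assms by linarith
    have l: "l = p * c powr (p - 1)" by (rule DERIV_unique[OF c(3) der[OF \<open>c > 0\<close>]])
    have "r powr (p - 1) < c powr (p - 1)" using c assms by (intro powr_less_mono2) auto
    then have "(t - r) * (p * r powr (p - 1)) < (t - r) * l"
      unfolding l using rt p by (intro mult_strict_left_mono) auto
    then show ?thesis using c(4) by (simp add: algebra_simps)
  qed
qed

section \<open>Strict convexity of the mass and the bound on peak functions\<close>

context
  fixes p :: real
  assumes p: "1 < p"
begin

text \<open>Strictness has two sources: if the moduli differ, \<open>t powr p\<close> is strictly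
  convex; if they agree, the real part of \<open>cnj c * x\<close> is strictly below the product of
  the moduli because \<open>x \<noteq> c\<close>.\<close>

lemma powr_gap_pos:
  assumes "x \<noteq> c" shows "0 < powr_gap p c x"
proof (cases "c = 0")
  case True
  then show ?thesis using assms p by (simp add: powr_gap_def)
next
  case False
  define r where "r = norm c"
  have r: "r > 0" using False by (simp add: r_def)
  have cc: "Re (cnj c * c) = r * r"
    by (simp add: r_def cmod_power2 flip: power2_eq_square)
  have pw: "r powr (p - 2) * r = r powr (p - 1)"
    using r powr_add[of r "p - 2" 1] by (simp add: algebra_simps)
  have le: "Re (cnj c * x) \<le> r * norm x"
    using complex_Re_le_cmod[of "cnj c * x"] by (simp add: norm_mult r_def)
  have eq: "powr_gap p c x = norm x powr p - r powr p - p * r powr (p - 2) * (Re (cnj c * x) - r * r)"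
    unfolding powr_gap_def r_def[symmetric] right_diff_distrib minus_complex.sel(1) cc ..
  have "p * r powr (p - 2) * (Re (cnj c * x) - r * r) \<le> p * r powr (p - 2) * (r * norm x - r * r)"
    using p le by (intro mult_left_mono) auto
  also have "\<dots> = p * (r powr (p - 2) * r) * (norm x - r)"
    by (simp add: algebra_simps)
  finally have le2: "p * r powr (p - 2) * (Re (cnj c * x) - r * r) \<le> p * r powr (p - 1) * (norm x - r)"
    unfolding pw .
  show ?thesis
  proof (cases "norm x = r")
    case False
    then show ?thesis
      using powr_strict_tangent[OF p norm_ge_zero r False] le2 unfolding eq by linarith
  next
    case True
    have "(norm (x - c))\<^sup>2 = (norm x)\<^sup>2 + r\<^sup>2 - 2 * Re (cnj c * x)"
      unfolding r_def cmod_power2 by (simp add: power2_eq_square algebra_simps)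
    moreover have "(norm (x - c))\<^sup>2 > 0" using assms by simp
    ultimately have "Re (cnj c * x) - r * r < 0" using True by (simp add: power2_eq_square)
    then have "p * r powr (p - 2) * (Re (cnj c * x) - r * r) < 0"
      using p r by (intro mult_pos_neg) auto
    then show ?thesis unfolding eq True by simp
  qed
qed

lemma powr_gap_nonneg: "0 \<le> powr_gap p c x"
proof (cases "x = c")
  case True
  then show ?thesis by (simp add: powr_gap_def)
qed (use powr_gap_pos[of x c] in simp)

lemma continuous_on_powr_gap: "continuous_on S (powr_gap p c)"
  unfolding powr_gap_def[abs_def] using p
  by (intro continuous_intros continuous_on_powr') auto

lemma tangent_functional_dual: "tangent_functional p z k \<in> lp_dual p"
  using lp_dual_finite_sum[OF p, where k = k and c = "\<lambda>i. complex_of_real (p * norm (z i) powr (p - 2)) * cnj (z i)"]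
  by (simp add: tangent_functional_def[abs_def])

text \<open>Because the gap is an exact remainder, the tangent expansion of the head mass is an
  identity and leaves no error term to estimate.\<close>

lemma sum_powr_tangent:
  "(\<Sum>i<k. norm (x i) powr p) = (\<Sum>i<k. norm (z i) powr p)
    + Re (tangent_functional p z k x - tangent_functional p z k z) + (\<Sum>i<k. powr_gap p (z i) (x i))"
proof -
  have "tangent_functional p z k x - tangent_functional p z k z
    = (\<Sum>i<k. complex_of_real (p * norm (z i) powr (p - 2)) * (cnj (z i) * (x i - z i)))"
    unfolding tangent_functional_def sum_subtractf[symmetric] by (intro sum.cong refl) (simp add: algebra_simps)
  then have "Re (tangent_functional p z k x - tangent_functional p z k z)
    = (\<Sum>i<k. p * norm (z i) powr (p - 2) * Re (cnj (z i) * (x i - z i)))"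
    by (simp only: Re_sum Re_complex_of_real times_complex.sel Im_complex_of_real mult_zero_left diff_zero)
  then show ?thesis
    by (simp only: powr_gap_def sum_subtractf)
qed

lemma tail_mass_bounds:
  assumes z: "z \<in> lp_ball p"
  shows "1 - lp_pow p z \<le> tail_mass p z k" "0 < 1 - lp_pow p z" "tail_mass p z k \<le> 1" "0 < tail_mass p z k"
proof -
  have zz: "z \<in> lp p" "lp_pow p z < 1" using z mem_lp_ball[OF p] by auto
  show 1: "1 - lp_pow p z \<le> tail_mass p z k"
    unfolding tail_mass_def using sum_le_lp_pow[OF p zz(1), of "{..<k}"] by simp
  show 2: "0 < 1 - lp_pow p z" using zz by simp
  show "tail_mass p z k \<le> 1" unfolding tail_mass_def by (simp add: sum_nonneg)
  show "0 < tail_mass p z k" using 1 2 by linarith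
qed

context
  fixes n N :: nat and z :: "nat \<Rightarrow> complex"
  assumes n: "p \<le> real n" and N: "N = n + 2" and z: "z \<in> lp_ball p"
begin

text \<open>The contractive inclusion of \<open>p\<close>-summable into \<open>N\<close>-summable
  sequences, applied beyond \<open>k\<close>: if the masses \<open>v i\<close> have sum
  \<open>V\<close>, then \<open>v i powr (N / p) \<le> V powr (N / p - 1) * v i\<close>, since
  \<open>N \<ge> p\<close>.\<close>

lemma norm_diag_poly_tail_le:
  assumes x: "x \<in> lp p" "lp_norm p x \<le> 1" and a: "\<And>i. norm (a i) \<le> 1"
  shows "norm (diag_poly N (\<lambda>i. if k \<le> i then a i else 0) x) \<le> (lp_pow p x - (\<Sum>i<k. norm (x i) powr p)) powr (real N / p)"
proof -
  define v where "v i = (if k \<le> i then norm (x i) powr p else 0)" for i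
  define V where "V = (\<Sum>i. v i)"
  have sx: "summable (\<lambda>i. norm (x i) powr p)" by (rule lp_summable[OF p x(1)])
  have sv: "summable v"
    by (rule summable_comparison_test'[OF sx, of 0]) (simp add: v_def)
  have V: "V = lp_pow p x - (\<Sum>i<k. norm (x i) powr p)"
  proof -
    have "V = (\<Sum>i. v (i + k)) + (\<Sum>i<k. v i)"
      unfolding V_def by (rule suminf_split_initial_segment[OF sv])
    moreover have "(\<Sum>i. v (i + k)) = lp_pow p x - (\<Sum>i<k. norm (x i) powr p)"
      unfolding lp_pow_def suminf_minus_initial_segment[OF sx, of k, symmetric] by (simp add: v_def)
    moreover have "(\<Sum>i<k. v i) = 0" by (simp add: v_def)
    ultimately show ?thesis by simp
  qed
  have N1: "N > 0" "real N / p - 1 \<ge> 0" using n p by (simp_all add: N field_simps)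
  have v0: "0 \<le> v i" for i by (simp add: v_def)
  have vV: "v i \<le> V" for i
    using sum_le_suminf[OF sv, of "{i}"] v0 by (simp add: V_def)
  have b: "norm ((if k \<le> i then a i else 0) * x i ^ N) \<le> V powr (real N / p - 1) * v i" for i
  proof (cases "k \<le> i \<and> x i \<noteq> 0")
    case True
    then have pos: "norm (x i) > 0" and vi: "v i = norm (x i) powr p" by (auto simp: v_def)
    have "norm ((if k \<le> i then a i else 0) * x i ^ N) \<le> 1 * norm (x i) ^ N"
      unfolding norm_mult norm_power using a[of i] by (intro mult_right_mono) auto
    also have "\<dots> = norm (x i) powr real N" using pos by (simp add: powr_realpow)
    also have "\<dots> = v i powr (real N / p)" using p by (simp add: vi powr_powr)
    also have "\<dots> = v i powr (real N / p - 1) * v i powr 1"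
      unfolding powr_add[symmetric] by simp
    also have "\<dots> = v i powr (real N / p - 1) * v i" using v0[of i] by simp
    also have "\<dots> \<le> V powr (real N / p - 1) * v i"
      by (intro mult_right_mono powr_mono2 N1 v0 vV)
    finally show ?thesis .
  next
    case False
    then have "(if k \<le> i then a i else 0) * x i ^ N = 0" using N1 by auto
    then show ?thesis using v0[of i] by (simp only: norm_zero mult_nonneg_nonneg powr_ge_zero)
  qed
  have "norm (diag_poly N (\<lambda>i. if k \<le> i then a i else 0) x) \<le> (\<Sum>i. V powr (real N / p - 1) * v i)"
    unfolding diag_poly_def by (intro norm_suminf_le b summable_mult sv)
  also have "\<dots> = V powr (real N / p - 1) * V"
    unfolding V_def by (rule suminf_mult[OF sv])
  also have "\<dots> = V powr (real N / p - 1) * V powr 1"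
    using vV[of 0] v0[of 0] by simp
  also have "\<dots> = V powr (real N / p)"
    unfolding powr_add[symmetric] by simp
  finally show ?thesis unfolding V .
qed

text \<open>The estimate is \<open>1 - u \<le> exp (- u)\<close> applied to the mass that \<open>x\<close> can have beyond \<open>k\<close>.\<close>

lemma norm_peak_fun_le:
  assumes x: "x \<in> lp_ball p" and a: "\<And>i. norm (a i) \<le> 1"
  shows "norm (peak_fun p N z k a x) \<le> exp (- (real N / p) * (\<Sum>i<k. powr_gap p (z i) (x i)))"
proof -
  define \<sigma> where "\<sigma> = tail_mass p z k"
  define M where "M = real N / p"
  define D where "D = Re (tangent_functional p z k x - tangent_functional p z k z)"
  define G where "G = (\<Sum>i<k. powr_gap p (z i) (x i))"
  define V where "V = lp_pow p x - (\<Sum>i<k. norm (x i) powr p)"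
  have \<sigma>: "0 < \<sigma>" "\<sigma> \<le> 1" unfolding \<sigma>_def using tail_mass_bounds[OF z] by auto
  have M: "M > 0" using p N by (simp add: M_def)
  have G: "G \<ge> 0" unfolding G_def by (intro sum_nonneg powr_gap_nonneg)
  have xx: "x \<in> lp p" "lp_pow p x < 1" "lp_norm p x \<le> 1"
    using x mem_lp_ball[OF p, of x] by (auto simp: lp_ball_def)
  have V0: "V \<ge> 0" unfolding V_def using sum_le_lp_pow[OF p xx(1), of "{..<k}"] by simp
  \<comment> \<open>The total mass is below 1, and \<open>sum_powr_tangent\<close> writes the mass
    of the head as \<open>1 - \<sigma> + D + G\<close>.\<close>
  have "V \<le> \<sigma> - D - G"
    unfolding V_def sum_powr_tangent[of x k z] using xx(2) by (simp add: \<sigma>_def tail_mass_def D_def G_def)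
  also have "\<dots> = \<sigma> * (1 + - ((D + G) / \<sigma>))"
    using \<sigma> by (simp add: field_simps)
  also have "\<dots> \<le> \<sigma> * exp (- ((D + G) / \<sigma>))"
    using \<sigma> by (intro mult_left_mono exp_ge_add_one_self) auto
  finally have "V powr M \<le> (\<sigma> * exp (- ((D + G) / \<sigma>))) powr M"
    using V0 M by (intro powr_mono2) auto
  also have "\<dots> = \<sigma> powr M * exp (M * - ((D + G) / \<sigma>))"
    using \<sigma> by (simp add: powr_mult exp_powr_real mult_ac)
  finally have VM: "V powr M \<le> \<sigma> powr M * exp (M * - ((D + G) / \<sigma>))" .
  have "norm (peak_fun p N z k a x) = exp (M / \<sigma> * D) * norm (diag_poly N (\<lambda>i. if k \<le> i then a i else 0) x) * \<sigma> powr - M"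
    unfolding peak_fun_def \<sigma>_def[symmetric] M_def[symmetric] norm_mult norm_exp_eq_Re norm_of_real
    by (simp add: D_def M_def)
  also have "\<dots> \<le> exp (M / \<sigma> * D) * V powr M * \<sigma> powr - M"
    using norm_diag_poly_tail_le[OF xx(1,3) a, of k] by (intro mult_right_mono mult_left_mono) (auto simp: V_def M_def)
  also have "\<dots> \<le> exp (M / \<sigma> * D) * (\<sigma> powr M * exp (M * - ((D + G) / \<sigma>))) * \<sigma> powr - M"
    by (intro mult_right_mono mult_left_mono VM) auto
  also have "\<dots> = (\<sigma> powr M * \<sigma> powr - M) * (exp (M / \<sigma> * D) * exp (M * - ((D + G) / \<sigma>)))"
    by (simp only: mult_ac)
  also have "\<dots> = exp (M / \<sigma> * D + M * - ((D + G) / \<sigma>))"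
    unfolding exp_add[symmetric] powr_add[symmetric] using \<sigma> by simp
  also have "M / \<sigma> * D + M * - ((D + G) / \<sigma>) = - (M * (G / \<sigma>))"
    using \<sigma> by (simp add: field_simps)
  \<comment> \<open>As \<open>\<sigma> \<le> 1\<close>, dropping it only weakens the bound, and the
    remaining rate \<open>M\<close> is the same for all \<open>k\<close>.\<close>
  also have "exp (- (M * (G / \<sigma>))) \<le> exp (- M * G)"
    using \<sigma> M G by (simp add: le_divide_eq mult_left_le)
  finally show ?thesis unfolding M_def G_def .
qed

context
  fixes a :: "nat \<Rightarrow> complex"
  assumes a: "\<And>i. norm (a i) \<le> 1"
begin

lemma norm_tail_coefficients: "norm (if k \<le> i then a i else 0) \<le> 1"
  using a by simp

lemma Au_peak_fun: "(\<lambda>x\<in>lp_ball p. peak_fun p N z k a x) \<in> Au p"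
proof -
  let ?T = "tangent_functional p z k" and ?c = "complex_of_real (real N / (p * tail_mass p z k))"
  let ?d = "complex_of_real (tail_mass p z k powr - (real N / p))"
  have T: "restrict ?T (lp_ball p) \<in> Au p" by (rule Au_linear[OF p tangent_functional_dual])
  have E: "(\<lambda>x\<in>lp_ball p. exp (?c * (restrict ?T (lp_ball p) x - ?T z))) \<in> Au p"
    by (rule Au_compose_bounded[OF p T, where S = UNIV and T = "cball 0 (Au_norm p (restrict ?T (lp_ball p)))"])
       (auto intro!: holomorphic_intros simp del: restrict_apply norm_conv_dist[symmetric] simp: norm_le_Au_norm[OF p T])
  note Q = Au_diag_poly[where a = "\<lambda>i. if k \<le> i then a i else 0", OF p n N norm_tail_coefficients]
  have "(\<lambda>x\<in>lp_ball p. ?d * (\<lambda>x\<in>lp_ball p. (\<lambda>x\<in>lp_ball p. exp (?c * (restrict ?T (lp_ball p) x - ?T z))) x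
      * (\<lambda>x\<in>lp_ball p. diag_poly N (\<lambda>i. if k \<le> i then a i else 0) x) x) x) = (\<lambda>x\<in>lp_ball p. peak_fun p N z k a x)"
    by (rule restrict_ext) (simp add: peak_fun_def)
  then show ?thesis
    using Au_cmult[OF p Au_mult[OF p E Q], of ?d] by (simp only:)
qed

lemma Au_norm_peak_fun_le_1: "Au_norm p (\<lambda>x\<in>lp_ball p. peak_fun p N z k a x) \<le> 1"
proof (rule Au_norm_le[OF p])
  fix x assume x: "x \<in> lp_ball p"
  have "exp (- (real N / p) * (\<Sum>i<k. powr_gap p (z i) (x i))) \<le> 1"
    using p by (simp add: sum_nonneg powr_gap_nonneg)
  from order_trans[OF norm_peak_fun_le[where a = a and k = k, OF x a] this]
  show "norm ((\<lambda>x\<in>lp_ball p. peak_fun p N z k a x) x) \<le> 1" using x by simp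
qed

text \<open>An evaluation is a limit from inside the ball. Along a ray the tangent functional is
  linear and the polynomial homogeneous, so the formula is continuous in \<open>t\<close> and stays
  valid on the boundary.\<close>

lemma evaluation_peak_fun:
  assumes x: "x \<in> lp p" "lp_norm p x \<le> 1"
  shows "evaluation p x (\<lambda>x\<in>lp_ball p. peak_fun p N z k a x) = peak_fun p N z k a x"
proof (rule evaluation_restrict[OF p Au_peak_fun x])
  let ?T = "tangent_functional p z k" and ?c = "complex_of_real (real N / (p * tail_mass p z k))"
  let ?d = "complex_of_real (tail_mass p z k powr - (real N / p))" and ?Q = "diag_poly N (\<lambda>i. if k \<le> i then a i else 0) x"
  have e: "peak_fun p N z k a (\<lambda>i. complex_of_real t * x i)
      = exp (?c * (of_real t * ?T x - ?T z)) * (of_real t ^ N * ?Q) * ?d" for t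
    unfolding peak_fun_def lp_dual_scale[OF p tangent_functional_dual x(1)]
      diag_poly_scale[where a = "\<lambda>i. if k \<le> i then a i else 0", OF p n N norm_tail_coefficients x] ..
  have e1: "peak_fun p N z k a x = exp (?c * (of_real 1 * ?T x - ?T z)) * (of_real 1 ^ N * ?Q) * ?d"
    by (simp add: peak_fun_def)
  show "((\<lambda>t. peak_fun p N z k a (\<lambda>i. complex_of_real t * x i)) \<longlongrightarrow> peak_fun p N z k a x) (at_left 1)"
    unfolding e e1 by (intro tendsto_intros)
qed

end
end
end

subsection \<open>Limits of evaluations along filters\<close>

text \<open>A cluster point together with a filter that realises it. The filter is retained because
  the indices along which \<open>\<phi>\<close> is approached decide the limit of the peak functions
  with given coefficients.\<close>

definition limit_character ::
    "real \<Rightarrow> (nat \<Rightarrow> complex) \<Rightarrow> real \<Rightarrow> (((nat \<Rightarrow> complex) \<Rightarrow> complex) \<Rightarrow> complex) \<Rightarrow> nat filter \<Rightarrow> bool" where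
  "limit_character p z s \<phi> F \<longleftrightarrow> \<phi> \<in> Au_spectrum p \<and> F \<noteq> bot \<and> F \<le> sequentially \<and>
     (\<forall>f\<in>Au p. ((\<lambda>m. evaluation p (sphere_seq z s m) f) \<longlongrightarrow> \<phi> f) F)"

context
  fixes p s :: real and z :: "nat \<Rightarrow> complex"
  assumes p: "1 < p" and z: "z \<in> lp_ball p" and s: "s = (1 - lp_norm p z powr p) powr (1 / p)"
begin

lemma sphere_radius: "0 < s" "s powr p = 1 - lp_pow p z"
proof -
  have "0 < 1 - lp_pow p z" by (rule tail_mass_bounds(2)[OF p z])
  moreover have "s = (1 - lp_pow p z) powr (1 / p)"
    unfolding s by (simp add: lp_norm_powr[OF p lp_ball_lp[OF p z]])
  ultimately show "0 < s" "s powr p = 1 - lp_pow p z" using p by (simp_all add: powr_powr)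
qed

lemma sphere_seq_apply:
  "sphere_seq z s m i = (if i < m then z i else if i = m then of_real s else 0)"
  by (simp add: sphere_seq_def coord_proj_def canonical_vec_def)

lemma sphere_seq_lp: "sphere_seq z s m \<in> lp p" "lp_norm p (sphere_seq z s m) \<le> 1"
proof -
  have 0: "\<And>i. i \<notin> {..<Suc m} \<Longrightarrow> sphere_seq z s m i = 0" by (auto simp: sphere_seq_apply)
  show l: "sphere_seq z s m \<in> lp p"
    by (rule finite_support_lp(1)[where I = "{..<Suc m}", OF p 0 finite_lessThan])
  have "lp_pow p (sphere_seq z s m) = (\<Sum>i<Suc m. norm (sphere_seq z s m i) powr p)"
    by (rule finite_support_lp(2)[where I = "{..<Suc m}", OF p 0 finite_lessThan])
  also have "\<dots> = (\<Sum>i<m. norm (z i) powr p) + s powr p"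
    using sphere_radius(1) by (simp add: sphere_seq_apply)
  also have "\<dots> \<le> 1"
    using sum_le_lp_pow[OF p lp_ball_lp[OF p z], of "{..<m}"] sphere_radius(2) by simp
  finally show "lp_norm p (sphere_seq z s m) \<le> 1"
    using lp_norm_le_iff[OF p l, of 1] by simp
qed

context
  fixes n N :: nat
  assumes n: "p \<le> real n" and N: "N = n + 2"
begin

text \<open>For \<open>m \<ge> k\<close> the head is that of \<open>z\<close>, so the exponential is
  1; the polynomial sees the piece of \<open>z\<close> between \<open>k\<close> and \<open>m\<close>
  and the bump of height \<open>s\<close> at index \<open>m\<close>.\<close>

lemma peak_fun_sphere_seq:
  assumes "k \<le> m"
  shows "peak_fun p N z k a (sphere_seq z s m)
    = ((\<Sum>i=k..<m. a i * z i ^ N) + a m * of_real s ^ N) * of_real (tail_mass p z k powr - (real N / p))"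
proof -
  let ?a = "\<lambda>i. if k \<le> i then a i else 0"
  have T: "tangent_functional p z k (sphere_seq z s m) = tangent_functional p z k z"
    unfolding tangent_functional_def using assms by (intro sum.cong) (auto simp: sphere_seq_apply)
  have "diag_poly N ?a (sphere_seq z s m) = (\<Sum>i<Suc m. ?a i * sphere_seq z s m i ^ N)"
    unfolding diag_poly_def by (rule suminf_finite) (auto simp: sphere_seq_apply N)
  also have "\<dots> = (\<Sum>i<m. ?a i * z i ^ N) + a m * of_real s ^ N"
    using assms by (simp add: sphere_seq_apply)
  also have "(\<Sum>i<m. ?a i * z i ^ N) = (\<Sum>i=k..<m. a i * z i ^ N)"
    by (rule sum.mono_neutral_cong_right) auto
  finally show ?thesis
    unfolding peak_fun_def T by simp
qed

text \<open>Two successive limits. For fixed \<open>k\<close>, the limit along \<open>F\<close>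
  consists of the tail \<open>W - S k\<close> and the bump \<open>\<alpha> * s ^ N\<close>, up to
  the normalising factor. As \<open>k\<close> grows the tail vanishes, and
  \<open>tail_mass p z k\<close> tends to \<open>s powr p\<close>, so the factor cancels
  \<open>s ^ N\<close>.\<close>

lemma limit_character_peak_fun:
  assumes \<phi>: "limit_character p z s \<phi> F" and a: "\<And>i. norm (a i) \<le> 1" and \<alpha>: "\<forall>\<^sub>F m in F. a m = \<alpha>"
  shows "(\<lambda>k. \<phi> (\<lambda>x\<in>lp_ball p. peak_fun p N z k a x)) \<longlonglongrightarrow> \<alpha>"
proof -
  define S where "S m = (\<Sum>i<m. a i * z i ^ N)" for m
  define W where "W = (\<Sum>i. a i * z i ^ N)"
  have F: "F \<noteq> bot" "F \<le> sequentially" using \<phi> by (auto simp: limit_character_def)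
  have zz: "z \<in> lp p" "lp_norm p z \<le> 1" using z by (auto simp: lp_ball_def)
  have SW: "S \<longlonglongrightarrow> W"
    unfolding S_def[abs_def] W_def by (intro summable_LIMSEQ diag_poly_summable[OF p n N a zz])
  have \<phi>k: "\<phi> (\<lambda>x\<in>lp_ball p. peak_fun p N z k a x)
      = ((W - S k) + \<alpha> * of_real s ^ N) * of_real (tail_mass p z k powr - (real N / p))" for k
  proof (rule tendsto_unique[OF F(1)])
    let ?f = "\<lambda>x\<in>lp_ball p. peak_fun p N z k a x"
    show "((\<lambda>m. evaluation p (sphere_seq z s m) ?f) \<longlongrightarrow> \<phi> ?f) F"
      using \<phi> Au_peak_fun[OF p n N z a, of k] by (simp only: limit_character_def)
    have "\<forall>\<^sub>F m in F. k \<le> m"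
      using F(2) eventually_ge_at_top[of k] by (simp add: le_filter_def)
    then have "\<forall>\<^sub>F m in F. ((S m - S k) + \<alpha> * of_real s ^ N) * of_real (tail_mass p z k powr - (real N / p))
        = evaluation p (sphere_seq z s m) ?f"
      using \<alpha>
    proof eventually_elim
      case (elim m)
      have "S m - S k = (\<Sum>i=k..<m. a i * z i ^ N)"
        unfolding S_def lessThan_atLeast0 using elim(1) by (intro sum_diff_nat_ivl) auto
      then show ?case
        using elim(2) peak_fun_sphere_seq[OF elim(1), of a]
          evaluation_peak_fun[where a = a, OF p n N z a sphere_seq_lp, of m k] by simp
    qed
    then show "((\<lambda>m. evaluation p (sphere_seq z s m) ?f) \<longlongrightarrow>
        ((W - S k) + \<alpha> * of_real s ^ N) * of_real (tail_mass p z k powr - (real N / p))) F"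
      by (rule Lim_transform_eventually[rotated]) (intro tendsto_intros tendsto_mono[OF F(2) SW])
  qed
  have mass: "(\<lambda>k. tail_mass p z k) \<longlonglongrightarrow> 1 - lp_pow p z"
    unfolding tail_mass_def lp_pow_def
    by (intro tendsto_diff tendsto_const summable_LIMSEQ lp_summable[OF p zz(1)])
  have "(\<lambda>k. ((W - S k) + \<alpha> * of_real s ^ N) * of_real (tail_mass p z k powr - (real N / p)))
      \<longlonglongrightarrow> ((W - W) + \<alpha> * of_real s ^ N) * of_real ((1 - lp_pow p z) powr - (real N / p))"
    using tail_mass_bounds(2)[OF p z] by (intro tendsto_intros SW mass) auto
  moreover have "complex_of_real s ^ N * of_real ((1 - lp_pow p z) powr - (real N / p)) = 1"
  proof -
    have "s ^ N * (1 - lp_pow p z) powr - (real N / p) = s powr real N * s powr - real N"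
      unfolding sphere_radius(2)[symmetric] using sphere_radius(1) p by (simp add: powr_powr powr_realpow)
    also have "\<dots> = 1"
      unfolding powr_add[symmetric] using sphere_radius(1) by simp
    finally show ?thesis by (simp flip: of_real_power of_real_mult)
  qed
  ultimately show ?thesis
    unfolding \<phi>k by (simp add: mult.assoc)
qed

text \<open>Multiplication by \<open>P k ^ j\<close> localises \<open>X - z i\<close>: where the
  coordinate is near \<open>z i\<close> the difference is small, elsewhere the power is. Under
  \<open>\<psi>\<close> the power costs nothing in the limit, because \<open>\<psi> (P k)\<close>
  tends to 1.\<close>

lemma gleason_part_coordinate:
  assumes \<phi>: "limit_character p z s \<phi> F" and \<psi>: "\<psi> \<in> gleason_part p \<phi>"
  shows "\<psi> (\<lambda>x\<in>lp_ball p. x i) = z i"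
proof -
  have \<phi>S: "\<phi> \<in> Au_spectrum p" using \<phi> by (simp add: limit_character_def)
  have \<psi>S: "\<psi> \<in> Au_spectrum p" using \<psi> by (simp add: gleason_part_def)
  define P where "P k = (\<lambda>x\<in>lp_ball p. peak_fun p N z k (\<lambda>_. 1) x)" for k
  have P: "P k \<in> Au p" "Au_norm p (P k) \<le> 1" for k
    unfolding P_def by (intro Au_peak_fun[OF p n N z] Au_norm_peak_fun_le_1[OF p n N z]; simp)+
  have "(\<lambda>k. \<phi> (P k)) \<longlonglongrightarrow> 1"
    unfolding P_def by (rule limit_character_peak_fun[OF \<phi>]) auto
  then have \<psi>P: "(\<lambda>k. \<psi> (P k)) \<longlonglongrightarrow> 1"
    by (rule gleason_part_tendsto_1[OF p \<phi>S \<psi> P])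
  define X where "X = (\<lambda>x\<in>lp_ball p. x i)"
  have X: "X \<in> Au p"
    unfolding X_def by (rule Au_linear[OF p lp_dual_coord[OF p]])
  define w where "w = \<psi> X"
  have zi: "norm (z i) \<le> 1"
    using norm_le_lp_norm[OF p lp_ball_lp[OF p z], of i] z by (simp add: lp_ball_def)
  have "norm (w - z i) \<le> 0 + \<epsilon>" if \<epsilon>: "\<epsilon> > 0" for \<epsilon>
  proof -
    define C where "C = {u. norm u \<le> 1 \<and> \<epsilon> \<le> norm (u - z i)}"
    have "compact C"
    proof -
      have "C = cball 0 1 - ball (z i) \<epsilon>"
        by (auto simp: C_def dist_norm norm_minus_commute)
      then show ?thesis by (simp add: compact_diff)
    qed
    \<comment> \<open>By compactness, all coordinate values that are at least
      \<open>\<epsilon>\<close> away from \<open>z i\<close> have a common positive gap.\<close>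
    obtain \<gamma> where \<gamma>: "\<gamma> > 0" "\<And>u. u \<in> C \<Longrightarrow> \<gamma> \<le> powr_gap p (z i) u"
    proof (cases "C = {}")
      case False
      from continuous_attains_inf[OF \<open>compact C\<close> False continuous_on_powr_gap[OF p]]
      obtain c where c: "c \<in> C" "\<And>u. u \<in> C \<Longrightarrow> powr_gap p (z i) c \<le> powr_gap p (z i) u" by blast
      have "c \<noteq> z i" using c(1) \<epsilon> by (auto simp: C_def)
      then show ?thesis using that[of "powr_gap p (z i) c"] c(2) powr_gap_pos[OF p] by blast
    next
      case True
      then show ?thesis using that[of 1] by simp
    qed
    define b where "b = exp (- (real N / p) * \<gamma>)"
    have b: "0 \<le> b" "b < 1" using p \<gamma>(1) by (simp_all add: b_def N)
    \<comment> \<open>The exponent is fixed before \<open>k\<close>, which is possible because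
      \<open>b\<close> does not depend on \<open>k\<close>. The factor \<open>1 / 2\<close> answers
      \<open>norm (x i - z i) \<le> 2\<close>.\<close>
    obtain j where j: "b ^ j < \<epsilon> / 2"
      using real_arch_pow_inv[of "\<epsilon> / 2" b] \<epsilon> b(2) by auto
    \<comment> \<open>The condition \<open>i < k\<close> puts coordinate \<open>i\<close> into the
      head, so that its gap occurs in the exponential bound.\<close>
    have bound: "norm (\<psi> (P k)) ^ j * norm (w - z i) \<le> \<epsilon>" if k: "i < k" for k
    proof -
      define H where "H = (\<lambda>x\<in>lp_ball p. (\<lambda>x\<in>lp_ball p. P k x ^ j) x * (\<lambda>x\<in>lp_ball p. - z i + 1 * X x) x)"
      have H1: "(\<lambda>x\<in>lp_ball p. P k x ^ j) \<in> Au p" by (rule Au_power[OF p P(1)])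
      have H2: "(\<lambda>x\<in>lp_ball p. - z i + 1 * X x) \<in> Au p" by (rule Au_affine[OF p X])
      have H: "H \<in> Au p" unfolding H_def by (rule Au_mult[OF p H1 H2])
      have "\<psi> H = \<psi> (P k) ^ j * (- z i + 1 * w)"
        unfolding H_def spectrum_mult[OF p \<psi>S H1 H2] spectrum_power[OF p \<psi>S P(1)] spectrum_affine[OF p \<psi>S X] w_def ..
      then have "norm (\<psi> (P k)) ^ j * norm (w - z i) = norm (\<psi> H)"
        by (simp add: norm_mult norm_power)
      also have "\<dots> \<le> Au_norm p H" by (rule spectrum_bound[OF p \<psi>S H])
      also have "\<dots> \<le> \<epsilon>"
      proof (rule Au_norm_le[OF p])
        fix x assume x: "x \<in> lp_ball p"
        have xi: "norm (x i) \<le> 1"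
          using norm_le_lp_norm[OF p lp_ball_lp[OF p x], of i] x by (simp add: lp_ball_def)
        have eq: "norm (H x) = norm (P k x) ^ j * norm (x i - z i)"
          using x by (simp add: H_def X_def norm_mult norm_power)
        show "norm (H x) \<le> \<epsilon>"
        proof (cases "norm (x i - z i) < \<epsilon>")
          case True
          have "norm (P k x) ^ j \<le> 1"
            using norm_le_Au_norm[OF p P(1) x, of k] P(2)[of k] by (intro power_le_one) auto
          then have "norm (P k x) ^ j * norm (x i - z i) \<le> 1 * norm (x i - z i)"
            by (intro mult_right_mono) auto
          then show ?thesis unfolding eq using True by linarith
        next
          case False
          then have "x i \<in> C" using xi by (simp add: C_def)
          then have "\<gamma> \<le> (\<Sum>i<k. powr_gap p (z i) (x i))"
            using member_le_sum[of i "{..<k}" "\<lambda>i. powr_gap p (z i) (x i)"] powr_gap_nonneg[OF p] \<gamma>(2) k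
            by (metis (no_types, lifting) finite_lessThan lessThan_iff order_trans)
          then have "- (real N / p) * (\<Sum>i<k. powr_gap p (z i) (x i)) \<le> - (real N / p) * \<gamma>"
            using p by (intro mult_left_mono_neg) auto
          then have "norm (P k x) \<le> b"
            using norm_peak_fun_le[where a = "\<lambda>_. 1" and k = k, OF p n N z x] x
            unfolding b_def P_def by (simp add: order_trans)
          then have "norm (P k x) ^ j * norm (x i - z i) \<le> b ^ j * 2"
            using norm_triangle_ineq4[of "x i" "z i"] xi zi b(1) by (intro mult_mono power_mono) auto
          then show ?thesis unfolding eq using j by linarith
        qed
      qed
      finally show ?thesis .
    qed
    have "norm (1::complex) ^ j * norm (w - z i) \<le> \<epsilon>"
    proof (rule tendsto_upperbound)
      show "(\<lambda>k. norm (\<psi> (P k)) ^ j * norm (w - z i)) \<longlonglongrightarrow> norm (1::complex) ^ j * norm (w - z i)"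
        by (intro tendsto_intros \<psi>P)
      show "\<forall>\<^sub>F k in sequentially. norm (\<psi> (P k)) ^ j * norm (w - z i) \<le> \<epsilon>"
        using eventually_gt_at_top[of i] by eventually_elim (rule bound)
    qed simp
    then show ?thesis by simp
  qed
  then have "norm (w - z i) \<le> 0" by (rule field_le_epsilon)
  then show ?thesis by (simp add: w_def X_def)
qed

text \<open>Linearity takes the coordinate values to all functions
  \<open>L (coord_proj m _)\<close>, and contractivity of \<open>\<psi>\<close> passes to their
  uniform limit, given by \<open>lp_dual_uniform_tail\<close>.\<close>

lemma gleason_part_subset_fiber:
  assumes \<phi>: "limit_character p z s \<phi> F"
  shows "gleason_part p \<phi> \<subseteq> Au_fiber p z"
proof
  fix \<psi> assume \<psi>: "\<psi> \<in> gleason_part p \<phi>"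
  then have \<psi>S: "\<psi> \<in> Au_spectrum p" by (simp add: gleason_part_def)
  have "\<psi> (restrict L (lp_ball p)) = L z" if L: "L \<in> lp_dual p" for L
  proof -
    have fin: "(\<lambda>x\<in>lp_ball p. L (coord_proj m x)) \<in> Au p
        \<and> \<psi> (\<lambda>x\<in>lp_ball p. L (coord_proj m x)) = L (coord_proj m z)" for m
    proof (induction m)
      case 0
      show ?case
        unfolding lp_dual_coord_proj[OF p L] lessThan_0 sum.empty
        by (rule conjI[OF Au_const[OF p] spectrum_const[OF p \<psi>S]])
    next
      case (Suc m)
      let ?f = "\<lambda>x\<in>lp_ball p. L (coord_proj m x)" and ?g = "\<lambda>x\<in>lp_ball p. L (canonical_vec m) * (\<lambda>x\<in>lp_ball p. x m) x"
      have X: "(\<lambda>x\<in>lp_ball p. x m) \<in> Au p" by (rule Au_linear[OF p lp_dual_coord[OF p]])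
      have g: "?g \<in> Au p" by (rule Au_cmult[OF p X])
      have eq: "(\<lambda>x\<in>lp_ball p. ?f x + ?g x) = (\<lambda>x\<in>lp_ball p. L (coord_proj (Suc m) x))"
        unfolding lp_dual_coord_proj[OF p L] by (rule restrict_ext) simp
      have "\<psi> (\<lambda>x\<in>lp_ball p. ?f x + ?g x) = L (coord_proj m z) + L (canonical_vec m) * z m"
        using spectrum_add[OF p \<psi>S conjunct1[OF Suc] g] spectrum_cmult[OF p \<psi>S X, of "L (canonical_vec m)"]
          gleason_part_coordinate[OF \<phi> \<psi>, of m] Suc by (simp only:)
      also have "\<dots> = L (coord_proj (Suc m) z)" unfolding lp_dual_coord_proj[OF p L] by simp
      finally show ?case
        using Au_add[OF p conjunct1[OF Suc] g] unfolding eq by blast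
    qed
    have Lf: "restrict L (lp_ball p) \<in> Au p" by (rule Au_linear[OF p L])
    have "norm (\<psi> (restrict L (lp_ball p)) - L z) \<le> 0 + \<epsilon>" if "\<epsilon> > 0" for \<epsilon>
    proof -
      obtain m where m: "\<And>x. x \<in> lp_ball p \<Longrightarrow> norm (L x - L (coord_proj m x)) \<le> \<epsilon> / 2"
        using lp_dual_uniform_tail[OF p L, of "\<epsilon> / 2"] \<open>\<epsilon> > 0\<close> by auto
      let ?f = "\<lambda>x\<in>lp_ball p. L (coord_proj m x)"
      let ?g = "\<lambda>x\<in>lp_ball p. (-1) * ?f x"
      have g: "?g \<in> Au p" by (rule Au_cmult[OF p conjunct1[OF fin]])
      let ?h = "\<lambda>x\<in>lp_ball p. restrict L (lp_ball p) x + ?g x"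
      have "\<psi> ?h = \<psi> (restrict L (lp_ball p)) + (-1) * L (coord_proj m z)"
        using spectrum_add[OF p \<psi>S Lf g] spectrum_cmult[OF p \<psi>S conjunct1[OF fin], of "-1" m] fin[of m] by (simp only:)
      moreover have "norm (\<psi> ?h) \<le> \<epsilon> / 2"
        using spectrum_bound[OF p \<psi>S Au_add[OF p Lf g]] Au_norm_le[OF p, of ?h "\<epsilon> / 2"] m by simp
      ultimately have "norm (\<psi> (restrict L (lp_ball p)) - L (coord_proj m z)) \<le> \<epsilon> / 2" by simp
      then show ?thesis
        using m[OF z] norm_triangle_ineq4[of "\<psi> (restrict L (lp_ball p)) - L (coord_proj m z)" "L z - L (coord_proj m z)"]
        by simp
    qed
    then have "norm (\<psi> (restrict L (lp_ball p)) - L z) \<le> 0" by (rule field_le_epsilon)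
    then show ?thesis by simp
  qed
  then show "\<psi> \<in> Au_fiber p z" using \<psi>S by (simp add: Au_fiber_def)
qed

lemma mem_gleason_part_self: "\<phi> \<in> Au_spectrum p \<Longrightarrow> \<phi> \<in> gleason_part p \<phi>"
  by (simp add: gleason_part_def functional_dist_self[OF p])

text \<open>With the indicator of \<open>A\<close> as coefficients, the peak functions tell which
  index set a character is approached along. Equal parts would force the limit 1 on
  \<open>\<psi>\<close>, whose own limit is 0.\<close>

lemma limit_characters_separated:
  assumes \<phi>: "limit_character p z s \<phi> F" and \<psi>: "limit_character p z s \<psi> G"
    and A: "\<forall>\<^sub>F m in F. m \<in> A" "\<forall>\<^sub>F m in G. m \<notin> A"
  shows "gleason_part p \<phi> \<noteq> gleason_part p \<psi>"
proof
  assume eq: "gleason_part p \<phi> = gleason_part p \<psi>"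
  define a :: "nat \<Rightarrow> complex" where "a m = (if m \<in> A then 1 else 0)" for m
  have a: "norm (a i) \<le> 1" for i by (simp add: a_def)
  have S: "\<phi> \<in> Au_spectrum p" "\<psi> \<in> Au_spectrum p" using \<phi> \<psi> by (auto simp: limit_character_def)
  have a1: "\<forall>\<^sub>F m in F. a m = 1"
    using A(1) by eventually_elim (simp add: a_def)
  have a0: "\<forall>\<^sub>F m in G. a m = 0"
    using A(2) by eventually_elim (simp add: a_def)
  note l = limit_character_peak_fun[where a = a, OF \<phi> a a1] limit_character_peak_fun[where a = a, OF \<psi> a a0]
  have "\<psi> \<in> gleason_part p \<phi>" using mem_gleason_part_self[OF S(2)] eq by simp
  then have "(\<lambda>k. \<psi> (\<lambda>x\<in>lp_ball p. peak_fun p N z k a x)) \<longlonglongrightarrow> 1"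
  proof (rule gleason_part_tendsto_1[where f = "\<lambda>k. \<lambda>x\<in>lp_ball p. peak_fun p N z k a x", OF p S(1) _ _ _ l(1)])
    show "(\<lambda>x\<in>lp_ball p. peak_fun p N z k a x) \<in> Au p" for k
      by (rule Au_peak_fun[where a = a, OF p n N z a])
    show "Au_norm p (\<lambda>x\<in>lp_ball p. peak_fun p N z k a x) \<le> 1" for k
      by (rule Au_norm_peak_fun_le_1[where a = a, OF p n N z a])
  qed
  from LIMSEQ_unique[OF this l(2)] show False by simp
qed

text \<open>If the characters differ at \<open>f\<close>, the indices whose evaluation of
  \<open>f\<close> lies within half the difference of \<open>\<phi> f\<close> eventually contain one
  filter and eventually avoid the other. So separation by any function becomes separation by a set
  of indices.\<close>

lemma distinct_limit_characters:
  assumes \<phi>: "limit_character p z s \<phi> F" and \<psi>: "limit_character p z s \<psi> G" and "\<phi> \<noteq> \<psi>"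
  shows "gleason_part p \<phi> \<noteq> gleason_part p \<psi>"
proof -
  have "\<phi> \<in> extensional (Au p)" "\<psi> \<in> extensional (Au p)"
    using \<phi> \<psi> spectrum_extensional[OF p] by (auto simp: limit_character_def)
  then obtain f where f: "f \<in> Au p" "\<phi> f \<noteq> \<psi> f"
    using \<open>\<phi> \<noteq> \<psi>\<close> extensionalityI by blast
  define e where "e = dist (\<phi> f) (\<psi> f) / 2"
  have e: "e > 0" using f(2) by (simp add: e_def)
  define A where "A = {m. dist (evaluation p (sphere_seq z s m) f) (\<phi> f) < e}"
  show ?thesis
  proof (rule limit_characters_separated[OF \<phi> \<psi>])
    have "((\<lambda>m. evaluation p (sphere_seq z s m) f) \<longlongrightarrow> \<phi> f) F"
      using \<phi> f(1) by (simp add: limit_character_def)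
    from tendstoD[OF this e] show "\<forall>\<^sub>F m in F. m \<in> A" by (simp add: A_def)
    have "((\<lambda>m. evaluation p (sphere_seq z s m) f) \<longlongrightarrow> \<psi> f) G"
      using \<psi> f(1) by (simp add: limit_character_def)
    from tendstoD[OF this e] show "\<forall>\<^sub>F m in G. m \<notin> A"
    proof eventually_elim
      case (elim m)
      then show ?case
        using dist_triangle3[of "\<phi> f" "\<psi> f" "evaluation p (sphere_seq z s m) f"] unfolding A_def e_def by simp
    qed
  qed
qed

end
end

subsection \<open>Cardinality\<close>

text \<open>The lower Dedekind cuts of the real and the imaginary part: a complex number becomes a
  subset of the countable type \<open>bool \<times> rat\<close>.\<close>

definition rat_part :: "bool \<Rightarrow> rat \<Rightarrow> complex \<Rightarrow> bool" where
  "rat_part b q c \<longleftrightarrow> of_rat q < (if b then Re c else Im c)"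

lemma rat_part_ext:
  assumes "\<And>b q. rat_part b q c \<Longrightarrow> rat_part b q d" "\<And>b q. rat_part b q d \<Longrightarrow> rat_part b q c"
  shows "c = d"
proof -
  have le: "x \<le> y" if "\<And>q. of_rat q < x \<Longrightarrow> of_rat q < y" for x y :: real
  proof (rule ccontr)
    assume "\<not> x \<le> y"
    then obtain q where "y < of_rat q" "of_rat q < x" using of_rat_dense[of y x] by auto
    with that[of q] show False by simp
  qed
  have "Re c = Re d"
    using assms[of True] by (intro antisym le) (simp_all add: rat_part_def)
  moreover have "Im c = Im d"
    using assms[of False] by (intro antisym le) (simp_all add: rat_part_def)
  ultimately show ?thesis by (rule complex_eqI)
qed

text \<open>The finitely supported sequences of Gaussian rationals, with a countable index
  type.\<close>

definition rat_vec :: "(rat \<times> rat) list \<Rightarrow> nat \<Rightarrow> complex" where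
  "rat_vec l = (\<lambda>i. if i < length l then Complex (of_rat (fst (l ! i))) (of_rat (snd (l ! i))) else 0)"

text \<open>A function in \<open>Au p\<close> is determined by its cuts on a countable dense set, so
  a set of naturals can name it. At lists outside the ball all these functions share the value
  \<open>undefined\<close>.\<close>

definition fun_code :: "((nat \<Rightarrow> complex) \<Rightarrow> complex) \<Rightarrow> nat set" where
  "fun_code f = to_nat ` {(l, b, q). rat_part b q (f (rat_vec l))}"

text \<open>Codes a triple by one set of naturals: \<open>S\<close> occupies the left summand, and
  the right summand holds the single point \<open>(b, q)\<close>. A character will be coded by the
  set of graph points of its cuts.\<close>

definition graph_point :: "nat set \<Rightarrow> bool \<Rightarrow> rat \<Rightarrow> nat set" where
  "graph_point S b q = to_nat ` (Inl ` S \<union> {Inr (b, q)} :: (nat + bool \<times> rat) set)"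

lemma graph_point_inject: "graph_point S b q = graph_point S' b' q' \<longleftrightarrow> S = S' \<and> b = b' \<and> q = q'"
proof
  assume "graph_point S b q = graph_point S' b' q'"
  then have e: "(Inl ` S \<union> {Inr (b, q)} :: (nat + bool \<times> rat) set) = Inl ` S' \<union> {Inr (b', q')}"
    unfolding graph_point_def by (rule inj_image_eq_iff[OF inj_to_nat, THEN iffD1])
  have "Inr (b, q) \<in> (Inl ` S' \<union> {Inr (b', q')} :: (nat + bool \<times> rat) set)"
    unfolding e[symmetric] by simp
  then have 1: "b = b' \<and> q = q'" by auto
  have "x \<in> S \<longleftrightarrow> x \<in> S'" for x
  proof -
    have "x \<in> S \<longleftrightarrow> Inl x \<in> (Inl ` S \<union> {Inr (b, q)} :: (nat + bool \<times> rat) set)" by auto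
    also have "\<dots> \<longleftrightarrow> x \<in> S'" unfolding e by auto
    finally show ?thesis .
  qed
  with 1 show "S = S' \<and> b = b' \<and> q = q'" by auto
qed simp

text \<open>Rounding towards zero: absolute values must not grow, so that the approximating sequence
  stays in the open ball.\<close>

lemma rat_approx_real:
  fixes r d :: real
  assumes "0 < d"
  obtains q :: rat where "\<bar>of_rat q\<bar> \<le> \<bar>r\<bar>" "\<bar>of_rat q - r\<bar> \<le> d"
proof (cases r "0 :: real" rule: linorder_cases)
  case less
  then obtain q where "r < of_rat q" "of_rat q < min 0 (r + d)"
    using of_rat_dense[of r "min 0 (r + d)"] assms by auto
  then show ?thesis using less by (intro that[of q]) (auto simp: of_rat_minus)
next
  case equal
  then show ?thesis using assms by (intro that[of 0]) auto
next
  case greater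
  then obtain q where "max 0 (r - d) < of_rat q" "of_rat q < r"
    using of_rat_dense[of "max 0 (r - d)" r] assms by auto
  then show ?thesis using greater by (intro that[of q]) auto
qed

lemma rat_approx_complex:
  fixes c :: complex and d :: real
  assumes "0 < d"
  shows "\<exists>w. norm (Complex (of_rat (fst w)) (of_rat (snd w))) \<le> norm c
    \<and> norm (c - Complex (of_rat (fst w)) (of_rat (snd w))) \<le> d"
proof -
  have d: "d / 2 > 0" using assms by simp
  obtain a :: rat where a: "\<bar>of_rat a\<bar> \<le> \<bar>Re c\<bar>" "\<bar>of_rat a - Re c\<bar> \<le> d / 2" by (rule rat_approx_real[OF d])
  obtain b :: rat where b: "\<bar>of_rat b\<bar> \<le> \<bar>Im c\<bar>" "\<bar>of_rat b - Im c\<bar> \<le> d / 2" by (rule rat_approx_real[OF d])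
  have "norm (Complex (of_rat a) (of_rat b)) \<le> norm c"
    unfolding cmod_def using a(1) b(1) by (intro real_sqrt_le_mono add_mono) (simp_all only: complex.sel abs_le_square_iff[symmetric])
  moreover have "norm (c - Complex (of_rat a) (of_rat b)) \<le> d"
    using cmod_le[of "c - Complex (of_rat a) (of_rat b)"] a(2) b(2) by (simp add: abs_minus_commute)
  ultimately show ?thesis by (intro exI[of _ "(a, b)"]) simp
qed

context
  fixes p :: real
  assumes p: "1 < p"
begin

lemma rat_vec_dense:
  assumes x: "x \<in> lp_ball p" and d: "0 < d"
  obtains l where "rat_vec l \<in> lp_ball p" "lp_dist p x (rat_vec l) < d"
proof -
  have xl: "x \<in> lp p" "lp_pow p x < 1" using x mem_lp_ball[OF p] by auto
  have d4: "d / 4 > 0" using d by simp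
  obtain m where m: "lp_dist p x (coord_proj m x) < d / 4"
    using LIMSEQ_D[OF coord_proj_tendsto[OF p xl(1)] d4] by auto
  \<comment> \<open>Chosen such that \<open>m\<close> errors of size \<open>\<delta>\<close> have
    total mass below \<open>(d / 4) powr p\<close>; the summand 1 makes this strict and covers
    \<open>m = 0\<close>.\<close>
  define \<delta> where "\<delta> = ((d / 4) powr p / (real m + 1)) powr (1 / p)"
  have \<delta>: "\<delta> > 0" "\<delta> powr p = (d / 4) powr p / (real m + 1)"
    using d p by (simp_all add: \<delta>_def powr_powr)
  obtain w where w: "\<And>i. norm (Complex (of_rat (fst (w i))) (of_rat (snd (w i)))) \<le> norm (x i)"
      "\<And>i. norm (x i - Complex (of_rat (fst (w i))) (of_rat (snd (w i)))) \<le> \<delta>"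
  proof -
    have "\<exists>w. \<forall>i. norm (Complex (of_rat (fst (w i))) (of_rat (snd (w i)))) \<le> norm (x i)
      \<and> norm (x i - Complex (of_rat (fst (w i))) (of_rat (snd (w i)))) \<le> \<delta>"
      by (intro choice allI rat_approx_complex \<delta>(1))
    then show ?thesis using that by blast
  qed
  define l where "l = map w [0..<m]"
  have v: "rat_vec l i = (if i < m then Complex (of_rat (fst (w i))) (of_rat (snd (w i))) else 0)" for i
    by (simp add: rat_vec_def l_def)
  have v0: "\<And>i. i \<notin> {..<m} \<Longrightarrow> rat_vec l i = 0" by (simp add: v)
  have vl: "rat_vec l \<in> lp p" by (rule finite_support_lp(1)[where I = "{..<m}", OF p v0 finite_lessThan])
  have "lp_pow p (rat_vec l) = (\<Sum>i<m. norm (rat_vec l i) powr p)"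
    by (rule finite_support_lp(2)[where I = "{..<m}", OF p v0 finite_lessThan])
  also have "\<dots> \<le> (\<Sum>i<m. norm (x i) powr p)"
    using p w(1) by (intro sum_mono powr_mono2) (auto simp: v)
  also have "\<dots> \<le> lp_pow p x" by (rule sum_le_lp_pow[OF p xl(1) finite_lessThan])
  finally have vb: "rat_vec l \<in> lp_ball p" using vl xl(2) mem_lp_ball[OF p] by auto
  define c where "c = (\<lambda>i. rat_vec l i - coord_proj m x i)"
  have c0: "\<And>i. i \<notin> {..<m} \<Longrightarrow> c i = 0" by (simp add: c_def v coord_proj_def)
  have cl: "c \<in> lp p" by (rule finite_support_lp(1)[where I = "{..<m}", OF p c0 finite_lessThan])
  have "lp_pow p c = (\<Sum>i<m. norm (c i) powr p)"
    by (rule finite_support_lp(2)[where I = "{..<m}", OF p c0 finite_lessThan])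
  also have "\<dots> \<le> (\<Sum>i<m. \<delta> powr p)"
    using p w(2) by (intro sum_mono powr_mono2) (auto simp: c_def v coord_proj_def norm_minus_commute)
  also have "\<dots> = (d / 4) powr p * (real m / (real m + 1))" by (simp add: \<delta>(2))
  also have "\<dots> < (d / 4) powr p * 1"
    using d by (intro mult_strict_left_mono) auto
  finally have "lp_dist p (rat_vec l) (coord_proj m x) < d / 4"
    using lp_norm_less_iff[OF p cl, of "d / 4"] d by (simp add: lp_dist_def c_def)
  moreover have "coord_proj m x \<in> lp p"
    by (rule finite_support_lp(1)[OF p, of "{..<m}"]) (auto simp: coord_proj_def)
  ultimately have "lp_dist p x (rat_vec l) < d"
    using lp_dist_triangle[OF p xl(1) vl, of "coord_proj m x"] m by (simp add: max_def split: if_splits)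
  with vb show ?thesis by (rule that)
qed

lemma inj_on_fun_code: "inj_on fun_code (Au p)"
proof (rule inj_onI)
  fix f g assume f: "f \<in> Au p" and g: "g \<in> Au p" and eq: "fun_code f = fun_code g"
  from eq have "{(l, b, q). rat_part b q (f (rat_vec l))} = {(l, b, q). rat_part b q (g (rat_vec l))}"
    unfolding fun_code_def by (rule inj_image_eq_iff[OF inj_to_nat, THEN iffD1])
  then have "rat_part b q (f (rat_vec l)) \<longleftrightarrow> rat_part b q (g (rat_vec l))" for l b q
    by (auto simp: set_eq_iff)
  then have fg: "f (rat_vec l) = g (rat_vec l)" for l
    by (intro rat_part_ext) auto
  show "f = g"
  proof (rule extensionalityI[OF Au_extensional[OF p f] Au_extensional[OF p g]])
    fix x assume x: "x \<in> lp_ball p"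
    have "norm (f x - g x) \<le> 0 + e" if "e > 0" for e
    proof -
      have e2: "e / 2 > 0" using that by simp
      obtain d1 where d1: "0 < d1" "\<And>x y. x \<in> lp_ball p \<Longrightarrow> y \<in> lp_ball p \<Longrightarrow> lp_dist p x y < d1 \<Longrightarrow> norm (f x - f y) < e/2"
        using Au_ucont[OF p f e2] by blast
      obtain d2 where d2: "0 < d2" "\<And>x y. x \<in> lp_ball p \<Longrightarrow> y \<in> lp_ball p \<Longrightarrow> lp_dist p x y < d2 \<Longrightarrow> norm (g x - g y) < e/2"
        using Au_ucont[OF p g e2] by blast
      have "0 < min d1 d2" using d1 d2 by simp
      then obtain l where l: "rat_vec l \<in> lp_ball p" "lp_dist p x (rat_vec l) < min d1 d2"
        by (rule rat_vec_dense[OF x])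
      have "norm (f x - f (rat_vec l)) < e/2" "norm (g x - g (rat_vec l)) < e/2"
        using d1(2)[OF x l(1)] d2(2)[OF x l(1)] l(2) by auto
      then show ?thesis
        using norm_triangle_ineq4[of "f x - f (rat_vec l)" "g x - g (rat_vec l)"] by (simp add: fg)
    qed
    then have "norm (f x - g x) \<le> 0" by (rule field_le_epsilon)
    then show "f x = g x" by simp
  qed
qed

text \<open>A character is recovered from the cuts of its values at the elements of
  \<open>Au p\<close>, and these elements are named by sets of naturals. So it is coded by a set of
  sets of naturals, and there are as many of those as sets of reals.\<close>

lemma spectrum_lepoll: "Au_spectrum p \<lesssim> (UNIV :: real set set)"
proof -
  define C where "C \<phi> = {S. \<exists>f b q. S = graph_point (fun_code f) b q \<and> f \<in> Au p \<and> rat_part b q (\<phi> f)}" for \<phi> :: "((nat \<Rightarrow> complex) \<Rightarrow> complex) \<Rightarrow> complex"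
  have CI: "rat_part b q (\<phi> f) \<Longrightarrow> f \<in> Au p \<Longrightarrow> graph_point (fun_code f) b q \<in> C \<phi>" for b q \<phi> f
    unfolding C_def by blast
  have CD: "rat_part b q (\<phi> f)" if mem: "graph_point (fun_code f) b q \<in> C \<phi>" and f: "f \<in> Au p" for b q \<phi> f
  proof -
    obtain f' b' q' where *: "graph_point (fun_code f) b q = graph_point (fun_code f') b' q'" "f' \<in> Au p" "rat_part b' q' (\<phi> f')"
      using mem unfolding C_def by blast
    then have "f' = f" using inj_onD[OF inj_on_fun_code _ *(2) f] by (simp add: graph_point_inject)
    then show ?thesis using * by (simp add: graph_point_inject)
  qed
  have "inj_on C (Au_spectrum p)"
  proof (rule inj_onI)
    fix \<phi> \<psi> assume \<phi>: "\<phi> \<in> Au_spectrum p" and \<psi>: "\<psi> \<in> Au_spectrum p" and eq: "C \<phi> = C \<psi>"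
    show "\<phi> = \<psi>"
    proof (rule extensionalityI[OF spectrum_extensional[OF p \<phi>] spectrum_extensional[OF p \<psi>]])
      fix f assume f: "f \<in> Au p"
      show "\<phi> f = \<psi> f"
      proof (rule rat_part_ext)
        show "rat_part b q (\<psi> f)" if "rat_part b q (\<phi> f)" for b q
          using CI[of b q \<phi> f, OF that f] unfolding eq by (rule CD[OF _ f])
        show "rat_part b q (\<phi> f)" if "rat_part b q (\<psi> f)" for b q
          using CI[of b q \<psi> f, OF that f] unfolding eq[symmetric] by (rule CD[OF _ f])
      qed
    qed
  qed
  then have 1: "Au_spectrum p \<lesssim> (UNIV :: nat set set set)"
    unfolding lepoll_def by blast
  obtain g :: "nat set \<Rightarrow> real" where g: "inj g"
    using nat_sets_eqpoll_reals unfolding eqpoll_def bij_betw_def by blast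
  have "inj (image g)" using g by (simp add: inj_image_eq_iff inj_def)
  then have "(UNIV :: nat set set set) \<lesssim> (UNIV :: real set set)"
    unfolding lepoll_def by blast
  with 1 show ?thesis by (rule lepoll_trans)
qed

end

section \<open>An independent family of sets of naturals indexed by the reals\<close>

definition independent_set :: "real \<Rightarrow> nat set" where
  "independent_set t = {m. \<exists>(a, b)\<in>set (from_nat m :: (rat \<times> rat) list). of_rat a < t \<and> t < of_rat b}"

text \<open>Each basic condition prescribes membership in finitely many
  \<open>independent_set t\<close> according to \<open>A\<close>; the bound \<open>k\<close> makes
  the filter finer than \<open>sequentially\<close>.\<close>

definition independent_filter :: "real set \<Rightarrow> nat filter" where
  "independent_filter A = (INF (T, k)\<in>{T. finite T} \<times> UNIV.
     principal {m. k \<le> m \<and> (\<forall>t\<in>T. m \<in> independent_set t \<longleftrightarrow> t \<in> A)})"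

text \<open>Finitely many reals can be isolated from each other by rational intervals, and a list of
  the intervals around \<open>T \<inter> A\<close> codes a number with exactly the prescribed
  memberships. Rational endpoints keep the codes countable although the family is indexed by the
  reals.\<close>

lemma independent_sets:
  assumes T: "finite T"
  shows "\<exists>m\<ge>k. \<forall>t\<in>T. m \<in> independent_set t \<longleftrightarrow> t \<in> A"
proof -
  have "\<exists>w. of_rat (fst w) < t \<and> t < of_rat (snd w) \<and> (\<forall>u\<in>T - {t}. \<not> (of_rat (fst w) < u \<and> u < of_rat (snd w)))" for t :: real
  proof -
    have "open (- (T - {t}))" using T by (intro open_Compl finite_imp_closed) auto
    then obtain e where e: "e > 0" "ball t e \<subseteq> - (T - {t})" unfolding open_contains_ball by auto
    obtain a where a: "t - e < of_rat a" "of_rat a < t" using of_rat_dense[of "t - e" t] e(1) by auto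
    obtain b where b: "t < of_rat b" "of_rat b < t + e" using of_rat_dense[of t "t + e"] e(1) by auto
    have "\<not> (of_rat a < u \<and> u < of_rat b)" if "u \<in> T - {t}" for u
    proof
      assume "of_rat a < u \<and> u < of_rat b"
      then have "u \<in> ball t e" using a b by (auto simp: dist_real_def)
      then show False using e(2) that by blast
    qed
    then show ?thesis using a b by (intro exI[of _ "(a, b)"]) simp
  qed
  then have "\<exists>w. \<forall>t. of_rat (fst (w t)) < t \<and> t < of_rat (snd (w t))
      \<and> (\<forall>u\<in>T - {t}. \<not> (of_rat (fst (w t)) < u \<and> u < of_rat (snd (w t))))"
    by (intro choice allI)
  then obtain w where w: "\<And>t. of_rat (fst (w t)) < t" "\<And>t. t < of_rat (snd (w t))"
      "\<And>t u. u \<in> T - {t} \<Longrightarrow> \<not> (of_rat (fst (w t)) < u \<and> u < of_rat (snd (w t)))" by blast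
  obtain l0 where l0: "set l0 = w ` (T \<inter> A)" using T finite_list[of "w ` (T \<inter> A)"] by auto
  \<comment> \<open>Padding with the empty interval \<open>(0, 0)\<close> changes no membership and
    gives infinitely many codes, hence one that is at least \<open>k\<close>.\<close>
  define g where "g j = to_nat (replicate j (0 :: rat, 0 :: rat) @ l0)" for j
  have "inj g"
    unfolding g_def by (rule injI) (simp add: append_eq_append_conv inj_eq[OF inj_to_nat] flip: length_replicate)
  then have "infinite (range g)" by (simp add: finite_image_iff)
  then obtain j where j: "k \<le> g j"
    unfolding infinite_nat_iff_unbounded_le by blast
  have "g j \<in> independent_set t \<longleftrightarrow> t \<in> A" if t: "t \<in> T" for t
  proof -
    have "g j \<in> independent_set t \<longleftrightarrow> (\<exists>v\<in>set (replicate j (0, 0) @ l0). of_rat (fst v) < t \<and> t < of_rat (snd v))"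
      unfolding independent_set_def g_def by (simp add: case_prod_beta)
    also have "\<dots> \<longleftrightarrow> (\<exists>v\<in>set l0. of_rat (fst v) < t \<and> t < of_rat (snd v))"
      by auto
    also have "\<dots> \<longleftrightarrow> (\<exists>u\<in>T \<inter> A. of_rat (fst (w u)) < t \<and> t < of_rat (snd (w u)))"
      unfolding l0 by blast
    also have "\<dots> \<longleftrightarrow> t \<in> A"
    proof
      assume "t \<in> A"
      with t w(1,2) show "\<exists>u\<in>T \<inter> A. of_rat (fst (w u)) < t \<and> t < of_rat (snd (w u))"
        by (intro bexI[of _ t]) auto
    next
      assume "\<exists>u\<in>T \<inter> A. of_rat (fst (w u)) < t \<and> t < of_rat (snd (w u))"
      then obtain u where u: "u \<in> T \<inter> A" "of_rat (fst (w u)) < t \<and> t < of_rat (snd (w u))" ..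
      then have "t \<notin> T - {u}" using w(3) by metis
      then show "t \<in> A" using t u(1) by auto
    qed
    finally show ?thesis .
  qed
  with j show ?thesis by blast
qed

lemma eventually_independent_filter:
  "eventually P (independent_filter A) \<longleftrightarrow>
    (\<exists>T k. finite T \<and> (\<forall>m\<ge>k. (\<forall>t\<in>T. m \<in> independent_set t \<longleftrightarrow> t \<in> A) \<longrightarrow> P m))"
  unfolding independent_filter_def
proof (subst eventually_INF_base, goal_cases)
  case (2 x y)
  then show ?case
    by (intro bexI[of _ "(fst x \<union> fst y, max (snd x) (snd y))"]) auto
qed (auto simp: eventually_principal)

lemma independent_filter:
  "independent_filter A \<noteq> bot" "independent_filter A \<le> sequentially"
  "\<forall>\<^sub>F m in independent_filter A. m \<in> independent_set t \<longleftrightarrow> t \<in> A"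
proof -
  show "independent_filter A \<noteq> bot"
    unfolding trivial_limit_def eventually_independent_filter using independent_sets by blast
  show "independent_filter A \<le> sequentially"
    unfolding le_filter_def eventually_independent_filter eventually_sequentially
    by (auto intro!: exI[of _ "{}"])
  show "\<forall>\<^sub>F m in independent_filter A. m \<in> independent_set t \<longleftrightarrow> t \<in> A"
    unfolding eventually_independent_filter by (intro exI[of _ "{t}"] exI[of _ 0]) simp
qed

section \<open>Compactness of the spectrum and cluster points\<close>

context
  fixes p :: real
  assumes p: "1 < p"
begin

text \<open>The algebraic identities pass to pointwise limits, and the limit is not zero because
  every character takes the value 1 at the constant 1.\<close>

lemma spectrum_limit:
  assumes F: "F \<noteq> bot" and u: "\<And>m. u m \<in> Au_spectrum p" and ext: "\<phi> \<in> extensional (Au p)"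
    and lim: "\<And>f. f \<in> Au p \<Longrightarrow> ((\<lambda>m. u m f) \<longlongrightarrow> \<phi> f) F"
  shows "\<phi> \<in> Au_spectrum p"
  unfolding Au_spectrum_def mem_Collect_eq
proof (intro conjI ballI allI bexI ext)
  fix f g assume f: "f \<in> Au p" and g: "g \<in> Au p"
  show "\<phi> (\<lambda>x\<in>lp_ball p. f x + g x) = \<phi> f + \<phi> g"
    using lim[OF Au_add[OF p f g]] tendsto_add[OF lim[OF f] lim[OF g]]
    unfolding spectrum_add[OF p u f g] by (rule tendsto_unique[OF F])
  show "\<phi> (\<lambda>x\<in>lp_ball p. f x * g x) = \<phi> f * \<phi> g"
    using lim[OF Au_mult[OF p f g]] tendsto_mult[OF lim[OF f] lim[OF g]]
    unfolding spectrum_mult[OF p u f g] by (rule tendsto_unique[OF F])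
next
  fix c f assume f: "f \<in> Au p"
  show "\<phi> (\<lambda>x\<in>lp_ball p. c * f x) = c * \<phi> f"
    using lim[OF Au_cmult[OF p f]] tendsto_mult_left[OF lim[OF f], of c]
    unfolding spectrum_cmult[OF p u f] by (rule tendsto_unique[OF F])
next
  have "\<phi> (\<lambda>x\<in>lp_ball p. 1) = 1"
    using lim[OF Au_const[OF p, of 1]] tendsto_const[of 1 F]
    unfolding spectrum_one[OF p u] by (rule tendsto_unique[OF F])
  then show "\<phi> (\<lambda>x\<in>lp_ball p. 1) \<noteq> 0" by simp
  show "(\<lambda>x\<in>lp_ball p. 1) \<in> Au p" by (rule Au_const[OF p])
qed

text \<open>The Banach-Alaoglu argument: contractivity places all characters in a product of closed
  discs, which is compact by Tychonoff's theorem. The cluster point is presented as a limit along a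
  finer filter.\<close>

lemma spectrum_cluster:
  fixes F :: "'i filter"
  assumes F: "F \<noteq> bot" and u: "\<And>m. u m \<in> Au_spectrum p"
  obtains \<phi> G where "\<phi> \<in> Au_spectrum p" "G \<noteq> bot" "G \<le> F"
    "\<And>f. f \<in> Au p \<Longrightarrow> ((\<lambda>m. u m f) \<longlongrightarrow> \<phi> f) G"
proof -
  \<comment> \<open>Outside \<open>Au p\<close> the value \<open>undefined\<close> is replaced by 0,
    so that the product can run over the whole function type, with discs of radius 0 there.\<close>
  define v where "v m = (\<lambda>f. if f \<in> Au p then u m f else 0)" for m
  define K where "K = PiE UNIV (\<lambda>f. cball (0 :: complex) (if f \<in> Au p then Au_norm p f else 0))"
  have "compactin (product_topology (\<lambda>_. euclidean) UNIV) K"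
    unfolding K_def compactin_PiE by simp
  then have K: "compact K"
    unfolding euclidean_product_topology compactin_euclidean_iff .
  have "v m \<in> K" for m
    unfolding K_def v_def using spectrum_bound[OF p u] by (auto simp: PiE_UNIV_domain)
  then have "\<forall>\<^sub>F x in filtermap v F. x \<in> K" by (simp add: eventually_filtermap)
  moreover have "filtermap v F \<noteq> bot" using F by (simp add: filtermap_bot_iff)
  ultimately obtain x where x: "inf (nhds x) (filtermap v F) \<noteq> bot"
    using K unfolding compact_filter by blast
  define G where "G = inf F (filtercomap v (nhds x))"
  have G: "G \<noteq> bot"
  proof
    assume "G = bot"
    then have "eventually (\<lambda>_. False) G" by simp
    then obtain P Q where PQ: "eventually P F" "eventually Q (filtercomap v (nhds x))" "\<And>m. P m \<Longrightarrow> Q m \<Longrightarrow> False"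
      unfolding G_def eventually_inf by blast
    from PQ(2) obtain R where R: "eventually R (nhds x)" "\<And>m. R (v m) \<Longrightarrow> Q m"
      unfolding eventually_filtercomap by blast
    have "\<forall>\<^sub>F y in filtermap v F. \<not> R y"
      unfolding eventually_filtermap using PQ(1) by (rule eventually_mono) (use PQ(3) R(2) in blast)
    then have "eventually (\<lambda>_. False) (inf (nhds x) (filtermap v F))"
      unfolding eventually_inf using R(1) by blast
    with x show False by simp
  qed
  have "filterlim v (nhds x) (filtercomap v (nhds x))" by (rule filterlim_filtercomap)
  then have vx: "filterlim v (nhds x) G"
    by (rule filterlim_mono) (simp_all add: G_def)
  have lim: "((\<lambda>m. u m f) \<longlongrightarrow> x f) G" if f: "f \<in> Au p" for f
  proof -
    have cont: "continuous_on UNIV (\<lambda>y :: ((nat \<Rightarrow> complex) \<Rightarrow> complex) \<Rightarrow> complex. y f)"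
      by (rule continuous_on_product_coordinates)
    have "((\<lambda>m. v m f) \<longlongrightarrow> x f) G"
    proof (rule topological_tendstoI)
      fix S :: "complex set" assume "open S" "x f \<in> S"
      then have "open ((\<lambda>y :: ((nat \<Rightarrow> complex) \<Rightarrow> complex) \<Rightarrow> complex. y f) -` S)" "x \<in> (\<lambda>y. y f) -` S"
        using open_vimage[OF _ cont] by simp_all
      from topological_tendstoD[OF vx this] show "\<forall>\<^sub>F m in G. v m f \<in> S" by simp
    qed
    then show ?thesis using f by (simp add: v_def)
  qed
  show ?thesis
  proof (rule that[OF _ G])
    show "restrict x (Au p) \<in> Au_spectrum p"
      by (rule spectrum_limit[where u = u, OF G u]) (simp_all add: lim)
    show "G \<le> F" by (simp add: G_def)
    show "((\<lambda>m. u m f) \<longlongrightarrow> restrict x (Au p) f) G" if "f \<in> Au p" for f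
      using lim[OF that] that by simp
  qed
qed

lemma topspace_wstar [simp]: "topspace (wstar p) = Au_spectrum p"
  using spectrum_extensional[OF p] by (auto simp: wstar_def PiE_UNIV_domain PiE_def)

text \<open>The finer filter is \<open>F\<close> joined with the preimage of the neighbourhoods of
  \<open>\<phi>\<close>; it is proper exactly because each neighbourhood is visited frequently.
  Conversely, a pointwise limit is a limit in \<open>wstar p\<close>, and what holds eventually
  along a finer proper filter holds frequently along \<open>F\<close>.\<close>

lemma cluster_points_wstar_iff:
  assumes u: "\<And>m. u m \<in> Au_spectrum p"
  shows "\<phi> \<in> cluster_points (wstar p) u F \<longleftrightarrow> \<phi> \<in> Au_spectrum p \<and>
    (\<exists>G. G \<noteq> bot \<and> G \<le> F \<and> (\<forall>f\<in>Au p. ((\<lambda>m. u m f) \<longlongrightarrow> \<phi> f) G))" (is "?l \<longleftrightarrow> ?r")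
proof
  assume ?l
  then have \<phi>: "\<phi> \<in> Au_spectrum p" and fr: "\<And>U. openin (wstar p) U \<Longrightarrow> \<phi> \<in> U \<Longrightarrow> \<exists>\<^sub>F i in F. u i \<in> U"
    unfolding cluster_points_def by auto
  define G where "G = inf F (filtercomap u (nhdsin (wstar p) \<phi>))"
  have "G \<noteq> bot"
  proof
    assume "G = bot"
    then have "eventually (\<lambda>_. False) G" by simp
    then obtain P Q where PQ: "eventually P F" "eventually Q (filtercomap u (nhdsin (wstar p) \<phi>))" "\<And>m. P m \<Longrightarrow> Q m \<Longrightarrow> False"
      unfolding G_def eventually_inf by blast
    from PQ(2) obtain R where R: "eventually R (nhdsin (wstar p) \<phi>)" "\<And>m. R (u m) \<Longrightarrow> Q m"
      unfolding eventually_filtercomap by blast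
    from R(1) obtain U where U: "openin (wstar p) U" "\<phi> \<in> U" "\<And>y. y \<in> U \<Longrightarrow> R y"
      using \<phi> by (auto simp: eventually_nhdsin)
    from fr[OF U(1,2)] PQ(1) have "\<exists>\<^sub>F i in F. u i \<in> U \<and> P i" by (rule frequently_eventually_frequently)
    from frequently_ex[OF this] show False using U(3) R(2) PQ(3) by blast
  qed
  moreover have "((\<lambda>m. u m f) \<longlongrightarrow> \<phi> f) G" if f: "f \<in> Au p" for f
  proof (rule tendstoI)
    fix e :: real assume e: "e > 0"
    define U where "U = {\<psi> \<in> topspace (wstar p). \<psi> f \<in> ball (\<phi> f) e}"
    have "continuous_map (wstar p) euclidean (\<lambda>\<psi>. \<psi> f)"
      unfolding wstar_def using f by (intro continuous_map_from_subtopology continuous_map_product_projection)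
    then have "openin (wstar p) U"
      unfolding U_def by (rule openin_continuous_map_preimage) simp
    moreover have "\<phi> \<in> U" using \<phi> e by (simp add: U_def)
    ultimately have "eventually (\<lambda>\<psi>. \<psi> \<in> U) (nhdsin (wstar p) \<phi>)"
      unfolding eventually_nhdsin by blast
    then have "eventually (\<lambda>m. u m \<in> U) (filtercomap u (nhdsin (wstar p) \<phi>))"
      by (rule eventually_filtercomapI)
    then have "eventually (\<lambda>m. u m \<in> U) G"
      by (rule filter_leD[rotated]) (simp add: G_def)
    then show "\<forall>\<^sub>F m in G. dist (u m f) (\<phi> f) < e"
      by eventually_elim (simp add: U_def dist_commute)
  qed
  ultimately show ?r using \<phi> by (intro conjI exI[of _ G]) (auto simp: G_def)
next
  assume ?r
  then obtain G where \<phi>: "\<phi> \<in> Au_spectrum p" and G: "G \<noteq> bot" "G \<le> F"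
    and lim: "\<And>f. f \<in> Au p \<Longrightarrow> ((\<lambda>m. u m f) \<longlongrightarrow> \<phi> f) G" by blast
  have "limitin (wstar p) u \<phi> G"
    unfolding wstar_def limitin_subtopology limitin_componentwise
    using \<phi> u lim spectrum_extensional[OF p] by (auto simp: PiE_def intro!: always_eventually)
  then have ev: "\<forall>\<^sub>F m in G. u m \<in> U" if "openin (wstar p) U" "\<phi> \<in> U" for U
    using that unfolding limitin_def by blast
  have "\<exists>\<^sub>F m in F. u m \<in> U" if "openin (wstar p) U" "\<phi> \<in> U" for U
    unfolding frequently_def
  proof
    assume "\<forall>\<^sub>F m in F. u m \<notin> U"
    then have "\<forall>\<^sub>F m in G. u m \<notin> U" by (rule filter_leD[OF G(2)])
    with ev[OF that] have "\<forall>\<^sub>F m in G. False" by eventually_elim simp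
    with G(1) show False by simp
  qed
  then show ?l using \<phi> unfolding cluster_points_def by simp
qed

end

theorem theorem3p2:
  fixes p s :: real and z :: "nat \<Rightarrow> complex"
  assumes "1 < p" and "z \<in> lp_ball p"
    and "s = (1 - lp_norm p z powr p) powr (1 / p)"
  shows "{P \<in> gleason_part p ` Au_spectrum p. P \<subseteq> Au_fiber p z} \<approx> (UNIV :: real set set)
    \<and> wstar_ac p z s \<subseteq> Au_fiber p z
    \<and> wstar_ac p z s \<approx> (UNIV :: real set set)
    \<and> (\<forall>\<phi>\<in>wstar_ac p z s. \<forall>\<psi>\<in>wstar_ac p z s. \<phi> \<noteq> \<psi> \<longrightarrow> gleason_part p \<phi> \<noteq> gleason_part p \<psi>)
    \<and> (\<forall>\<phi>\<in>wstar_ac p z s. gleason_part p \<phi> \<subseteq> Au_fiber p z)"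
proof -
  note A = assms
  define n where "n = nat \<lceil>p\<rceil>"
  have n: "p \<le> real n" unfolding n_def by linarith
  have u: "evaluation p (sphere_seq z s m) \<in> Au_spectrum p" for m
    by (rule evaluation_in_spectrum[OF A(1) sphere_seq_lp[OF A]])
  have ac: "\<phi> \<in> wstar_ac p z s \<longleftrightarrow> (\<exists>F. limit_character p z s \<phi> F)" for \<phi>
    unfolding wstar_ac_def sphere_seq_def[symmetric] cluster_points_wstar_iff[OF A(1), where u = "\<lambda>m. evaluation p (sphere_seq z s m)", OF u]
      limit_character_def by blast
  have distinct: "gleason_part p \<phi> \<noteq> gleason_part p \<psi>"
    if \<phi>: "\<phi> \<in> wstar_ac p z s" and \<psi>: "\<psi> \<in> wstar_ac p z s" and ne: "\<phi> \<noteq> \<psi>" for \<phi> \<psi>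
  proof -
    obtain F where F: "limit_character p z s \<phi> F" using \<phi> ac by blast
    obtain G where G: "limit_character p z s \<psi> G" using \<psi> ac by blast
    show ?thesis by (rule distinct_limit_characters[OF A n refl F G ne])
  qed
  have fiber: "gleason_part p \<phi> \<subseteq> Au_fiber p z" if \<phi>: "\<phi> \<in> wstar_ac p z s" for \<phi>
  proof -
    obtain F where F: "limit_character p z s \<phi> F" using \<phi> ac by blast
    show ?thesis by (rule gleason_part_subset_fiber[OF A n refl F])
  qed
  have spec: "wstar_ac p z s \<subseteq> Au_spectrum p"
    using ac unfolding limit_character_def by blast
  \<comment> \<open>Each cluster point belongs to its own Gleason part, so the inclusion of parts
    gives the inclusion of points.\<close>
  have sub: "wstar_ac p z s \<subseteq> Au_fiber p z"
    using fiber mem_gleason_part_self[OF A n refl] spec by blast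
  \<comment> \<open>One cluster point for every set of reals: compactness provides it, and a filter
    finer than \<open>independent_filter T\<close> remembers \<open>T\<close> through the
    independent sets.\<close>
  have "\<exists>\<phi> F. limit_character p z s \<phi> F \<and> F \<le> independent_filter T" for T
  proof -
    obtain \<phi> F where "\<phi> \<in> Au_spectrum p" "F \<noteq> bot" "F \<le> independent_filter T"
      "\<And>f. f \<in> Au p \<Longrightarrow> ((\<lambda>m. evaluation p (sphere_seq z s m) f) \<longlongrightarrow> \<phi> f) F"
      using spectrum_cluster[where u = "\<lambda>m. evaluation p (sphere_seq z s m)", OF A(1) independent_filter(1)[of T] u] by blast
    moreover have "F \<le> sequentially" if "F \<le> independent_filter T"
      using that independent_filter(2) by (rule order_trans)
    ultimately show ?thesis unfolding limit_character_def by blast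
  qed
  then have "\<exists>\<Phi>. \<forall>T. \<exists>F. limit_character p z s (\<Phi> T) F \<and> F \<le> independent_filter T"
    by (intro choice allI)
  then obtain \<Phi> where \<Phi>: "\<And>T. \<exists>F. limit_character p z s (\<Phi> T) F \<and> F \<le> independent_filter T" by blast
  \<comment> \<open>A real that lies in \<open>T\<close> but not in \<open>T'\<close> names an
    independent set that separates the two filters.\<close>
  have sep: "gleason_part p (\<Phi> T) \<noteq> gleason_part p (\<Phi> T')" if t: "t \<in> T" "t \<notin> T'" for t T T'
  proof -
    obtain F where F: "limit_character p z s (\<Phi> T) F" "F \<le> independent_filter T" using \<Phi> by blast
    obtain G where G: "limit_character p z s (\<Phi> T') G" "G \<le> independent_filter T'" using \<Phi> by blast
    show ?thesis
    proof (rule limit_characters_separated[OF A n refl F(1) G(1)])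
      show "\<forall>\<^sub>F m in F. m \<in> independent_set t"
        using filter_leD[OF F(2) independent_filter(3)[of t T]] t by simp
      show "\<forall>\<^sub>F m in G. m \<notin> independent_set t"
        using filter_leD[OF G(2) independent_filter(3)[of t T']] t by simp
    qed
  qed
  have inj: "inj (\<lambda>T. gleason_part p (\<Phi> T))"
  proof (rule injI)
    fix T T' assume "gleason_part p (\<Phi> T) = gleason_part p (\<Phi> T')"
    then show "T = T'" using sep[of _ T T'] sep[of _ T' T] by auto
  qed
  have \<Phi>ac: "\<Phi> T \<in> wstar_ac p z s" for T using \<Phi> ac by blast
  have "inj \<Phi>" using inj by (auto simp: inj_def)
  then have "(UNIV :: real set set) \<lesssim> wstar_ac p z s"
    unfolding lepoll_def using \<Phi>ac by blast
  moreover have "wstar_ac p z s \<lesssim> (UNIV :: real set set)"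
    by (rule lepoll_trans[OF subset_imp_lepoll[OF spec] spectrum_lepoll[OF A(1)]])
  ultimately have card_ac: "wstar_ac p z s \<approx> (UNIV :: real set set)"
    by (intro lepoll_antisym)
  \<comment> \<open>The same family counts the parts: those of the chosen points are pairwise
    distinct and lie in the fiber, and there are no more parts than characters.\<close>
  have "(\<lambda>T. gleason_part p (\<Phi> T)) ` UNIV \<subseteq> {P \<in> gleason_part p ` Au_spectrum p. P \<subseteq> Au_fiber p z}"
    using fiber \<Phi>ac spec by blast
  with inj have "(UNIV :: real set set) \<lesssim> {P \<in> gleason_part p ` Au_spectrum p. P \<subseteq> Au_fiber p z}"
    unfolding lepoll_def by blast
  moreover have "{P \<in> gleason_part p ` Au_spectrum p. P \<subseteq> Au_fiber p z} \<lesssim> gleason_part p ` Au_spectrum p"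
    by (rule subset_imp_lepoll) blast
  then have "{P \<in> gleason_part p ` Au_spectrum p. P \<subseteq> Au_fiber p z} \<lesssim> (UNIV :: real set set)"
    by (rule lepoll_trans[OF lepoll_trans[OF _ image_lepoll] spectrum_lepoll[OF A(1)]])
  ultimately have "{P \<in> gleason_part p ` Au_spectrum p. P \<subseteq> Au_fiber p z} \<approx> (UNIV :: real set set)"
    by (intro lepoll_antisym)
  with sub card_ac distinct fiber show ?thesis by blast
qed

end
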